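(* Let $\rho\colon G_{\widehat I}\to\mathbb{U}_n$ be a globalization for the $I$-indexed Kummer linking structure $\mathcal{G}_{\widehat I,I}$ of $F$ unramified outside $\widehat I$, and let $E_\rho$ be the associated Galois extension of $F$. Then: (a) If $i\in I$, then the valuation $v_i$ (if $i\in J_{\mathrm{val}}$), resp. the ordering $P_i$ (if $i\in J_{\mathrm{ord}}$), ramifies in the extension $E_\rho/F$, and the image of $T_i$ in $\mathrm{Gal}(E_\rho/F)$ is isomorphic to $\mathbb{Z}/q$. (b) If $j\in J\setminus\widehat I$, then the valuation $v_j$, resp. the ordering $P_j$, is unramified in $E_\rho/F$.
   Context: Field-theoretic setup. Let $p$ be a prime, $q>1$ a $p$-power, and $F$ a field containing a root of unity of (exact) order $q$; fix an isomorphism $\mu_q\cong\mathbb{Z}/q$. $F(p)$ is the maximal pro-$p$ Galois extension of $F$ and $G=\mathrm{Gal}(F(p)/F)$. Let $v_j$, $j\in J_{\mathrm{val}}$, be non-equivalent non-trivial (Krull) valuations on $F$; for each fix an extension $u_j$ to $F(p)$, and let $Z_j=\{\sigma\in G:u_j\circ\sigma=u_j\}$ and $T_j=\{\sigma\in G:\forall a\in O_{u_j}\ u_j(\sigma(a)-a)>0\}$ be its decomposition and inertia groups over $F$. If $p=2$, let $P_j$, $j\in J_{\mathrm{ord}}$, be distinct orderings on $F$ (additively closed subgroups of $F^\times$ of index $2$); for each choose a relative real closure $F_{P_j}$ of $F$ in $F(2)$ at $P_j$ (a maximal extension of $F$ in $F(2)$ having an ordering that extends $P_j$), and set $Z_j=T_j=\mathrm{Gal}(F(2)/F_{P_j})\cong\mathbb{Z}/2$.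 If $p\ne2$, $J_{\mathrm{ord}}=\emptyset$. Let $J$ be the disjoint union of $J_{\mathrm{val}}$ and $J_{\mathrm{ord}}$. Let $I=\{i_1,\ldots,i_n\}\subseteq J$ consist of $n\ge1$ distinct elements, $I_{\mathrm{val}}=I\cap J_{\mathrm{val}}$, $I_{\mathrm{ord}}=I\cap J_{\mathrm{ord}}$, such that for $i\in I_{\mathrm{val}}$ the valuation $v_i$ is discrete (value group $\mathbb{Z}$) with residue characteristic $\ne p$, and such that $v_i$ ($i\in I_{\mathrm{val}}$), $P_i$ ($i\in I_{\mathrm{ord}}$) are independent (induce distinct topologies on $F$). Then $Z_i=T_i\rtimes\bar Z_i$ with $\bar Z_i=Z_i/T_i$ for $i\in I$. Choose $t_i\in F^\times$ ($i\in I$) such that $t_i$ is a uniformizer for $v_i$ if $i\in I_{\mathrm{val}}$; $t_i\in-P_i$ if $i\in I_{\mathrm{ord}}$; $t_i$ is a $v_{i'}$-unit for all $i\ne i'\in I_{\mathrm{val}}$; and $t_i\in P_{i'}$ for all $i\neq i'\in I_{\mathrm{ord}}$ (such elements exist). Let $\bar\pi_i=\kappa_{t_i}\colon T_i\to\mu_q\cong\mathbb{Z}/q$ be the Kummer map $\sigma\mapsto\sigma(\sqrt[q]{t_i})/\sqrt[q]{t_i}$; it is surjective and independent of the choice of $t_i$. Let $\mathbb{U}_n$ be the group of unipotent upper-triangular $(n+1)\times(n+1)$ matrices over $\mathbb{Z}/q$ and define $\pi_i\colon T_i\to\mathbb{U}_n$, $\pi_i(\tau)=\mathrm{Id}+\bar\pi_i(\tau)E_{l,l+1}$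 for $i=i_l$. Let $I\subseteq\widehat I\subseteq J$, let $N_{\widehat I}$ be the closed normal subgroup of $G$ generated by $T_j$, $j\in J\setminus\widehat I$, and $G_{\widehat I}=G/N_{\widehat I}$, with natural maps $\mathrm{res}_j\colon Z_j\to G_{\widehat I}$. Assume that the images of $T_i$, $i\in I$, generate $G_{\widehat I}$ as a pro-$p$ group. The $I$-indexed Kummer linking structure of $F$ unramified outside $\widehat I$ is $\mathcal{G}_{\widehat I,I}=(G_{\widehat I},\mathbb{U}_n,Z_i,T_i,\mathrm{res}_i,\pi_i)_{i\in I}$; a globalization for it is a pro-$p$ homomorphism $\rho\colon G_{\widehat I}\to\mathbb{U}_n$ with $\rho\circ\mathrm{res}_i=\pi_i$ on $T_i$ for all $i\in I$. $E_\rho$ is the fixed field in $F(p)$ of the kernel of $G\to G_{\widehat I}\xrightarrow{\rho}\mathbb{U}_n$; it is a Galois extension of $F$. For a pro-$p$ Galois extension $F'$ of $F$ inside $F(p)$, the valuation $v_j$ (resp. ordering $P_j$) is unramified in $F'$ if $T_j$ fixes $F'$, and ramifies otherwise (independent of the choices of $u_j$, $F_{P_j}$). *)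

theory Defs
  imports
    "HOL-Algebra.Algebra"
    "HOL-Algebra.Algebraic_Closure_Type"
    "HOL-Analysis.Abstract_Topology"
    "Jordan_Normal_Form.Matrix"
    "Berlekamp_Zassenhaus.Finite_Field"
begin

section \<open>Galois extensions inside an algebraically closed field\<close>

text \<open>
  All fields are subfields of a type of class \<open>alg_closed_field\<close>. For a base field given as a type,
  the type \<open>alg_closure\<close> with the subfield \<open>range to_ac\<close> provides such a setting.
\<close>

abbreviation ambient :: "'a::field ring" (\<open>\<Omega>\<close>)
  where "\<Omega> \<equiv> ring_of_type_algebra"

definition galois_group :: "'a::field set \<Rightarrow> 'a set \<Rightarrow> ('a \<Rightarrow> 'a) monoid"
  where "galois_group L K = (BijGroup L)\<lparr>carrier :=
    {\<sigma> \<in> Bij L. (\<forall>x\<in>L. \<forall>y\<in>L. \<sigma> (x + y) = \<sigma> x + \<sigma> y \<and> \<sigma> (x * y) = \<sigma> x * \<sigma> y) \<and> (\<forall>x\<in>K. \<sigma> x = x)}\<rparr>"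

definition fixed_field :: "'a set \<Rightarrow> ('a \<Rightarrow> 'a) set \<Rightarrow> 'a set"
  where "fixed_field L H = {x \<in> L. \<forall>\<sigma>\<in>H. \<sigma> x = x}"

definition galois_extension :: "'a::field set \<Rightarrow> 'a set \<Rightarrow> bool"
  where "galois_extension L K \<longleftrightarrow> subfield K \<Omega> \<and> subfield L \<Omega> \<and> K \<subseteq> L \<and>
    (\<forall>x\<in>L. ring.algebraic \<Omega> K x) \<and> fixed_field L (carrier (galois_group L K)) = K"

definition krull_topology :: "'a::field set \<Rightarrow> 'a set \<Rightarrow> ('a \<Rightarrow> 'a) topology"
  where "krull_topology L K = topology_generated_by
    {\<sigma> <#\<^bsub>galois_group L K\<^esub> carrier (galois_group L E) | \<sigma> E.
      \<sigma> \<in> carrier (galois_group L K) \<and> subfield E \<Omega> \<and> K \<subseteq> E \<and> E \<subseteq> L \<and> ring.finite_dimension \<Omega> K E}"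

text \<open>A Galois group, being profinite, is pro-p when all its open normal subgroups have p-power index.
  An infinite index has \<open>card\<close> equal to 0 and is thus excluded.\<close>

definition pro_p_galois_extension :: "nat \<Rightarrow> 'a::field set \<Rightarrow> 'a set \<Rightarrow> bool"
  where "pro_p_galois_extension p L K \<longleftrightarrow> galois_extension L K \<and>
    (\<forall>N. N \<lhd> galois_group L K \<and> openin (krull_topology L K) N \<longrightarrow>
      (\<exists>k. card (rcosets\<^bsub>galois_group L K\<^esub> N) = p ^ k))"

definition maximal_pro_p_galois_extension :: "nat \<Rightarrow> 'a::field set \<Rightarrow> 'a set \<Rightarrow> bool"
  where "maximal_pro_p_galois_extension p L K \<longleftrightarrow> pro_p_galois_extension p L K \<and>
    (\<forall>M. pro_p_galois_extension p M K \<longrightarrow> M \<subseteq> L)"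

lemma subgroup_galois_group:
  fixes L K :: "'a::field set"
  assumes "subfield L \<Omega>" "K \<subseteq> L"
  shows "subgroup (carrier (galois_group L K)) (BijGroup L)"
proof -
  interpret B: group "BijGroup L" by (rule group_BijGroup)
  have cl: "x + y \<in> L" "x * y \<in> L" if "x \<in> L" "y \<in> L" for x y
    using subringE(6,7)[OF subfieldE(1)[OF assms(1)], of x y] that
    by (auto simp: ring_of_type_algebra_def)
  have K: "x \<in> L" if "x \<in> K" for x using assms(2) that by blast
  show ?thesis
  proof (rule B.subgroupI, goal_cases)
    case 1 show ?case by (auto simp: galois_group_def BijGroup_def)
  next
    case 2
    have "(\<lambda>x\<in>L. x) \<in> carrier (galois_group L K)"
      by (auto simp: galois_group_def id_Bij cl K)
    then show ?case by blast
  next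
    case (3 \<sigma>)
    then have \<sigma>: "\<sigma> \<in> Bij L"
      and hom: "\<And>x y. x \<in> L \<Longrightarrow> y \<in> L \<Longrightarrow> \<sigma> (x + y) = \<sigma> x + \<sigma> y \<and> \<sigma> (x * y) = \<sigma> x * \<sigma> y"
      and fx: "\<And>x. x \<in> K \<Longrightarrow> \<sigma> x = x"
      by (auto simp: galois_group_def)
    have bij: "bij_betw \<sigma> L L" using \<sigma> by (simp add: Bij_def)
    let ?i = "inv_into L \<sigma>"
    have inL: "?i x \<in> L" if "x \<in> L" for x using Bij_inv_into_mem[OF \<sigma> that] .
    have r: "\<sigma> (?i x) = x" if "x \<in> L" for x using bij_betw_inv_into_right[OF bij that] .
    have l: "?i (\<sigma> x) = x" if "x \<in> L" for x using bij_betw_inv_into_left[OF bij that] .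
    have a: "?i (x + y) = ?i x + ?i y" if "x \<in> L" "y \<in> L" for x y
      using l[of "?i x + ?i y"] hom[of "?i x" "?i y"] that by (simp add: inL r cl)
    have m: "?i (x * y) = ?i x * ?i y" if "x \<in> L" "y \<in> L" for x y
      using l[of "?i x * ?i y"] hom[of "?i x" "?i y"] that by (simp add: inL r cl)
    have f: "?i x = x" if "x \<in> K" for x using l[OF K[OF that]] fx[OF that] by simp
    show ?case using \<sigma>
      by (auto simp: inv_BijGroup galois_group_def restrict_inv_into_Bij cl K a m f)
  next
    case (4 \<sigma> \<tau>)
    then have "\<sigma> \<in> Bij L" "\<tau> \<in> Bij L" by (auto simp: galois_group_def)
    moreover have "\<And>x. x \<in> L \<Longrightarrow> \<tau> x \<in> L" using \<open>\<tau> \<in> Bij L\<close> by (auto dest: Bij_imp_funcset)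
    ultimately show ?case using 4
      by (auto simp: BijGroup_def galois_group_def compose_Bij[unfolded compose_def] compose_def cl K)
  qed
qed

lemma group_galois_group:
  fixes L K :: "'a::field set"
  assumes "subfield L \<Omega>" "K \<subseteq> L"
  shows "group (galois_group L K)"
proof -
  have "galois_group L K = (BijGroup L)\<lparr>carrier := carrier (galois_group L K)\<rparr>"
    by (simp add: galois_group_def)
  then show ?thesis
    using subgroup.subgroup_is_group[OF subgroup_galois_group[OF assms] group_BijGroup] by simp
qed


section \<open>Topological groups\<close>

definition closed_normal_closure :: "('g, 'm) monoid_scheme \<Rightarrow> 'g topology \<Rightarrow> 'g set \<Rightarrow> 'g set"
  where "closed_normal_closure G tp S = \<Inter>{N. N \<lhd> G \<and> closedin tp N \<and> S \<subseteq> N}"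

text \<open>The preimage in the group of a set \<open>U\<close> of cosets is \<open>\<Union>U\<close>.\<close>

definition quotient_topology :: "('g, 'm) monoid_scheme \<Rightarrow> 'g topology \<Rightarrow> 'g set \<Rightarrow> 'g set topology"
  where "quotient_topology G tp N = topology (\<lambda>U. U \<subseteq> carrier (G Mod N) \<and> openin tp (\<Union>U))"

lemma openin_quotient_topology:
  assumes "N \<lhd> G"
  shows "openin (quotient_topology G tp N) U \<longleftrightarrow> U \<subseteq> carrier (G Mod N) \<and> openin tp (\<Union>U)"
proof -
  interpret normal N G by (rule assms)
  have "istopology (\<lambda>U. U \<subseteq> carrier (G Mod N) \<and> openin tp (\<Union>U))"
    unfolding istopology_def
  proof (intro conjI allI impI, goal_cases)
    case (2 S T)
    have "\<Union>(S \<inter> T) = \<Union>S \<inter> \<Union>T"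
    proof
      show "\<Union>S \<inter> \<Union>T \<subseteq> \<Union>(S \<inter> T)"
      proof
        fix x assume "x \<in> \<Union>S \<inter> \<Union>T"
        then obtain A B where AB: "A \<in> S" "B \<in> T" "x \<in> A" "x \<in> B" by blast
        then have "A \<in> rcosets\<^bsub>G\<^esub> N" "B \<in> rcosets\<^bsub>G\<^esub> N" using 2 by (auto simp: FactGroup_def)
        then have "A = B" using rcos_disjoint[OF subgroup_axioms] AB
          by (auto simp: pairwise_def disjnt_iff)
        then show "x \<in> \<Union>(S \<inter> T)" using AB by blast
      qed
    qed blast
    then show ?case using 2 by auto
  next
    case (4 \<C>)
    have "\<Union>(\<Union>\<C>) = \<Union>(Union ` \<C>)" by blast
    moreover have "openin tp (\<Union>(Union ` \<C>))" using 4 by (intro openin_Union) auto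
    ultimately show ?case by simp
  qed blast+
  then show ?thesis by (simp add: quotient_topology_def topology_inverse')
qed


section \<open>Valuations\<close>

text \<open>
  A valuation on a subfield \<open>K\<close> is given by its values on \<open>K - {0}\<close>; its value at 0, which would be
  infinite, is never used. The value group is the image of \<open>K - {0}\<close>, which may be a proper subgroup of
  the type \<open>'g\<close>; so families of valuations with different value groups can share one type \<open>'g\<close>
  into which all these groups embed.
\<close>

definition valuation :: "'a::field set \<Rightarrow> ('a \<Rightarrow> 'g::linordered_ab_group_add) \<Rightarrow> bool"
  where "valuation K w \<longleftrightarrow> (\<forall>x\<in>K - {0}. \<forall>y\<in>K - {0}.
    w (x * y) = w x + w y \<and> (x + y \<noteq> 0 \<longrightarrow> min (w x) (w y) \<le> w (x + y)))"

definition nontrivial_valuation :: "'a::field set \<Rightarrow> ('a \<Rightarrow> 'g::linordered_ab_group_add) \<Rightarrow> bool"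
  where "nontrivial_valuation K w \<longleftrightarrow> (\<exists>x\<in>K - {0}. w x \<noteq> 0)"

definition valuation_ring :: "'a::field set \<Rightarrow> ('a \<Rightarrow> 'g::linordered_ab_group_add) \<Rightarrow> 'a set"
  where "valuation_ring K w = {x \<in> K. x = 0 \<or> 0 \<le> w x}"

definition valuation_ideal :: "'a::field set \<Rightarrow> ('a \<Rightarrow> 'g::linordered_ab_group_add) \<Rightarrow> 'a set"
  where "valuation_ideal K w = {x \<in> K. x = 0 \<or> 0 < w x}"

definition equivalent_valuations ::
  "'a::field set \<Rightarrow> ('a \<Rightarrow> 'g::linordered_ab_group_add) \<Rightarrow> ('a \<Rightarrow> 'g) \<Rightarrow> bool"
  where "equivalent_valuations K w w' \<longleftrightarrow> valuation_ring K w = valuation_ring K w'"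

definition residue_field :: "'a::field set \<Rightarrow> ('a \<Rightarrow> 'g::linordered_ab_group_add) \<Rightarrow> 'a set ring"
  where "residue_field K w = (\<Omega>\<lparr>carrier := valuation_ring K w\<rparr>) Quot (valuation_ideal K w)"

definition residue_char :: "'a::field set \<Rightarrow> ('a \<Rightarrow> 'g::linordered_ab_group_add) \<Rightarrow> nat"
  where "residue_char K w =
    Gcd {m. [m] \<cdot>\<^bsub>residue_field K w\<^esub> \<one>\<^bsub>residue_field K w\<^esub> = \<zero>\<^bsub>residue_field K w\<^esub>}"

definition discrete_valuation :: "'a::field set \<Rightarrow> ('a \<Rightarrow> 'g::linordered_ab_group_add) \<Rightarrow> bool"
  where "discrete_valuation K w \<longleftrightarrow> valuation K w \<and>
    (\<exists>f :: int \<Rightarrow> 'g. (\<forall>a b. f (a + b) = f a + f b) \<and> strict_mono f \<and> w ` (K - {0}) = range f)"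

definition uniformizer :: "'a::field set \<Rightarrow> ('a \<Rightarrow> 'g::linordered_ab_group_add) \<Rightarrow> 'a \<Rightarrow> bool"
  where "uniformizer K w t \<longleftrightarrow> t \<in> K - {0} \<and> 0 < w t \<and> (\<forall>x\<in>K - {0}. 0 < w x \<longrightarrow> w t \<le> w x)"

definition valuation_topology :: "'a::field set \<Rightarrow> ('a \<Rightarrow> 'g::linordered_ab_group_add) \<Rightarrow> 'a topology"
  where "valuation_topology K w =
    topology_generated_by {{x \<in> K. x = a \<or> w b < w (x - a)} | a b. a \<in> K \<and> b \<in> K - {0}}"

definition decomposition_group ::
  "'a::field set \<Rightarrow> 'a set \<Rightarrow> ('a \<Rightarrow> 'g::linordered_ab_group_add) \<Rightarrow> ('a \<Rightarrow> 'a) set"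
  where "decomposition_group L K w = {\<sigma> \<in> carrier (galois_group L K). \<forall>x\<in>L - {0}. w (\<sigma> x) = w x}"

definition inertia_group ::
  "'a::field set \<Rightarrow> 'a set \<Rightarrow> ('a \<Rightarrow> 'g::linordered_ab_group_add) \<Rightarrow> ('a \<Rightarrow> 'a) set"
  where "inertia_group L K w =
    {\<sigma> \<in> carrier (galois_group L K). \<forall>a\<in>valuation_ring L w. \<sigma> a - a = 0 \<or> 0 < w (\<sigma> a - a)}"


section \<open>Orderings\<close>

definition field_ordering :: "'a::field set \<Rightarrow> 'a set \<Rightarrow> bool"
  where "field_ordering K P \<longleftrightarrow> subgroup P (mult_of (\<Omega>\<lparr>carrier := K\<rparr>)) \<and>
    card (rcosets\<^bsub>mult_of (\<Omega>\<lparr>carrier := K\<rparr>)\<^esub> P) = 2 \<and> (\<forall>x\<in>P. \<forall>y\<in>P. x + y \<in> P)"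

definition ordering_topology :: "'a::field set \<Rightarrow> 'a set \<Rightarrow> 'a topology"
  where "ordering_topology K P =
    topology_generated_by {{x \<in> K. x - a \<in> P \<and> b - x \<in> P} | a b. a \<in> K \<and> b \<in> K}"

definition ordering_extends_to :: "'a::field set \<Rightarrow> 'a set \<Rightarrow> 'a set \<Rightarrow> bool"
  where "ordering_extends_to K P M \<longleftrightarrow> (\<exists>Q. field_ordering M Q \<and> Q \<inter> K = P)"

definition relative_real_closure :: "'a::field set \<Rightarrow> 'a set \<Rightarrow> 'a set \<Rightarrow> 'a set \<Rightarrow> bool"
  where "relative_real_closure L K P R \<longleftrightarrow>
    subfield R \<Omega> \<and> K \<subseteq> R \<and> R \<subseteq> L \<and> ordering_extends_to K P R \<and>
    (\<forall>M. subfield M \<Omega> \<and> R \<subseteq> M \<and> M \<subseteq> L \<and> ordering_extends_to K P M \<longrightarrow> M = R)"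


section \<open>Kummer maps and unipotent matrices\<close>

definition primitive_root_of_unity :: "nat \<Rightarrow> 'a::field \<Rightarrow> bool"
  where "primitive_root_of_unity q z \<longleftrightarrow> z ^ q = 1 \<and> (\<forall>k. 0 < k \<and> k < q \<longrightarrow> z ^ k \<noteq> 1)"

definition roots_of_unity_group :: "nat \<Rightarrow> 'a::field set \<Rightarrow> 'a monoid"
  where "roots_of_unity_group q K = (mult_of \<Omega>)\<lparr>carrier := {x \<in> K. x ^ q = 1}\<rparr>"

text \<open>When \<open>K\<close> contains the \<open>q\<close>-th roots of unity and \<open>\<sigma>\<close> fixes them, the value does not depend on
  the chosen \<open>q\<close>-th root \<open>r\<close> in \<open>L\<close> of \<open>t\<close>.\<close>

definition kummer_map :: "'a::field set \<Rightarrow> nat \<Rightarrow> 'a \<Rightarrow> ('a \<Rightarrow> 'a) \<Rightarrow> 'a"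
  where "kummer_map L q t \<sigma> = (let r = (SOME r. r \<in> L \<and> r ^ q = t) in \<sigma> r / r)"

definition unipotent_group :: "nat \<Rightarrow> 'r::comm_ring_1 mat monoid"
  where "unipotent_group n =
    \<lparr>carrier = {A \<in> carrier_mat (n + 1) (n + 1). upper_triangular A \<and> (\<forall>i\<le>n. A $$ (i, i) = 1)},
     monoid.mult = (*), one = 1\<^sub>m (n + 1)\<rparr>"

text \<open>Rows and columns are numbered from 0.\<close>

definition elementary_matrix :: "nat \<Rightarrow> nat \<Rightarrow> nat \<Rightarrow> 'r::comm_ring_1 mat"
  where "elementary_matrix m k l = mat m m (\<lambda>(r, c). if r = k \<and> c = l then 1 else 0)"


section \<open>Linking structures\<close>

record ('g, 'h, 'z, 'j) linking_structure =
  index_set :: "'j set"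
  global_group :: "'g monoid"
  global_topology :: "'g topology"
  target_group :: "'h monoid"
  local_group :: "'j \<Rightarrow> 'z monoid"
  local_inertia :: "'j \<Rightarrow> 'z set"
  local_res :: "'j \<Rightarrow> 'z \<Rightarrow> 'g"
  local_map :: "'j \<Rightarrow> 'z \<Rightarrow> 'h"

text \<open>The target group is finite here, hence carries the discrete topology.\<close>

definition globalization :: "('g, 'h, 'z, 'j) linking_structure \<Rightarrow> ('g \<Rightarrow> 'h) \<Rightarrow> bool"
  where "globalization S \<rho> \<longleftrightarrow>
    \<rho> \<in> hom (global_group S) (target_group S) \<and>
    continuous_map (global_topology S) (discrete_topology (carrier (target_group S))) \<rho> \<and>
    (\<forall>i\<in>index_set S. \<forall>\<tau>\<in>local_inertia S i. \<rho> (local_res S i \<tau>) = local_map S i \<tau>)"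

text \<open>
  Here \<open>T\<close> is the inertia group of a valuation or ordering of the base field, as a subgroup of the
  Galois group of a field containing \<open>E\<close>.
\<close>

definition unramified_in :: "('a \<Rightarrow> 'a) set \<Rightarrow> 'a set \<Rightarrow> bool"
  where "unramified_in T E \<longleftrightarrow> (\<forall>\<sigma>\<in>T. \<forall>x\<in>E. \<sigma> x = x)"

end

theory Submission
  imports Defs "HOL-Analysis.Function_Topology"
begin

text \<open>
  Let \<open>G\<close> be the Galois group of \<open>F(p)\<close> over \<open>F\<close> and \<open>KK\<close> the kernel of the composite of \<open>G \<rightarrow> G/N\<close>
  with \<open>\<rho>\<close>, so that \<open>E\<close> is the fixed field of \<open>KK\<close>. As \<open>\<rho>\<close> is continuous with discrete target, \<open>KK\<close> is
  open, and by the Galois correspondence (\<open>fixed_field_open_subgroup\<close>) an automorphism fixes \<open>E\<close> if and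
  only if it lies in \<open>KK\<close>. For \<open>j\<close> outside \<open>Ihat\<close> the group \<open>T j\<close> is contained in \<open>N\<close>, hence in \<open>KK\<close>: this
  is part (b). For \<open>i\<close> in \<open>I\<close>, two elements of \<open>T i\<close> have the same restriction to \<open>E\<close> if and only if \<open>\<rho>\<close>,
  and that means \<open>\<pi> i\<close>, agrees on them, if and only if they have the same Kummer value. So the image of
  \<open>T i\<close> in the Galois group of \<open>E\<close> is isomorphic to the image of the Kummer character of \<open>T i\<close>, and part
  (a) says that this character is onto the group of \<open>q\<close>-th roots of unity.

  Let \<open>r\<close> be a \<open>q\<close>-th root of \<open>t i\<close>; it lies in \<open>F(p)\<close> because \<open>F(r)\<close> is Galois over \<open>F\<close> of \<open>p\<close>-power
  degree (\<open>kummer_radical_in_pro_p\<close>). As \<open>q\<close> is a power of \<open>p\<close>, a character with values in the \<open>q\<close>-th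
  roots of unity is onto as soon as its power with exponent \<open>q / p\<close> is nontrivial; thus it suffices that
  some element of \<open>T i\<close> moves \<open>s = r ^ (q / p)\<close>, where \<open>s ^ p = t i\<close> (\<open>kummer_surjective\<close>).

  For an ordering, \<open>p = 2\<close> and \<open>s\<close> is a square root of a negative element, so it is outside the relative
  real closure; every element outside an intermediate field is moved by the Galois group over that field
  (\<open>moved_over_intermediate\<close>).

  For a valuation, let \<open>w\<close> be its extension to \<open>F(p)\<close> and suppose that the inertia group fixes \<open>s\<close>
  (\<open>tame_inertia_finite\<close>). Form the trace of \<open>c * s\<close> for the action through a finite quotient, a
  \<open>p\<close>-group. It is \<open>s\<close> times the sum of \<open>\<chi> \<sigma> * \<sigma> c\<close> over that quotient, where \<open>\<chi> \<sigma> = \<sigma> s / s\<close> is a root of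
  unity. Modulo the maximal ideal the summand depends only on the coset of \<open>\<sigma>\<close> modulo inertia, the cosets
  have \<open>p\<close>-power order, which is a unit because the residue characteristic is not \<open>p\<close>, and the characters
  \<open>c \<mapsto> \<sigma> c\<close> of different cosets are independent modulo the maximal ideal (\<open>dedekind_independence\<close>).
  Hence for a suitable \<open>c\<close> the sum is a unit. Then the trace, an element of \<open>F\<close>, has value
  \<open>w s = w t / p\<close>, which is positive and below the value of the uniformizer \<open>t\<close>: a contradiction. This
  finds inertia elements only up to finitely many conditions; compactness of the Galois group
  (\<open>Gal_compact\<close>) does the rest.
\<close>

section \<open>Subfields and algebraic elements\<close>

lemma ring_of_type_algebra_simps [simp]:
  "carrier (ring_of_type_algebra :: 'a::ring_1 ring) = UNIV"
  "monoid.mult (ring_of_type_algebra :: 'a ring) = (*)" "monoid.one (ring_of_type_algebra :: 'a ring) = 1"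
  "ring.zero (ring_of_type_algebra :: 'a ring) = 0" "ring.add (ring_of_type_algebra :: 'a ring) = (+)"
  by (simp_all add: ring_of_type_algebra_def)

lemma subfield_closed:
  fixes K :: "'a::field set"
  assumes "subfield K \<Omega>"
  shows "0 \<in> K" "1 \<in> K" "x \<in> K \<Longrightarrow> y \<in> K \<Longrightarrow> x + y \<in> K" "x \<in> K \<Longrightarrow> y \<in> K \<Longrightarrow> x * y \<in> K"
    "x \<in> K \<Longrightarrow> - x \<in> K" "x \<in> K \<Longrightarrow> y \<in> K \<Longrightarrow> x - y \<in> K" "x \<in> K \<Longrightarrow> inverse x \<in> K"
    "x \<in> K \<Longrightarrow> y \<in> K \<Longrightarrow> x / y \<in> K" "x \<in> K \<Longrightarrow> x ^ k \<in> K"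
proof -
  interpret R: field "\<Omega> :: 'a ring" by (rule field_from_type_algebra)
  have sr: "subring K \<Omega>" using subfieldE(1)[OF assms] .
  have um: "\<ominus>\<^bsub>\<Omega>\<^esub> x = - x" for x :: 'a
    using R.minus_equality[of "-x" x] by simp
  show *: "0 \<in> K" "1 \<in> K" "\<And>x y. x \<in> K \<Longrightarrow> y \<in> K \<Longrightarrow> x + y \<in> K"
    "\<And>x y. x \<in> K \<Longrightarrow> y \<in> K \<Longrightarrow> x * y \<in> K" "\<And>x. x \<in> K \<Longrightarrow> - x \<in> K"
    using subringE[OF sr] um by auto
  show "\<And>x y. x \<in> K \<Longrightarrow> y \<in> K \<Longrightarrow> x - y \<in> K" using *(3,5) by (metis diff_conv_add_uminus)
  show inv: "inverse x \<in> K" if "x \<in> K" for x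
  proof (cases "x = 0")
    case False
    then have "x \<in> Units (\<Omega>\<lparr>carrier := K\<rparr>)" using subfield.subfield_Units[OF assms] that by simp
    then obtain y where "y \<in> K" "y * x = 1" by (auto simp: Units_def)
    then show ?thesis by (metis inverse_unique mult.commute)
  qed (use * in simp)
  show "\<And>x y. x \<in> K \<Longrightarrow> y \<in> K \<Longrightarrow> x / y \<in> K" using inv *(4) by (simp add: divide_inverse)
  show "\<And>x k. x \<in> K \<Longrightarrow> x ^ k \<in> K" subgoal for x k by (induct k) (auto intro: *) done
qed

lemma subfield_sum_closed:
  fixes K :: "'a::field set"
  assumes "subfield K \<Omega>" "\<And>i. i \<in> I \<Longrightarrow> f i \<in> K"
  shows "(\<Sum>i\<in>I. f i) \<in> K"
  using assms(2) by (induct I rule: infinite_finite_induct) (auto intro: subfield_closed[OF assms(1)])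

lemma eval_ambient: "ring.eval (\<Omega> :: 'a::field ring) p x = poly (Poly (rev p)) x"
proof -
  interpret R: field "\<Omega> :: 'a ring" by (rule field_from_type_algebra)
  have pw: "x [^]\<^bsub>\<Omega>\<^esub> (k::nat) = x ^ k" for k by (induct k) (auto simp: mult.commute)
  show ?thesis
    by (induct p) (auto simp: Poly_append poly_monom pw)
qed

lemma algebraic_root:
  fixes K :: "'a::field set"
  assumes "subfield K \<Omega>" "ring.algebraic \<Omega> K x"
  obtains g :: "'a poly" where "g \<noteq> 0" "\<And>i. coeff g i \<in> K" "poly g x = 0"
proof -
  interpret R: field "\<Omega> :: 'a ring" by (rule field_from_type_algebra)
  obtain p where p: "p \<in> carrier (K[X]\<^bsub>\<Omega>\<^esub>)" "p \<noteq> []" "R.eval p x = 0"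
    using R.algebraicE[OF subfieldE(1)[OF assms(1)], of x] assms(2) by (auto simp: over_def)
  then have "polynomial\<^bsub>\<Omega>\<^esub> K p" by (simp add: univ_poly_def)
  then have *: "set p \<subseteq> K" "hd p \<noteq> 0" using p by (auto simp: polynomial_def)
  show ?thesis
  proof
    have "coeff (Poly (rev p)) (length p - 1) = hd p"
      using p(2) by (simp add: coeff_Poly_eq nth_default_def rev_nth hd_conv_nth)
    then show "Poly (rev p) \<noteq> 0" using *(2) by (metis coeff_0)
    show "coeff (Poly (rev p)) i \<in> K" for i
      using * subfield_closed(1)[OF assms(1)]
      by (auto simp: coeff_Poly_eq nth_default_def) (metis in_set_conv_nth length_rev set_rev subsetD)
    show "poly (Poly (rev p)) x = 0" using p(3) by (simp only: eval_ambient)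
  qed
qed


section \<open>Independence of characters modulo a prime ideal\<close>

text \<open>
  A prime ideal \<open>m\<close> of a subring \<open>A\<close>, as predicates on one ambient type. The two instances of interest are
  the zero ideal of a field and the maximal ideal of a valuation ring.
\<close>

locale prime_in_subring =
  fixes A m :: "'a::comm_ring_1 set"
  assumes A_one: "1 \<in> A" and A_add: "\<And>x y. x \<in> A \<Longrightarrow> y \<in> A \<Longrightarrow> x + y \<in> A"
    and A_uminus: "\<And>x. x \<in> A \<Longrightarrow> - x \<in> A" and A_mult: "\<And>x y. x \<in> A \<Longrightarrow> y \<in> A \<Longrightarrow> x * y \<in> A"
    and m_sub: "m \<subseteq> A" and m_zero: "0 \<in> m" and m_add: "\<And>x y. x \<in> m \<Longrightarrow> y \<in> m \<Longrightarrow> x + y \<in> m"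
    and m_mult: "\<And>x y. x \<in> A \<Longrightarrow> y \<in> m \<Longrightarrow> x * y \<in> m"
    and one_notin: "1 \<notin> m"
    and prime: "\<And>x y. x \<in> A \<Longrightarrow> y \<in> A \<Longrightarrow> x * y \<in> m \<Longrightarrow> x \<in> m \<or> y \<in> m"
begin

lemma A_diff: "x \<in> A \<Longrightarrow> y \<in> A \<Longrightarrow> x - y \<in> A"
  using A_add[of x "-y"] A_uminus by simp

lemma A_zero: "0 \<in> A" using m_zero m_sub by blast

lemma m_uminus: "x \<in> m \<Longrightarrow> - x \<in> m"
  using m_mult[of "-1" x] A_uminus A_one by simp

lemma m_diff: "x \<in> m \<Longrightarrow> y \<in> m \<Longrightarrow> x - y \<in> m"
  using m_add[of x "-y"] m_uminus by simp

lemma A_power: "x \<in> A \<Longrightarrow> x ^ k \<in> A"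
  by (induct k) (auto intro: A_one A_mult)

lemma A_sum: "(\<And>i. i \<in> I \<Longrightarrow> f i \<in> A) \<Longrightarrow> (\<Sum>i\<in>I. f i) \<in> A"
  by (induct I rule: infinite_finite_induct) (auto intro: A_zero A_add)

lemma m_sum: "(\<And>i. i \<in> I \<Longrightarrow> f i \<in> m) \<Longrightarrow> (\<Sum>i\<in>I. f i) \<in> m"
  by (induct I rule: infinite_finite_induct) (auto intro: m_zero m_add)

lemma A_of_nat: "of_nat k \<in> A"
  by (induct k) (auto intro: A_zero A_one A_add)

lemma of_nat_power_notin: "of_nat p \<notin> m \<Longrightarrow> of_nat (p ^ k) \<notin> m"
  using one_notin by (induct k) (auto dest!: prime[OF A_of_nat A_power[OF A_of_nat]])

text \<open>
  Dedekind's lemma. The usual shortening of a linear relation works modulo a prime ideal as well: it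
  multiplies the coefficients by differences of character values, and a difference that is not in \<open>m\<close> can
  be cancelled.
\<close>

lemma dedekind_independence:
  assumes M: "1 \<in> M" "\<And>x y. x \<in> M \<Longrightarrow> y \<in> M \<Longrightarrow> x * y \<in> M"
    and "finite I"
    and f: "\<And>i x. i \<in> I \<Longrightarrow> x \<in> M \<Longrightarrow> f i x \<in> A" "\<And>i. i \<in> I \<Longrightarrow> f i 1 = 1"
      "\<And>i x y. i \<in> I \<Longrightarrow> x \<in> M \<Longrightarrow> y \<in> M \<Longrightarrow> f i (x * y) = f i x * f i y"
    and distinct: "\<And>i j. i \<in> I \<Longrightarrow> j \<in> I \<Longrightarrow> i \<noteq> j \<Longrightarrow> \<exists>x\<in>M. f i x - f j x \<notin> m"
    and c: "\<And>i. i \<in> I \<Longrightarrow> c i \<in> A"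
    and rel: "\<And>x. x \<in> M \<Longrightarrow> (\<Sum>i\<in>I. c i * f i x) \<in> m"
    and "i \<in> I"
  shows "c i \<in> m"
  using assms(3-)
proof (induct I arbitrary: c i rule: finite_induct)
  case (insert j I)
  have fO: "\<And>i x. i \<in> insert j I \<Longrightarrow> x \<in> M \<Longrightarrow> f i x \<in> A" by (rule insert.prems(1))
  have cm: "c k \<in> m" if k: "k \<in> I" for k
  proof -
    obtain y where y: "y \<in> M" "f k y - f j y \<notin> m"
      using insert.prems(4)[of k j] k insert.hyps by auto
    \<comment> \<open>Evaluating at \<open>x * y\<close> and subtracting \<open>f j y\<close> times the value at \<open>x\<close> removes the term of \<open>j\<close>.\<close>
    have "c k * (f k y - f j y) \<in> m"
    proof (rule insert.hyps(3)[where c = "\<lambda>k. c k * (f k y - f j y)"])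
      show "(\<Sum>i\<in>I. c i * (f i y - f j y) * f i x) \<in> m" if x: "x \<in> M" for x
      proof -
        have "(\<Sum>i\<in>insert j I. c i * f i (x * y)) - f j y * (\<Sum>i\<in>insert j I. c i * f i x)
            = (\<Sum>i\<in>insert j I. c i * (f i y - f j y) * f i x)"
          unfolding sum_distrib_left sum_subtractf[symmetric]
          by (rule sum.cong) (auto simp: insert.prems(3) x y algebra_simps)
        also have "\<dots> = (\<Sum>i\<in>I. c i * (f i y - f j y) * f i x)" using insert.hyps by simp
        finally show ?thesis
          using m_diff[OF insert.prems(6)[of "x * y"] m_mult[OF fO[of j y] insert.prems(6)[of x]]] x y M(2)
          by simp
      qed
    qed (use insert.prems k y in \<open>auto intro!: A_mult A_diff\<close>)
    then show ?thesis using prime[of "c k" "f k y - f j y"] insert.prems k y by (auto intro!: A_diff)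
  qed
  have "c j = (\<Sum>i\<in>insert j I. c i * f i 1) - (\<Sum>i\<in>I. c i)"
    using insert.hyps by (simp add: insert.prems(2))
  moreover have "(\<Sum>i\<in>insert j I. c i * f i 1) \<in> m" using insert.prems(6) M(1) by blast
  ultimately have "c j \<in> m" using m_sum[of I c] cm m_diff by auto
  then show ?case using cm insert.prems by auto
qed simp

end

lemma prime_zero: "prime_in_subring UNIV {0 :: 'a::field}"
  by unfold_locales auto


section \<open>Galois groups acting on finitely many elements\<close>

locale galois =
  fixes L K :: "'a::field set"
  assumes galois: "galois_extension L K"
begin

abbreviation Gal :: "('a \<Rightarrow> 'a) set"
  where "Gal \<equiv> carrier (galois_group L K)"

abbreviation gal_mult :: "('a \<Rightarrow> 'a) \<Rightarrow> ('a \<Rightarrow> 'a) \<Rightarrow> 'a \<Rightarrow> 'a" (infixl \<open>\<star>\<close> 70)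
  where "\<sigma> \<star> \<tau> \<equiv> \<sigma> \<otimes>\<^bsub>galois_group L K\<^esub> \<tau>"

lemma L: "subfield L \<Omega>" and K: "subfield K \<Omega>" and K_sub: "K \<subseteq> L"
  and algebraic: "x \<in> L \<Longrightarrow> ring.algebraic \<Omega> K x"
  using galois by (auto simp: galois_extension_def)

lemmas L_closed = subfield_closed[OF L]
lemmas K_closed = subfield_closed[OF K]

text \<open>
  The finite quotients of the Galois group are handled by their action on a finite set \<open>Y\<close>: two
  automorphisms are identified if they agree on \<open>Y\<close>. The set \<open>determined Y\<close> takes the place of the field
  generated by \<open>Y\<close>; it is a monoid that contains \<open>Y\<close>, on which automorphisms that differ on \<open>Y\<close> are different
  characters. A transversal of \<open>S\<close> represents the finitely many restrictions to \<open>Y\<close> of elements of \<open>S\<close>.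
\<close>

definition agree :: "'a set \<Rightarrow> ('a \<Rightarrow> 'a) \<Rightarrow> ('a \<Rightarrow> 'a) \<Rightarrow> bool"
  where "agree Y f g = (\<forall>x\<in>Y. f x = g x)"

definition stabilizer :: "'a set \<Rightarrow> ('a \<Rightarrow> 'a) set"
  where "stabilizer Y = {\<sigma> \<in> Gal. \<forall>x\<in>Y. \<sigma> x = x}"

definition determined :: "'a set \<Rightarrow> 'a set"
  where "determined Y = {x \<in> L. \<forall>\<sigma>\<in>Gal. \<forall>\<tau>\<in>Gal. agree Y \<sigma> \<tau> \<longrightarrow> \<sigma> x = \<tau> x}"

definition transversal :: "('a \<Rightarrow> 'a) set \<Rightarrow> 'a set \<Rightarrow> ('a \<Rightarrow> 'a) set \<Rightarrow> bool"
  where "transversal S Y \<Gamma> \<longleftrightarrow> finite \<Gamma> \<and> \<Gamma> \<subseteq> S \<and> (\<forall>\<sigma>\<in>S. \<exists>\<gamma>\<in>\<Gamma>. agree Y \<sigma> \<gamma>)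
    \<and> (\<forall>\<gamma>\<in>\<Gamma>. \<forall>\<delta>\<in>\<Gamma>. agree Y \<gamma> \<delta> \<longrightarrow> \<gamma> = \<delta>)"

sublocale G: group "galois_group L K"
  by (rule group_galois_group[OF L K_sub])

lemma Gal_iff: "\<sigma> \<in> Gal \<longleftrightarrow> \<sigma> \<in> Bij L \<and>
    (\<forall>x\<in>L. \<forall>y\<in>L. \<sigma> (x + y) = \<sigma> x + \<sigma> y \<and> \<sigma> (x * y) = \<sigma> x * \<sigma> y) \<and> (\<forall>x\<in>K. \<sigma> x = x)"
  by (simp add: galois_group_def)

lemma comp_apply: "\<sigma> \<in> Gal \<Longrightarrow> \<tau> \<in> Gal \<Longrightarrow> x \<in> L \<Longrightarrow> (\<sigma> \<star> \<tau>) x = \<sigma> (\<tau> x)"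
  by (simp add: galois_group_def BijGroup_def compose_def)

lemma one_apply: "x \<in> L \<Longrightarrow> \<one>\<^bsub>galois_group L K\<^esub> x = x"
  by (auto simp: galois_group_def BijGroup_def)

lemma Gal_ext: "\<sigma> \<in> Gal \<Longrightarrow> \<tau> \<in> Gal \<Longrightarrow> (\<And>x. x \<in> L \<Longrightarrow> \<sigma> x = \<tau> x) \<Longrightarrow> \<sigma> = \<tau>"
  by (auto simp: Gal_iff Bij_def intro: extensionalityI)

lemma bij: "\<sigma> \<in> Gal \<Longrightarrow> bij_betw \<sigma> L L"
  by (simp add: Gal_iff Bij_def)

lemma app_closed: "\<sigma> \<in> Gal \<Longrightarrow> x \<in> L \<Longrightarrow> \<sigma> x \<in> L"
  using bij by (auto simp: bij_betw_def)

lemma app_inj: "\<sigma> \<in> Gal \<Longrightarrow> x \<in> L \<Longrightarrow> y \<in> L \<Longrightarrow> \<sigma> x = \<sigma> y \<longleftrightarrow> x = y"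
  using bij by (auto simp: bij_betw_def inj_on_def)

lemma app_fix: "\<sigma> \<in> Gal \<Longrightarrow> x \<in> K \<Longrightarrow> \<sigma> x = x"
  by (simp add: Gal_iff)

lemma app_add: "\<sigma> \<in> Gal \<Longrightarrow> x \<in> L \<Longrightarrow> y \<in> L \<Longrightarrow> \<sigma> (x + y) = \<sigma> x + \<sigma> y"
  and app_mult: "\<sigma> \<in> Gal \<Longrightarrow> x \<in> L \<Longrightarrow> y \<in> L \<Longrightarrow> \<sigma> (x * y) = \<sigma> x * \<sigma> y"
  by (simp_all add: Gal_iff)

lemma app_0: "\<sigma> \<in> Gal \<Longrightarrow> \<sigma> 0 = 0" and app_1: "\<sigma> \<in> Gal \<Longrightarrow> \<sigma> 1 = 1"
  using K_closed(1,2) by (auto intro: app_fix)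

lemma app_uminus: "\<sigma> \<in> Gal \<Longrightarrow> x \<in> L \<Longrightarrow> \<sigma> (- x) = - \<sigma> x"
  using app_add[of \<sigma> x "- x"] L_closed(5)[of x] app_0[of \<sigma>] by (simp add: minus_unique)

lemma app_power: "\<sigma> \<in> Gal \<Longrightarrow> x \<in> L \<Longrightarrow> \<sigma> (x ^ k) = \<sigma> x ^ k"
proof (induct k)
  case (Suc k)
  then show ?case using app_mult[of \<sigma> x "x ^ k"] L_closed(9)[of x k] by simp
qed (simp add: app_1[of \<sigma>])

lemma app_sum: "\<sigma> \<in> Gal \<Longrightarrow> (\<And>i. i \<in> I \<Longrightarrow> f i \<in> L) \<Longrightarrow> \<sigma> (\<Sum>i\<in>I. f i) = (\<Sum>i\<in>I. \<sigma> (f i))"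
proof (induct I rule: infinite_finite_induct)
  case (insert i I)
  then show ?case using app_add[of \<sigma> "f i" "sum f I"] subfield_sum_closed[OF L, of I f] by simp
qed (simp_all add: app_0[of \<sigma>])

lemma app_inv: "\<sigma> \<in> Gal \<Longrightarrow> x \<in> L \<Longrightarrow> \<sigma> ((inv\<^bsub>galois_group L K\<^esub> \<sigma>) x) = x"
  "\<sigma> \<in> Gal \<Longrightarrow> x \<in> L \<Longrightarrow> (inv\<^bsub>galois_group L K\<^esub> \<sigma>) (\<sigma> x) = x"
  using comp_apply[of \<sigma> "inv\<^bsub>galois_group L K\<^esub> \<sigma>" x] comp_apply[of "inv\<^bsub>galois_group L K\<^esub> \<sigma>" \<sigma> x]
    one_apply[of x] by auto

lemma fixed: "x \<in> L \<Longrightarrow> (\<And>\<sigma>. \<sigma> \<in> Gal \<Longrightarrow> \<sigma> x = x) \<Longrightarrow> x \<in> K"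
  using galois by (auto simp: galois_extension_def fixed_field_def)

lemma finite_orbit:
  assumes "x \<in> L"
  shows "finite ((\<lambda>\<sigma>. \<sigma> x) ` Gal)"
proof -
  obtain g :: "'a poly" where g: "g \<noteq> 0" "\<And>i. coeff g i \<in> K" "poly g x = 0"
    using algebraic_root[OF K algebraic[OF assms]] by blast
  have "poly g (\<sigma> x) = 0" if s: "\<sigma> \<in> Gal" for \<sigma>
  proof -
    have cl: "coeff g i * x ^ i \<in> L" for i
      using g(2) K_sub assms by (intro L_closed) auto
    have "poly g (\<sigma> x) = (\<Sum>i\<le>degree g. \<sigma> (coeff g i * x ^ i))"
      unfolding poly_altdef
    proof (rule sum.cong)
      fix i
      have c: "coeff g i \<in> L" "x ^ i \<in> L" using g(2) K_sub assms L_closed(9) by auto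
      show "coeff g i * \<sigma> x ^ i = \<sigma> (coeff g i * x ^ i)"
        by (simp add: app_mult[OF s c] app_power[OF s assms] app_fix[OF s g(2)])
    qed simp
    also have "\<dots> = \<sigma> (poly g x)" unfolding poly_altdef by (rule app_sum[OF s cl, symmetric])
    finally show ?thesis using g(3) app_0[OF s] by simp
  qed
  then have "(\<lambda>\<sigma>. \<sigma> x) ` Gal \<subseteq> {y. poly g y = 0}" by auto
  then show ?thesis using poly_roots_finite[OF g(1)] finite_subset by blast
qed


lemma determinedD:
  "x \<in> determined Y \<Longrightarrow> \<sigma> \<in> Gal \<Longrightarrow> \<tau> \<in> Gal \<Longrightarrow> agree Y \<sigma> \<tau> \<Longrightarrow> \<sigma> x = \<tau> x"
  unfolding determined_def by blast

lemma transversal_exists: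
  assumes "finite Y" "Y \<subseteq> L" "S \<subseteq> Gal"
  obtains \<Gamma> where "transversal S Y \<Gamma>"
proof -
  let ?r = "\<lambda>\<sigma>. restrict \<sigma> Y"
  have "?r ` S \<subseteq> (\<Pi>\<^sub>E x\<in>Y. (\<lambda>\<sigma>. \<sigma> x) ` Gal)" using assms(3) by auto
  moreover have "finite (\<Pi>\<^sub>E x\<in>Y. (\<lambda>\<sigma>. \<sigma> x) ` Gal)"
    using assms finite_orbit by (intro finite_PiE) auto
  ultimately have fin: "finite (?r ` S)" by (rule finite_subset)
  have eq: "?r \<sigma> = ?r \<tau> \<longleftrightarrow> agree Y \<sigma> \<tau>" for \<sigma> \<tau>
    by (auto simp: agree_def restrict_def fun_eq_iff)
  define \<Gamma> where "\<Gamma> = inv_into S ?r ` ?r ` S"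
  have "transversal S Y \<Gamma>"
    unfolding transversal_def
  proof (intro conjI ballI impI)
    show "finite \<Gamma>" "\<Gamma> \<subseteq> S" unfolding \<Gamma>_def using fin by (auto intro: inv_into_into)
    show "\<exists>\<gamma>\<in>\<Gamma>. agree Y \<sigma> \<gamma>" if "\<sigma> \<in> S" for \<sigma>
    proof
      show "inv_into S ?r (?r \<sigma>) \<in> \<Gamma>" using that by (simp add: \<Gamma>_def)
      show "agree Y \<sigma> (inv_into S ?r (?r \<sigma>))"
        unfolding eq[symmetric] using that f_inv_into_f[of "?r \<sigma>" ?r S] by simp
    qed
    show "\<gamma> = \<delta>" if ag: "\<gamma> \<in> \<Gamma>" "\<delta> \<in> \<Gamma>" "agree Y \<gamma> \<delta>" for \<gamma> \<delta>
    proof -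
      obtain u w where "u \<in> ?r ` S" "w \<in> ?r ` S" and e: "\<gamma> = inv_into S ?r u" "\<delta> = inv_into S ?r w"
        using ag(1,2) unfolding \<Gamma>_def by blast
      then have "?r \<gamma> = u" "?r \<delta> = w" using f_inv_into_f[of _ ?r S] by blast+
      then show ?thesis using ag(3) e unfolding eq[symmetric] by simp
    qed
  qed
  then show ?thesis by (rule that)
qed

text \<open>
  Left translation permutes the restrictions to \<open>Y\<close>, so sums over a transversal are invariant.
\<close>

lemma sum_transversal:
  assumes \<Gamma>: "transversal S Y \<Gamma>" and S: "S \<subseteq> Gal" "\<And>\<sigma> \<tau>. \<sigma> \<in> S \<Longrightarrow> \<tau> \<in> S \<Longrightarrow> \<sigma> \<star> \<tau> \<in> S"
    and Y: "Y \<subseteq> L" and \<tau>: "\<tau> \<in> S"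
    and F: "\<And>\<sigma> \<sigma>'. \<sigma> \<in> S \<Longrightarrow> \<sigma>' \<in> S \<Longrightarrow> agree Y \<sigma> \<sigma>' \<Longrightarrow> F \<sigma> = F \<sigma>'"
  shows "(\<Sum>\<gamma>\<in>\<Gamma>. F (\<tau> \<star> \<gamma>)) = (\<Sum>\<gamma>\<in>\<Gamma>. F \<gamma>)"
proof -
  have fin: "finite \<Gamma>" and sub: "\<Gamma> \<subseteq> S"
    and ex: "\<And>\<sigma>. \<sigma> \<in> S \<Longrightarrow> \<exists>\<gamma>\<in>\<Gamma>. agree Y \<sigma> \<gamma>"
    and un: "\<And>\<gamma> \<delta>. \<gamma> \<in> \<Gamma> \<Longrightarrow> \<delta> \<in> \<Gamma> \<Longrightarrow> agree Y \<gamma> \<delta> \<Longrightarrow> \<gamma> = \<delta>"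
    using \<Gamma> by (auto simp: transversal_def)
  define r where "r \<gamma> = (SOME \<delta>. \<delta> \<in> \<Gamma> \<and> agree Y (\<tau> \<star> \<gamma>) \<delta>)" for \<gamma>
  have r: "r \<gamma> \<in> \<Gamma> \<and> agree Y (\<tau> \<star> \<gamma>) (r \<gamma>)" if "\<gamma> \<in> \<Gamma>" for \<gamma>
  proof -
    have "\<gamma> \<in> S" using that sub by blast
    from someI_ex[OF ex[OF S(2)[OF \<tau> this], unfolded Bex_def]] show ?thesis by (simp add: r_def)
  qed
  have inj: "inj_on r \<Gamma>"
  proof (rule inj_onI)
    fix \<gamma> \<delta> assume *: "\<gamma> \<in> \<Gamma>" "\<delta> \<in> \<Gamma>" "r \<gamma> = r \<delta>"
    then have "agree Y (\<tau> \<star> \<gamma>) (\<tau> \<star> \<delta>)" using r[of \<gamma>] r[of \<delta>] by (auto simp: agree_def)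
    then have "agree Y \<gamma> \<delta>"
      unfolding agree_def
    proof (intro ballI)
      fix x assume x: "x \<in> Y" "\<forall>x\<in>Y. (\<tau> \<star> \<gamma>) x = (\<tau> \<star> \<delta>) x"
      have g: "\<tau> \<in> Gal" "\<gamma> \<in> Gal" "\<delta> \<in> Gal" "x \<in> L" using * \<tau> S sub Y x by auto
      then have "\<tau> (\<gamma> x) = \<tau> (\<delta> x)" using x comp_apply by auto
      then show "\<gamma> x = \<delta> x" using g app_inj app_closed by blast
    qed
    then show "\<gamma> = \<delta>" using un * by blast
  qed
  then have "r ` \<Gamma> = \<Gamma>" using r by (intro endo_inj_surj fin) auto
  then have "(\<Sum>\<gamma>\<in>\<Gamma>. F \<gamma>) = (\<Sum>\<gamma>\<in>\<Gamma>. F (r \<gamma>))"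
    using sum.reindex[OF inj, of F] by simp
  also have "\<dots> = (\<Sum>\<gamma>\<in>\<Gamma>. F (\<tau> \<star> \<gamma>))"
    using r sub S(2)[OF \<tau>] by (intro sum.cong refl F[symmetric]) auto
  finally show ?thesis by simp
qed

lemma determined_closed:
  "Y \<subseteq> L \<Longrightarrow> Y \<subseteq> determined Y" "K \<subseteq> determined Y" "1 \<in> determined Y" "determined Y \<subseteq> L"
  "x \<in> determined Y \<Longrightarrow> y \<in> determined Y \<Longrightarrow> x * y \<in> determined Y"
proof -
  show "K \<subseteq> determined Y"
  proof
    fix x assume x: "x \<in> K"
    then have "\<sigma> x = \<tau> x" if "\<sigma> \<in> Gal" "\<tau> \<in> Gal" for \<sigma> \<tau>
      using app_fix[OF that(1) x] app_fix[OF that(2) x] by simp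
    then show "x \<in> determined Y" using x K_sub by (auto simp: determined_def)
  qed
  then show "1 \<in> determined Y" using K_closed(2) by blast
  show "Y \<subseteq> L \<Longrightarrow> Y \<subseteq> determined Y" "determined Y \<subseteq> L" by (auto simp: determined_def agree_def)
  show "x * y \<in> determined Y" if xy: "x \<in> determined Y" "y \<in> determined Y"
  proof -
    have L: "x \<in> L" "y \<in> L" using xy by (auto simp: determined_def)
    have "\<sigma> (x * y) = \<tau> (x * y)" if "\<sigma> \<in> Gal" "\<tau> \<in> Gal" "agree Y \<sigma> \<tau>" for \<sigma> \<tau>
      using determinedD[OF xy(1) that] determinedD[OF xy(2) that]
      by (simp only: app_mult[OF that(1) L] app_mult[OF that(2) L])
    then show ?thesis using L L_closed(4) by (simp add: determined_def)
  qed
qed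

lemma trace_fixed:
  assumes \<Gamma>: "transversal S Y \<Gamma>" and S: "S \<subseteq> Gal" "\<And>\<sigma> \<tau>. \<sigma> \<in> S \<Longrightarrow> \<tau> \<in> S \<Longrightarrow> \<sigma> \<star> \<tau> \<in> S"
    and Y: "Y \<subseteq> L" and c: "c \<in> determined Y" and \<tau>: "\<tau> \<in> S"
  shows "\<tau> (\<Sum>\<gamma>\<in>\<Gamma>. \<gamma> c) = (\<Sum>\<gamma>\<in>\<Gamma>. \<gamma> c)" "(\<Sum>\<gamma>\<in>\<Gamma>. \<gamma> c) \<in> L"
    "(\<Sum>\<gamma>\<in>\<Gamma>. (\<tau> \<star> \<gamma>) c) = (\<Sum>\<gamma>\<in>\<Gamma>. \<gamma> c)"
proof -
  have g: "\<Gamma> \<subseteq> Gal" "\<tau> \<in> Gal" "c \<in> L" using \<Gamma> S \<tau> c by (auto simp: transversal_def determined_def)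
  then have cL: "\<gamma> c \<in> L" if "\<gamma> \<in> \<Gamma>" for \<gamma> using that app_closed by blast
  show "(\<Sum>\<gamma>\<in>\<Gamma>. \<gamma> c) \<in> L" by (rule subfield_sum_closed[OF L cL])
  show eq: "(\<Sum>\<gamma>\<in>\<Gamma>. (\<tau> \<star> \<gamma>) c) = (\<Sum>\<gamma>\<in>\<Gamma>. \<gamma> c)"
    using c S(1) by (intro sum_transversal[OF \<Gamma> S Y \<tau>]) (auto simp: determined_def)
  have "\<tau> (\<Sum>\<gamma>\<in>\<Gamma>. \<gamma> c) = (\<Sum>\<gamma>\<in>\<Gamma>. (\<tau> \<star> \<gamma>) c)"
    using app_sum[OF g(2) cL] comp_apply[OF g(2) _ g(3)] g(1) by (simp add: subset_iff cong: sum.cong)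
  then show "\<tau> (\<Sum>\<gamma>\<in>\<Gamma>. \<gamma> c) = (\<Sum>\<gamma>\<in>\<Gamma>. \<gamma> c)" using eq by simp
qed

text \<open>
  The trace is a sum of different characters, and these are linearly independent.
\<close>

lemma trace_nonzero:
  assumes \<Gamma>: "transversal S Y \<Gamma>" and S: "S \<subseteq> Gal" "S \<noteq> {}" and Y: "Y \<subseteq> L"
  obtains e where "e \<in> determined Y" "(\<Sum>\<gamma>\<in>\<Gamma>. \<gamma> e) \<noteq> 0"
proof -
  interpret P: prime_in_subring UNIV "{0::'a}" by (rule prime_zero)
  have g: "\<Gamma> \<subseteq> Gal" "finite \<Gamma>" using \<Gamma> S by (auto simp: transversal_def)
  obtain \<gamma>0 where \<gamma>0: "\<gamma>0 \<in> \<Gamma>" using \<Gamma> S(2) unfolding transversal_def by blast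
  have "\<exists>e\<in>determined Y. (\<Sum>\<gamma>\<in>\<Gamma>. \<gamma> e) \<noteq> 0"
  proof (rule ccontr)
    assume "\<not> ?thesis"
    then have z: "(\<Sum>\<gamma>\<in>\<Gamma>. \<gamma> e) = 0" if "e \<in> determined Y" for e using that by blast
    have "(1::'a) \<in> {0}"
    proof (rule P.dedekind_independence[where I = \<Gamma> and f = "\<lambda>\<gamma>. \<gamma>" and c = "\<lambda>_. 1" and M = "determined Y"])
      show "\<exists>x\<in>determined Y. \<gamma> x - \<delta> x \<notin> {0}" if "\<gamma> \<in> \<Gamma>" "\<delta> \<in> \<Gamma>" "\<gamma> \<noteq> \<delta>" for \<gamma> \<delta>
      proof -
        have "\<not> agree Y \<gamma> \<delta>" using \<Gamma> that unfolding transversal_def by blast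
        then show ?thesis using determined_closed(1)[OF Y] by (auto simp: agree_def)
      qed
      show "\<gamma> 1 = 1" if "\<gamma> \<in> \<Gamma>" for \<gamma> using that g(1) app_1[of \<gamma>] by blast
      show "\<gamma> (x * y) = \<gamma> x * \<gamma> y" if "\<gamma> \<in> \<Gamma>" "x \<in> determined Y" "y \<in> determined Y" for \<gamma> x y
        using that g(1) determined_closed(4) app_mult[of \<gamma> x y] by blast
    qed (use \<gamma>0 g z determined_closed(3,5) in auto)
    then show False by simp
  qed
  then show ?thesis using that by blast
qed


section \<open>The Krull topology and open subgroups\<close>

lemma stabilizer_finite:
  assumes "finite Y" "Y \<subseteq> L"
  obtains E where "subfield E \<Omega>" "K \<subseteq> E" "E \<subseteq> L" "ring.finite_dimension \<Omega> K E"
    "stabilizer Y = carrier (galois_group L E)"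
proof -
  interpret R: field "\<Omega> :: 'a ring" by (rule field_from_type_algebra)
  obtain xs where xs: "set xs = Y" using finite_list assms(1) by blast
  have xc: "set xs \<subseteq> carrier (\<Omega> :: 'a ring)" by simp
  have alg: "\<And>x. x \<in> set xs \<Longrightarrow> (R.algebraic over K) x" using algebraic assms xs by (auto simp: over_def)
  let ?E = "R.finite_extension K xs"
  have E: "subfield ?E \<Omega>" using R.finite_extension_is_subfield[OF K xc alg] .
  have KE: "K \<subseteq> ?E" using R.finite_extension_incl[of K xs] xc by simp
  have EL: "?E \<subseteq> L"
    using R.finite_extension_subring_incl[OF subfieldE(1)[OF L] K_sub, of xs] assms xs by simp
  have fd: "R.finite_dimension K ?E" using R.finite_extension_finite_dimension(1)[OF K xc alg] .
  have XE: "Y \<subseteq> ?E" using R.finite_extension_mem[OF subfieldE(1)[OF K] xc] xs by simp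
  have fix_E: "\<sigma> x = x" if s: "\<sigma> \<in> stabilizer Y" and x: "x \<in> ?E" for \<sigma> x
  proof -
    have sg: "\<sigma> \<in> Gal" using s by (simp add: stabilizer_def)
    let ?F = "{x \<in> L. \<sigma> x = x}"
    have "subring ?F \<Omega>"
    proof (rule R.subringI)
      show "\<ominus>\<^bsub>\<Omega>\<^esub> h \<in> ?F" if "h \<in> ?F" for h
      proof -
        have "\<ominus>\<^bsub>\<Omega>\<^esub> h = - h" using R.minus_equality[of "-h" h] by simp
        then show ?thesis using that app_uminus[OF sg] L_closed(5) by auto
      qed
    qed (use app_1[OF sg] app_mult[OF sg] app_add[OF sg] L_closed(2-4) in auto)
    then have "?E \<subseteq> ?F"
      using R.finite_extension_subring_incl[of ?F K xs] K_sub s assms(2) xs app_fix[OF sg]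
      by (auto simp: stabilizer_def)
    then show ?thesis using x by blast
  qed
  have "stabilizer Y = carrier (galois_group L ?E)"
  proof
    show "stabilizer Y \<subseteq> carrier (galois_group L ?E)"
    proof
      fix \<sigma> assume s: "\<sigma> \<in> stabilizer Y"
      then have "\<sigma> \<in> Gal" by (simp add: stabilizer_def)
      then show "\<sigma> \<in> carrier (galois_group L ?E)"
        using fix_E[OF s] by (simp add: galois_group_def)
    qed
    show "carrier (galois_group L ?E) \<subseteq> stabilizer Y"
    proof
      fix \<sigma> assume s: "\<sigma> \<in> carrier (galois_group L ?E)"
      then have f: "\<forall>x\<in>?E. \<sigma> x = x" by (simp add: galois_group_def)
      then have "\<forall>x\<in>K. \<sigma> x = x" using KE by blast
      then have "\<sigma> \<in> Gal" using s by (simp add: galois_group_def)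
      then show "\<sigma> \<in> stabilizer Y" using f XE by (auto simp: stabilizer_def)
    qed
  qed
  then show ?thesis using that E KE EL fd by blast
qed

lemma finite_dimension_generators:
  assumes "ring.finite_dimension \<Omega> K E" "E \<subseteq> L"
  obtains A where "finite A" "A \<subseteq> E" "E \<subseteq> determined A"
proof -
  interpret R: field "\<Omega> :: 'a ring" by (rule field_from_type_algebra)
  obtain n where "R.dimension n K E" using assms(1) R.finite_dimensionE' by blast
  then obtain Vs where Vs: "set Vs \<subseteq> carrier \<Omega>" "R.Span K Vs = E"
    using R.exists_base[OF K] by blast
  have inc: "set Vs \<subseteq> E" using R.Span_base_incl[OF K Vs(1)] Vs(2) by simp
  have "R.Span K Us \<subseteq> determined (set Vs)" if "set Us \<subseteq> set Vs" for Us
    using that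
  proof (induct Us)
    case Nil
    then show ?case using K_closed(1) determined_closed(2) by auto
  next
    case (Cons u Us)
    have D: "x + y \<in> determined (set Vs)" if "x \<in> determined (set Vs)" "y \<in> determined (set Vs)" for x y
    proof -
      have L: "x \<in> L" "y \<in> L" using that by (auto simp: determined_def)
      have "\<sigma> (x + y) = \<tau> (x + y)" if "\<sigma> \<in> Gal" "\<tau> \<in> Gal" "agree (set Vs) \<sigma> \<tau>" for \<sigma> \<tau>
        using determinedD[OF \<open>x \<in> determined _\<close> that] determinedD[OF \<open>y \<in> determined _\<close> that]
        by (simp only: app_add[OF that(1) L] app_add[OF that(2) L])
      then show ?thesis using L L_closed(3) by (simp add: determined_def)
    qed
    have u: "u \<in> determined (set Vs)" using Cons(2) determined_closed(1)[of "set Vs"] inc assms(2) by auto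
    show ?case
    proof
      fix x assume "x \<in> R.Span K (u # Us)"
      then obtain k v where kv: "k \<in> K" "v \<in> R.Span K Us" "x = k * u + v"
        using R.line_extension_mem_iff[of x K u "R.Span K Us"] by auto
      have "k \<in> determined (set Vs)" "v \<in> determined (set Vs)"
        using kv Cons determined_closed(2)[of "set Vs"] by auto
      then show "x \<in> determined (set Vs)" unfolding kv(3) using u by (intro D determined_closed(5))
    qed
  qed
  then have "E \<subseteq> determined (set Vs)" using Vs by blast
  then show ?thesis using that[of "set Vs"] inc by simp
qed

text \<open>
  Membership in an open set is decided locally by finitely many values of the automorphism: for a
  basic coset take generators of the finite extension that defines it.
\<close>

lemma openin_krull_local:
  assumes "openin (krull_topology L K) U" "\<sigma> \<in> U"
  obtains A where "finite A" "A \<subseteq> L" "\<And>\<tau>. \<tau> \<in> Gal \<Longrightarrow> agree A \<sigma> \<tau> \<Longrightarrow> \<tau> \<in> U"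
proof -
  let ?S = "{\<sigma> <#\<^bsub>galois_group L K\<^esub> carrier (galois_group L E) | \<sigma> E.
      \<sigma> \<in> Gal \<and> subfield E \<Omega> \<and> K \<subseteq> E \<and> E \<subseteq> L \<and> ring.finite_dimension \<Omega> K E}"
  have "generate_topology_on ?S U"
    using assms(1) by (simp add: krull_topology_def openin_topology_generated_by_iff)
  then have "\<forall>\<sigma>\<in>U. \<exists>A. finite A \<and> A \<subseteq> L \<and> (\<forall>\<tau>\<in>Gal. agree A \<sigma> \<tau> \<longrightarrow> \<tau> \<in> U)"
  proof (induct rule: generate_topology_on.induct)
    case (Int a b)
    show ?case
    proof
      fix \<sigma> assume "\<sigma> \<in> a \<inter> b"
      then have s: "\<sigma> \<in> a" "\<sigma> \<in> b" by auto
      obtain A where "finite A" "A \<subseteq> L" "\<forall>\<tau>\<in>Gal. agree A \<sigma> \<tau> \<longrightarrow> \<tau> \<in> a"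
        using bspec[OF Int(2) s(1)] by blast
      moreover obtain B where "finite B" "B \<subseteq> L" "\<forall>\<tau>\<in>Gal. agree B \<sigma> \<tau> \<longrightarrow> \<tau> \<in> b"
        using bspec[OF Int(4) s(2)] by blast
      ultimately show "\<exists>A. finite A \<and> A \<subseteq> L \<and> (\<forall>\<tau>\<in>Gal. agree A \<sigma> \<tau> \<longrightarrow> \<tau> \<in> a \<inter> b)"
        by (intro exI[of _ "A \<union> B"]) (auto simp: agree_def)
    qed
  next
    case (UN k)
    show ?case
    proof
      fix \<sigma> assume "\<sigma> \<in> \<Union>k"
      then obtain a where a: "a \<in> k" "\<sigma> \<in> a" by blast
      show "\<exists>A. finite A \<and> A \<subseteq> L \<and> (\<forall>\<tau>\<in>Gal. agree A \<sigma> \<tau> \<longrightarrow> \<tau> \<in> \<Union>k)"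
        using bspec[OF UN(2)[OF a(1)] a(2)] a(1) by blast
    qed
  next
    case (Basis s)
    then obtain \<sigma>0 E where s: "s = \<sigma>0 <#\<^bsub>galois_group L K\<^esub> carrier (galois_group L E)" "\<sigma>0 \<in> Gal"
      "K \<subseteq> E" "E \<subseteq> L" "ring.finite_dimension \<Omega> K E" by blast
    obtain A where A: "finite A" "A \<subseteq> E" "E \<subseteq> determined A"
      using finite_dimension_generators[OF s(5,4)] .
    have sub: "carrier (galois_group L E) \<subseteq> Gal" using s(3) by (auto simp: galois_group_def)
    show ?case
    proof (intro ballI exI[of _ A] conjI impI)
      fix \<sigma> \<tau> assume *: "\<sigma> \<in> s" "\<tau> \<in> Gal" "agree A \<sigma> \<tau>"
      then obtain \<theta> where \<theta>: "\<theta> \<in> carrier (galois_group L E)" "\<sigma> = \<sigma>0 \<star> \<theta>"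
        by (auto simp: s l_coset_def)
      have \<theta>': "\<theta> \<in> Gal" "\<sigma> \<in> Gal" using \<theta> sub s(2) by auto
      let ?k = "inv\<^bsub>galois_group L K\<^esub> \<sigma>0 \<star> \<tau>"
      have "?k x = x" if x: "x \<in> E" for x
      proof -
        have "\<tau> x = \<sigma> x" using determinedD[of x A, OF _ \<theta>'(2) *(2,3)] A(3) x by auto
        also have "\<dots> = \<sigma>0 (\<theta> x)" using comp_apply[OF s(2) \<theta>'(1)] \<theta>(2) s(4) x by blast
        also have "\<theta> x = x" using \<theta>(1) x by (simp add: galois_group_def)
        finally have "\<tau> x = \<sigma>0 x" .
        moreover have "x \<in> L" using x s(4) by blast
        ultimately show ?thesis
          using comp_apply[OF G.inv_closed[OF s(2)] *(2)] app_inv(2)[OF s(2)] by simp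
      qed
      moreover have "?k \<in> Gal" using s * by simp
      ultimately have "?k \<in> carrier (galois_group L E)" by (simp add: galois_group_def)
      moreover have "\<tau> = \<sigma>0 \<star> ?k" using s * by (simp add: G.m_assoc[symmetric])
      ultimately show "\<tau> \<in> s" unfolding s l_coset_def by blast
    qed (use A s in auto)
  qed simp
  from bspec[OF this assms(2)] obtain A
    where "finite A" "A \<subseteq> L" and A: "\<forall>\<tau>\<in>Gal. agree A \<sigma> \<tau> \<longrightarrow> \<tau> \<in> U" by blast
  then show ?thesis using that[of A] bspec[OF A] by simp
qed

lemma openin_stabilizer:
  assumes "finite Y" "Y \<subseteq> L"
  shows "openin (krull_topology L K) (stabilizer Y)"
proof -
  obtain E where E: "subfield E \<Omega>" "K \<subseteq> E" "E \<subseteq> L" "ring.finite_dimension \<Omega> K E"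
    "stabilizer Y = carrier (galois_group L E)" using stabilizer_finite[OF assms] .
  have "\<one>\<^bsub>galois_group L K\<^esub> <#\<^bsub>galois_group L K\<^esub> stabilizer Y = stabilizer Y"
    by (auto simp: l_coset_def stabilizer_def)
  then show ?thesis
    unfolding krull_topology_def
    by (intro topology_generated_by_Basis) (use E G.one_closed in \<open>force\<close>)
qed

lemma openin_krull_Gal: "openin (krull_topology L K) Gal" "topspace (krull_topology L K) = Gal"
proof -
  show 1: "openin (krull_topology L K) Gal" using openin_stabilizer[of "{}"] by (simp add: stabilizer_def)
  have "topspace (krull_topology L K) \<subseteq> Gal"
  proof -
    have "\<sigma> <#\<^bsub>galois_group L K\<^esub> carrier (galois_group L E) \<subseteq> Gal" if "\<sigma> \<in> Gal" "K \<subseteq> E" for \<sigma> E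
    proof -
      have "carrier (galois_group L E) \<subseteq> Gal" using that(2) by (auto simp: galois_group_def)
      then show ?thesis using G.l_coset_subset_G that(1) by blast
    qed
    then show ?thesis unfolding krull_topology_def topology_generated_by_topspace by blast
  qed
  then show "topspace (krull_topology L K) = Gal" using openin_subset[OF 1] by blast
qed


text \<open>
  The Galois correspondence for an open subgroup \<open>N\<close>. Traces over representatives of \<open>N\<close> are fixed by \<open>N\<close>.
  If \<open>\<tau>\<close> fixes all of them but is not in \<open>N\<close>, then the characters \<open>\<gamma>\<close> and \<open>\<tau> \<gamma>\<close>, for \<open>\<gamma>\<close> in the
  transversal, are pairwise different and satisfy a relation with coefficients \<open>1\<close> and \<open>-1\<close>.
\<close>

lemma fixed_field_open_subgroup:
  assumes N: "subgroup N (galois_group L K)" "openin (krull_topology L K) N"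
    and \<tau>: "\<tau> \<in> Gal" "\<And>x. x \<in> fixed_field L N \<Longrightarrow> \<tau> x = x"
  shows "\<tau> \<in> N"
proof (rule ccontr)
  assume notin: "\<tau> \<notin> N"
  interpret P: prime_in_subring UNIV "{0::'a}" by (rule prime_zero)
  interpret N: subgroup N "galois_group L K" by (rule N(1))
  obtain A where A: "finite A" "A \<subseteq> L" and nb: "\<And>\<sigma>. \<sigma> \<in> Gal \<Longrightarrow> agree A \<one>\<^bsub>galois_group L K\<^esub> \<sigma> \<Longrightarrow> \<sigma> \<in> N"
    using openin_krull_local[OF N(2) N.one_closed] by blast
  have NG: "N \<subseteq> Gal" by (rule N.subset)
  obtain \<Gamma> where \<Gamma>: "transversal N A \<Gamma>" using transversal_exists[OF A NG] .
  have g: "\<Gamma> \<subseteq> N" "finite \<Gamma>" using \<Gamma> by (auto simp: transversal_def)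
  have gG: "\<gamma> \<in> Gal" if "\<gamma> \<in> \<Gamma>" for \<gamma> using g NG that by blast
  obtain \<gamma>0 where \<gamma>0: "\<gamma>0 \<in> \<Gamma>" using \<Gamma> N.one_closed unfolding transversal_def by blast
  define f where "f = (\<lambda>(b, \<gamma>). if b then \<tau> \<star> \<gamma> else \<gamma>)"
  define c :: "bool \<times> ('a \<Rightarrow> 'a) \<Rightarrow> 'a" where "c = (\<lambda>(b, \<gamma>). if b then 1 else - 1)"
  have fG: "f i \<in> Gal" if "i \<in> (UNIV :: bool set) \<times> \<Gamma>" for i using that gG \<tau>(1) by (auto simp: f_def)
  have cross: "\<not> agree A (\<tau> \<star> \<gamma>) \<delta>" if gd: "\<gamma> \<in> \<Gamma>" "\<delta> \<in> \<Gamma>" for \<gamma> \<delta>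
  proof
    assume ag: "agree A (\<tau> \<star> \<gamma>) \<delta>"
    let ?k = "inv\<^bsub>galois_group L K\<^esub> \<delta> \<star> (\<tau> \<star> \<gamma>)"
    have "agree A \<one>\<^bsub>galois_group L K\<^esub> ?k"
      unfolding agree_def
    proof
      fix x assume x: "x \<in> A"
      have "?k x = (inv\<^bsub>galois_group L K\<^esub> \<delta>) (\<delta> x)"
        using ag x gG[OF gd(1)] gG[OF gd(2)] \<tau>(1) A by (subst comp_apply) (auto simp: agree_def)
      also have "\<dots> = x" using app_inv(2)[OF gG[OF gd(2)]] x A by blast
      finally show "\<one>\<^bsub>galois_group L K\<^esub> x = ?k x" using x A one_apply[of x] by auto
    qed
    then have "?k \<in> N" using nb gG[OF gd(1)] gG[OF gd(2)] \<tau>(1) by simp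
    then have "\<delta> \<star> ?k \<star> inv\<^bsub>galois_group L K\<^esub> \<gamma> \<in> N" using gd g by auto
    moreover have "\<delta> \<star> ?k = \<tau> \<star> \<gamma>"
      using gG[OF gd(1)] gG[OF gd(2)] \<tau>(1) by (simp add: G.m_assoc[symmetric])
    ultimately show False using notin gG[OF gd(1)] \<tau>(1) by (simp add: G.m_assoc)
  qed
  have "c (True, \<gamma>0) \<in> {0}"
  proof (rule P.dedekind_independence[where I = "(UNIV :: bool set) \<times> \<Gamma>" and f = f and M = "determined A"])
    fix x assume x: "x \<in> determined A"
    have "(\<Sum>\<gamma>\<in>\<Gamma>. \<gamma> x) \<in> fixed_field L N"
      unfolding fixed_field_def
      using trace_fixed(1)[OF \<Gamma> NG N.m_closed A(2) x]
        trace_fixed(2)[OF \<Gamma> NG N.m_closed A(2) x N.one_closed] by simp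
    then have "\<tau> (\<Sum>\<gamma>\<in>\<Gamma>. \<gamma> x) = (\<Sum>\<gamma>\<in>\<Gamma>. \<gamma> x)" by (rule \<tau>(2))
    moreover have "\<tau> (\<Sum>\<gamma>\<in>\<Gamma>. \<gamma> x) = (\<Sum>\<gamma>\<in>\<Gamma>. (\<tau> \<star> \<gamma>) x)"
    proof -
      have xL: "x \<in> L" using x determined_closed(4) by blast
      have "\<tau> (\<Sum>\<gamma>\<in>\<Gamma>. \<gamma> x) = (\<Sum>\<gamma>\<in>\<Gamma>. \<tau> (\<gamma> x))"
        by (rule app_sum[OF \<tau>(1)]) (use gG app_closed xL in blast)
      also have "\<dots> = (\<Sum>\<gamma>\<in>\<Gamma>. (\<tau> \<star> \<gamma>) x)"
        by (rule sum.cong[OF refl]) (use comp_apply[OF \<tau>(1) gG xL] in simp)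
      finally show ?thesis .
    qed
    ultimately show "(\<Sum>i\<in>(UNIV :: bool set) \<times> \<Gamma>. c i * f i x) \<in> {0}"
      by (simp add: sum.cartesian_product' UNIV_bool c_def f_def sum_negf)
  next
    fix i j assume ij: "i \<in> (UNIV :: bool set) \<times> \<Gamma>" "j \<in> (UNIV :: bool set) \<times> \<Gamma>" "i \<noteq> j"
    have "\<not> agree A (f i) (f j)"
    proof
      assume ag: "agree A (f i) (f j)"
      obtain b \<gamma> b' \<delta> where e: "i = (b, \<gamma>)" "j = (b', \<delta>)" "\<gamma> \<in> \<Gamma>" "\<delta> \<in> \<Gamma>" using ij by blast
      have ag': "agree A (f j) (f i)" using ag by (simp add: agree_def)
      have bb: "b = b'" using ag ag' e cross by (auto simp: f_def split: if_splits)
      have "agree A \<gamma> \<delta>"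
      proof (cases b)
        case True
        show ?thesis
          unfolding agree_def
        proof
          fix x assume x: "x \<in> A"
          then have xL: "x \<in> L" using A(2) by blast
          have "(\<tau> \<star> \<gamma>) x = (\<tau> \<star> \<delta>) x" using ag e bb True x by (simp add: f_def agree_def)
          then have "\<tau> (\<gamma> x) = \<tau> (\<delta> x)"
            using comp_apply[OF \<tau>(1) gG xL] e by simp
          then show "\<gamma> x = \<delta> x"
            using app_inj[OF \<tau>(1) app_closed[OF gG[OF e(3)] xL] app_closed[OF gG[OF e(4)] xL]] by simp
        qed
      qed (use ag e bb in \<open>auto simp: f_def\<close>)
      then show False using \<Gamma> e bb ij(3) by (auto simp: transversal_def)
    qed
    then show "\<exists>x\<in>determined A. f i x - f j x \<notin> {0}"
      using determined_closed(1)[OF A(2)] by (auto simp: agree_def)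
  next
    show "f i 1 = 1" if "i \<in> (UNIV :: bool set) \<times> \<Gamma>" for i by (rule app_1[OF fG[OF that]])
    show "f i (x * y) = f i x * f i y"
      if "i \<in> (UNIV :: bool set) \<times> \<Gamma>" "x \<in> determined A" "y \<in> determined A" for i x y
      using app_mult[OF fG[OF that(1)]] that(2,3) determined_closed(4) by blast
  qed (use \<gamma>0 g determined_closed(3,5) in auto)
  then show False by (simp add: c_def)
qed

end


section \<open>Compactness and intermediate fields\<close>

context galois begin

text \<open>
  A family of conditions, each on the value at one element, is satisfied by an automorphism if its finite
  subfamilies are. The orbits are finite, so by Tychonoff's theorem the product of the discrete orbits is
  compact; a function that agrees on each finite set with some automorphism is itself an automorphism.
\<close>

lemma Gal_compact:
  assumes D: "fst ` D \<subseteq> L" "\<And>B. finite B \<Longrightarrow> B \<subseteq> D \<Longrightarrow> \<exists>\<sigma>\<in>Gal. \<forall>(x, S)\<in>B. \<sigma> x \<in> S"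
  obtains \<sigma> where "\<sigma> \<in> Gal" "\<And>x S. (x, S) \<in> D \<Longrightarrow> \<sigma> x \<in> S"
proof -
  define orb where "orb x = (\<lambda>\<sigma>. \<sigma> x) ` Gal" for x
  define T where "T = product_topology (\<lambda>x. discrete_topology (orb x)) L"
  have top: "topspace T = (\<Pi>\<^sub>E x\<in>L. orb x)" by (simp add: T_def)
  have comp: "compact_space T"
    unfolding T_def
    by (auto simp: compact_space_product_topology compact_space_discrete_topology orb_def finite_orbit)
  define C where "C A B = {f \<in> topspace T. \<exists>\<sigma>\<in>Gal. agree A f \<sigma> \<and> (\<forall>(x, S)\<in>B. \<sigma> x \<in> S)}" for A B
  define \<U> where "\<U> = {C A B | A B. finite A \<and> A \<subseteq> L \<and> finite B \<and> B \<subseteq> D}"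
  have closed: "closedin T (C A B)" if A: "finite A" "A \<subseteq> L" for A B
  proof -
    have "openin T (topspace T - C A B)"
      unfolding T_def openin_product_topology_alt
    proof (intro ballI)
      fix f assume f: "f \<in> topspace (product_topology (\<lambda>x. discrete_topology (orb x)) L) - C A B"
      define U where "U i = (if i \<in> A then {f i} else orb i)" for i
      have "finite {i \<in> L. U i \<noteq> orb i}" by (rule finite_subset[OF _ A(1)]) (auto simp: U_def)
      moreover have "g \<in> topspace T - C A B" if g: "g \<in> Pi\<^sub>E L U" for g
      proof -
        have "g x \<in> orb x" if "x \<in> L" for x
          using g f that by (auto simp: U_def PiE_iff split: if_splits dest!: bspec[of L _ x])
        then have "g \<in> topspace T" using g by (auto simp: top PiE_iff)
        moreover have "agree A g \<sigma> \<longleftrightarrow> agree A f \<sigma>" for \<sigma>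
        proof -
          have "g x = f x" if "x \<in> A" for x using PiE_mem[OF g, of x] that A(2) by (auto simp: U_def)
          then show ?thesis by (auto simp: agree_def)
        qed
        ultimately show ?thesis using f by (auto simp: C_def T_def)
      qed
      ultimately show "\<exists>U. finite {i \<in> L. U i \<noteq> topspace (discrete_topology (orb i))} \<and>
          (\<forall>i\<in>L. openin (discrete_topology (orb i)) (U i)) \<and> f \<in> Pi\<^sub>E L U \<and>
          Pi\<^sub>E L U \<subseteq> topspace (product_topology (\<lambda>x. discrete_topology (orb x)) L) - C A B"
        using f by (intro exI[of _ U]) (auto simp: U_def T_def PiE_iff)
    qed
    then show ?thesis by (auto simp: closedin_def C_def)
  qed
  have fip: "\<Inter>\<F> \<noteq> {}" if F: "finite \<F>" "\<F> \<subseteq> \<U>" for \<F>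
  proof -
    have "\<F> \<subseteq> (\<lambda>(A, B). C A B) ` {(A, B). finite A \<and> A \<subseteq> L \<and> finite B \<and> B \<subseteq> D}"
      using F(2) by (auto simp: \<U>_def)
    from finite_subset_image[OF F(1) this] obtain W
      where W: "finite W" "W \<subseteq> {(A, B). finite A \<and> A \<subseteq> L \<and> finite B \<and> B \<subseteq> D}"
        "\<F> = (\<lambda>(A, B). C A B) ` W" by blast
    have "finite (\<Union>(snd ` W))" "\<Union>(snd ` W) \<subseteq> D" using W(1) subsetD[OF W(2)] by fastforce+
    then obtain \<sigma> where \<sigma>: "\<sigma> \<in> Gal" "\<forall>(x, S)\<in>\<Union>(snd ` W). \<sigma> x \<in> S" using D(2) by meson
    have "\<sigma> \<in> topspace T" using \<sigma>(1) by (auto simp: top orb_def Gal_iff Bij_def PiE_def)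
    moreover have "agree A \<sigma> \<sigma>" for A by (simp add: agree_def)
    moreover have "\<forall>(x, S)\<in>B. \<sigma> x \<in> S" if "(A, B) \<in> W" for A B
    proof
      fix z assume "z \<in> B"
      then have "z \<in> \<Union>(snd ` W)" using UN_I[OF that, of z snd] by simp
      then show "case z of (x, S) \<Rightarrow> \<sigma> x \<in> S" by (rule bspec[OF \<sigma>(2)])
    qed
    ultimately have "\<sigma> \<in> C A B" if "(A, B) \<in> W" for A B
      unfolding C_def using \<sigma>(1) that by blast
    then have "\<sigma> \<in> \<Inter>\<F>" using W(3) by auto
    then show ?thesis by blast
  qed
  have "\<forall>C\<in>\<U>. closedin T C" using closed by (auto simp: \<U>_def)
  then have "\<Inter>\<U> \<noteq> {}" using comp fip unfolding compact_space_fip by blast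
  then obtain f where "f \<in> \<Inter>\<U>" by blast
  then have f: "f \<in> C A B" if "finite A" "A \<subseteq> L" "finite B" "B \<subseteq> D" for A B
    using that by (auto simp: \<U>_def)
  have ft: "f \<in> (\<Pi>\<^sub>E x\<in>L. orb x)" using f[of "{}" "{}"] top by (simp add: C_def)
  have ag: "\<exists>\<sigma>\<in>Gal. agree A f \<sigma>" if "finite A" "A \<subseteq> L" for A
    using f[OF that, of "{}"] by (auto simp: C_def)
  have fL: "f x \<in> L" if "x \<in> L" for x using ag[of "{x}"] that app_closed by (auto simp: agree_def)
  have "bij_betw f L L"
    unfolding bij_betw_def
  proof
    show "inj_on f L"
    proof (rule inj_onI)
      fix x y assume "x \<in> L" "y \<in> L" "f x = f y"
      then show "x = y" using ag[of "{x, y}"] app_inj by (auto simp: agree_def)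
    qed
    show "f ` L = L"
    proof
      show "L \<subseteq> f ` L"
      proof
        fix y assume y: "y \<in> L"
        obtain \<sigma> where \<sigma>: "\<sigma> \<in> Gal" "agree (orb y) f \<sigma>"
          using ag[of "orb y"] finite_orbit[OF y] app_closed[OF _ y] by (auto simp: orb_def)
        have "(inv\<^bsub>galois_group L K\<^esub> \<sigma>) y \<in> orb y" using \<sigma> by (auto simp: orb_def)
        then have "f ((inv\<^bsub>galois_group L K\<^esub> \<sigma>) y) = y" using \<sigma>(2) app_inv(1)[OF \<sigma>(1) y] by (simp add: agree_def)
        then show "y \<in> f ` L" using \<sigma> y by (metis G.inv_closed app_closed image_eqI)
      qed
    qed (use fL in auto)
  qed
  moreover have "f (x + y) = f x + f y \<and> f (x * y) = f x * f y" if xy: "x \<in> L" "y \<in> L" for x y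
  proof -
    obtain \<sigma> where \<sigma>: "\<sigma> \<in> Gal" "agree {x, y, x + y, x * y} f \<sigma>"
      using ag[of "{x, y, x + y, x * y}"] xy L_closed(3)[OF xy] L_closed(4)[OF xy] by auto
    then show ?thesis using app_add[OF \<sigma>(1) xy] app_mult[OF \<sigma>(1) xy] by (simp add: agree_def)
  qed
  moreover have "f x = x" if "x \<in> K" for x
  proof -
    have "x \<in> L" using that K_sub by blast
    then obtain \<sigma> where "\<sigma> \<in> Gal" "f x = \<sigma> x" using ag[of "{x}"] by (auto simp: agree_def)
    then show ?thesis using app_fix that by simp
  qed
  ultimately have "f \<in> Gal" using ft by (simp add: Gal_iff Bij_def PiE_def)
  moreover have "f x \<in> S" if "(x, S) \<in> D" for x S
  proof -
    have "x \<in> L" using D(1) that by force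
    then show ?thesis using f[of "{x}" "{(x, S)}"] that by (auto simp: C_def agree_def)
  qed
  ultimately show ?thesis using that by blast
qed


lemma determined_by_stabilizer:
  assumes "Y \<subseteq> L" "s \<in> L" "\<And>\<sigma>. \<sigma> \<in> stabilizer Y \<Longrightarrow> \<sigma> s = s"
  shows "s \<in> determined Y"
proof -
  have "\<sigma> s = \<tau> s" if *: "\<sigma> \<in> Gal" "\<tau> \<in> Gal" "agree Y \<sigma> \<tau>" for \<sigma> \<tau>
  proof -
    have "inv\<^bsub>galois_group L K\<^esub> \<tau> \<star> \<sigma> \<in> stabilizer Y"
      using * assms(1) app_inv(2)[OF *(2)] comp_apply[OF G.inv_closed[OF *(2)] *(1)]
      by (auto simp: stabilizer_def agree_def subset_iff)
    then have "(inv\<^bsub>galois_group L K\<^esub> \<tau>) (\<sigma> s) = s" using assms(2,3) * by (metis comp_apply G.inv_closed)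
    then show ?thesis using app_inv(1)[OF *(2), of "\<sigma> s"] * assms(2) app_closed by metis
  qed
  then show ?thesis using assms(2) by (simp add: determined_def)
qed

text \<open>
  A list of pairs \<open>(x, c)\<close> stands for the tensor that is the sum of the \<open>x \<otimes> c\<close>; the tensor acts as the
  function \<open>\<sigma> \<mapsto> \<Sum> x * \<sigma> c\<close> on automorphisms.
\<close>

definition tensor_eval :: "('a \<times> 'a) list \<Rightarrow> ('a \<Rightarrow> 'a) \<Rightarrow> 'a"
  where "tensor_eval ps f = (\<Sum>(x, c)\<leftarrow>ps. x * f c)"

lemma tensor_eval_simps [simp]:
  "tensor_eval [] f = 0" "tensor_eval ((x, c) # ps) f = x * f c + tensor_eval ps f"
  "tensor_eval (ps @ qs) f = tensor_eval ps f + tensor_eval qs f"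
  by (simp_all add: tensor_eval_def)

text \<open>
  The functions given by tensors form an algebra, and \<open>1 \<otimes> a - \<gamma>1 a \<otimes> 1\<close> vanishes at \<open>\<gamma>1\<close> but not at an
  automorphism with another value at \<open>a\<close>. Scaled products of such elements are delta functions.
\<close>

lemma interpolation_unit:
  assumes E: "subfield E \<Omega>" "E \<subseteq> L" and Y: "Y \<subseteq> E" and \<gamma>0: "\<gamma>0 \<in> Gal"
    and "finite \<Gamma>" "\<Gamma> \<subseteq> Gal" "\<And>\<gamma>. \<gamma> \<in> \<Gamma> \<Longrightarrow> \<not> agree Y \<gamma>0 \<gamma>"
  shows "\<exists>ps. set ps \<subseteq> L \<times> (E \<inter> determined Y) \<and> tensor_eval ps \<gamma>0 = 1 \<and> (\<forall>\<gamma>\<in>\<Gamma>. tensor_eval ps \<gamma> = 0)"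
  using assms(5-)
proof (induct \<Gamma> rule: finite_induct)
  case empty
  show ?case
    by (rule exI[of _ "[(1, 1)]"]) (use determined_closed(3) subfield_closed(2)[OF E(1)] L_closed(2) app_1[OF \<gamma>0] in auto)
next
  case (insert \<gamma>1 \<Gamma>)
  then obtain ps where ps: "set ps \<subseteq> L \<times> (E \<inter> determined Y)" "tensor_eval ps \<gamma>0 = 1"
    "\<forall>\<gamma>\<in>\<Gamma>. tensor_eval ps \<gamma> = 0" by auto
  obtain a where a: "a \<in> Y" "\<gamma>0 a \<noteq> \<gamma>1 a" using insert.prems(2)[of \<gamma>1] by (auto simp: agree_def)
  have \<gamma>1: "\<gamma>1 \<in> Gal" "\<Gamma> \<subseteq> Gal" using insert by auto
  have aL: "a \<in> L" "a \<in> E" "a \<in> determined Y" using a Y E determined_closed(1)[of Y] by auto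
  let ?d = "\<gamma>0 a - \<gamma>1 a"
  \<comment> \<open>Multiplication by the separating element \<open>(1 \<otimes> a - \<gamma>1 a \<otimes> 1) / (\<gamma>0 a - \<gamma>1 a)\<close>.\<close>
  define qs where "qs = map (\<lambda>(x, c). (x / ?d, c * a)) ps @ map (\<lambda>(x, c). (- x * \<gamma>1 a / ?d, c)) ps"
  have ev: "tensor_eval qs \<gamma> = tensor_eval ps \<gamma> * ((\<gamma> a - \<gamma>1 a) / ?d)" if g: "\<gamma> \<in> Gal" for \<gamma>
  proof -
    have "tensor_eval (map (\<lambda>(x, c). (x / ?d, c * a)) rs) \<gamma> = tensor_eval rs \<gamma> * \<gamma> a / ?d"
      if "set rs \<subseteq> L \<times> (E \<inter> determined Y)" for rs
      using that E aL(1) by (induct rs) (auto simp: app_mult[OF g] subset_iff add_divide_distrib distrib_right)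
    moreover have "tensor_eval (map (\<lambda>(x, c). (- x * \<gamma>1 a / ?d, c)) rs) \<gamma> = - (tensor_eval rs \<gamma> * \<gamma>1 a / ?d)" for rs
      by (induct rs) (auto simp: add_divide_distrib distrib_right)
    ultimately show ?thesis using ps(1) by (simp add: qs_def diff_divide_distrib right_diff_distrib)
  qed
  have dL: "?d \<in> L" "\<gamma>1 a \<in> L" using app_closed \<gamma>0 \<gamma>1 aL by (auto intro!: L_closed)
  have "set qs \<subseteq> L \<times> (E \<inter> determined Y)"
    using ps(1) dL aL
    by (auto simp: qs_def intro!: L_closed subfield_closed[OF E(1)] determined_closed(5))
  moreover have "tensor_eval qs \<gamma>0 = 1" using ev[OF \<gamma>0] ps(2) a(2) by simp
  moreover have "\<forall>\<gamma>\<in>insert \<gamma>1 \<Gamma>. tensor_eval qs \<gamma> = 0" using ev \<gamma>1 ps(3) by (auto simp: subset_iff)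
  ultimately show ?case by blast
qed

lemma interpolation:
  assumes E: "subfield E \<Omega>" "E \<subseteq> L" and Y: "Y \<subseteq> E" and \<Gamma>: "transversal Gal Y \<Gamma>" and s: "s \<in> L"
  obtains ps where "set ps \<subseteq> L \<times> (E \<inter> determined Y)" "\<forall>\<gamma>\<in>\<Gamma>. tensor_eval ps \<gamma> = \<gamma> s"
proof -
  have g: "finite \<Gamma>" "\<Gamma> \<subseteq> Gal" using \<Gamma> by (auto simp: transversal_def)
  have "\<exists>ps. set ps \<subseteq> L \<times> (E \<inter> determined Y) \<and> (\<forall>\<gamma>\<in>\<Gamma>. tensor_eval ps \<gamma> = (if \<gamma> \<in> \<Delta> then \<gamma> s else 0))"
    if "finite \<Delta>" "\<Delta> \<subseteq> \<Gamma>" for \<Delta>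
    using that
  proof (induct \<Delta> rule: finite_induct)
    case empty
    show ?case by (rule exI[of _ "[]"]) auto
  next
    case (insert \<delta> \<Delta>)
    then obtain ps where ps: "set ps \<subseteq> L \<times> (E \<inter> determined Y)"
      "\<forall>\<gamma>\<in>\<Gamma>. tensor_eval ps \<gamma> = (if \<gamma> \<in> \<Delta> then \<gamma> s else 0)" by auto
    have \<delta>: "\<delta> \<in> Gal" "\<delta> \<in> \<Gamma>" using insert g by auto
    have "\<not> agree Y \<delta> \<gamma>" if "\<gamma> \<in> \<Gamma> - {\<delta>}" for \<gamma> using that \<Gamma> \<delta>(2) by (auto simp: transversal_def)
    then obtain qs where qs: "set qs \<subseteq> L \<times> (E \<inter> determined Y)" "tensor_eval qs \<delta> = 1"
      "\<forall>\<gamma>\<in>\<Gamma> - {\<delta>}. tensor_eval qs \<gamma> = 0"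
      using interpolation_unit[OF E Y \<delta>(1), of "\<Gamma> - {\<delta>}"] g by auto
    let ?rs = "map (\<lambda>(x, c). (\<delta> s * x, c)) qs"
    have "tensor_eval (map (\<lambda>(x, c). (\<delta> s * x, c)) us) \<gamma> = \<delta> s * tensor_eval us \<gamma>" for \<gamma> us
      by (induct us) (auto simp: distrib_left)
    then have "\<forall>\<gamma>\<in>\<Gamma>. tensor_eval (?rs @ ps) \<gamma> = (if \<gamma> \<in> insert \<delta> \<Delta> then \<gamma> s else 0)"
      using ps(2) qs(2,3) insert.hyps(2) by auto
    moreover have "set (?rs @ ps) \<subseteq> L \<times> (E \<inter> determined Y)"
      using ps(1) qs(1) app_closed[OF \<delta>(1) s] by (auto intro!: L_closed)
    ultimately show ?case by blast
  qed
  from this[OF g(1) subset_refl] show ?thesis using that by auto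
qed

text \<open>
  By interpolation \<open>\<sigma> s = \<Sum> x * \<sigma> c\<close> for all \<open>\<sigma>\<close>, with \<open>c\<close> in \<open>E\<close>. Taking \<open>\<sigma> = inv \<tau>\<close> and applying \<open>\<tau>\<close>
  turns this into \<open>s = \<Sum> \<tau> x * c\<close>. Multiplication by \<open>\<tau> e\<close> and summation over \<open>\<tau>\<close> replaces the
  coefficients by traces, which lie in the base field: if the trace of \<open>e\<close> is not zero, \<open>s\<close> is in \<open>E\<close>.
\<close>

lemma fixed_by_stabilizer:
  assumes E: "subfield E \<Omega>" "K \<subseteq> E" "E \<subseteq> L" and Y: "finite Y" "Y \<subseteq> E"
    and s: "s \<in> L" "\<And>\<sigma>. \<sigma> \<in> stabilizer Y \<Longrightarrow> \<sigma> s = s"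
  shows "s \<in> E"
proof -
  have YL: "Y \<subseteq> L" using Y E by blast
  obtain \<Gamma> where \<Gamma>: "transversal Gal Y \<Gamma>" using transversal_exists[OF Y(1) YL subset_refl] .
  have sd: "s \<in> determined Y" by (rule determined_by_stabilizer[OF YL s(1)]) (rule s(2))
  obtain ps where ps: "set ps \<subseteq> L \<times> (E \<inter> determined Y)" "\<forall>\<gamma>\<in>\<Gamma>. tensor_eval ps \<gamma> = \<gamma> s"
    using interpolation[OF E(1,3) Y(2) \<Gamma> s(1)] .
  have ev: "tensor_eval ps \<sigma> = \<sigma> s" if "\<sigma> \<in> Gal" for \<sigma>
  proof -
    obtain \<gamma> where \<gamma>: "\<gamma> \<in> \<Gamma>" "agree Y \<sigma> \<gamma>" using \<Gamma> \<open>\<sigma> \<in> Gal\<close> by (auto simp: transversal_def)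
    then have "\<gamma> \<in> Gal" using \<Gamma> by (auto simp: transversal_def)
    then have *: "\<sigma> c = \<gamma> c" if "c \<in> determined Y" for c using that \<gamma> \<open>\<sigma> \<in> Gal\<close> by (simp add: determined_def)
    have "tensor_eval qs \<sigma> = tensor_eval qs \<gamma>" if "set qs \<subseteq> L \<times> (E \<inter> determined Y)" for qs
      using that * by (induct qs) auto
    then show ?thesis using ps \<gamma>(1) * sd by simp
  qed
  have ps': "\<tau> (tensor_eval qs (inv\<^bsub>galois_group L K\<^esub> \<tau>)) = (\<Sum>(x, c)\<leftarrow>qs. \<tau> x * c)
      \<and> tensor_eval qs (inv\<^bsub>galois_group L K\<^esub> \<tau>) \<in> L" (is "?P qs")
    if \<tau>: "\<tau> \<in> Gal" and qs: "set qs \<subseteq> L \<times> L" for \<tau> qs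
    using qs
  proof (induct qs)
    case Nil
    show ?case using app_0[OF \<tau>] L_closed(1) by simp
  next
    case (Cons q qs)
    obtain x c where q: "q = (x, c)" "x \<in> L" "c \<in> L" using Cons(2) by auto
    let ?t = "inv\<^bsub>galois_group L K\<^esub> \<tau>"
    have c: "?t c \<in> L" using app_closed[OF G.inv_closed[OF \<tau>] q(3)] .
    have IH: "?P qs" using Cons by simp
    have "\<tau> (x * ?t c + tensor_eval qs ?t) = \<tau> x * c + \<tau> (tensor_eval qs ?t)"
      using app_add[OF \<tau> L_closed(4)[OF q(2) c]] app_mult[OF \<tau> q(2) c] app_inv(1)[OF \<tau> q(3)] IH by simp
    then show ?case using IH q c L_closed(3,4) by simp
  qed
  have psL: "set ps \<subseteq> L \<times> L" using ps E by blast
  have s_eq: "s = (\<Sum>(x, c)\<leftarrow>ps. \<tau> x * c)" if "\<tau> \<in> Gal" for \<tau>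
    using ps'[OF that psL] ev[of "inv\<^bsub>galois_group L K\<^esub> \<tau>"] that app_inv(1)[OF that s(1)] by simp
  define W where "W = fst ` set ps"
  have W: "finite W" "W \<subseteq> L" using ps by (auto simp: W_def)
  obtain \<Delta> where \<Delta>: "transversal Gal W \<Delta>" using transversal_exists[OF W subset_refl] .
  obtain e where e: "e \<in> determined W" "(\<Sum>\<gamma>\<in>\<Delta>. \<gamma> e) \<noteq> 0"
    using trace_nonzero[OF \<Delta> subset_refl _ W(2)] G.one_closed by blast
  have trK: "(\<Sum>\<gamma>\<in>\<Delta>. \<gamma> c) \<in> K" if "c \<in> determined W" for c
    using trace_fixed(1,2)[OF \<Delta> subset_refl _ W(2) that] by (intro fixed) auto
  have \<Delta>G: "\<Delta> \<subseteq> Gal" using \<Delta> by (simp add: transversal_def)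
  have "(\<Sum>\<gamma>\<in>\<Delta>. \<gamma> e * (\<Sum>(x, c)\<leftarrow>qs. \<gamma> x * c)) \<in> E" if "set qs \<subseteq> set ps" for qs
    using that
  proof (induct qs)
    case Nil
    then show ?case using subfield_closed(1)[OF E(1)] by simp
  next
    case (Cons q qs)
    obtain x c where q: "q = (x, c)" by fastforce
    then have xc: "x \<in> W" "x \<in> L" "c \<in> E" using Cons(2) ps by (auto simp: W_def image_iff) (metis fst_conv)+
    have xd: "e * x \<in> determined W" using determined_closed(5)[OF e(1)] determined_closed(1)[OF W(2)] xc by blast
    have "\<gamma> e * (\<gamma> x * c + r) = \<gamma> (e * x) * c + \<gamma> e * r" if "\<gamma> \<in> \<Delta>" for \<gamma> r
    proof -
      have "\<gamma> \<in> Gal" "e \<in> L" using that \<Delta>G e(1) determined_closed(4) by auto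
      then show ?thesis using app_mult[of \<gamma> e x] xc(2) by (simp add: algebra_simps)
    qed
    then have "(\<Sum>\<gamma>\<in>\<Delta>. \<gamma> e * (\<Sum>(x, c)\<leftarrow>q # qs. \<gamma> x * c))
        = (\<Sum>\<gamma>\<in>\<Delta>. \<gamma> (e * x)) * c + (\<Sum>\<gamma>\<in>\<Delta>. \<gamma> e * (\<Sum>(x, c)\<leftarrow>qs. \<gamma> x * c))"
      by (simp add: q sum.distrib sum_distrib_right)
    then show ?case
      using Cons trK[OF xd] E(2) xc(3) by (auto intro!: subfield_closed[OF E(1)])
  qed
  from this[OF subset_refl] have "(\<Sum>\<gamma>\<in>\<Delta>. \<gamma> e * (\<Sum>(x, c)\<leftarrow>ps. \<gamma> x * c)) \<in> E" .
  also have "(\<Sum>\<gamma>\<in>\<Delta>. \<gamma> e * (\<Sum>(x, c)\<leftarrow>ps. \<gamma> x * c)) = (\<Sum>\<gamma>\<in>\<Delta>. \<gamma> e) * s"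
    unfolding sum_distrib_right by (rule sum.cong[OF refl]) (use s_eq[symmetric] \<Delta>G in auto)
  finally have "((\<Sum>\<gamma>\<in>\<Delta>. \<gamma> e) * s) / (\<Sum>\<gamma>\<in>\<Delta>. \<gamma> e) \<in> E"
    using trK[OF e(1)] E(2) by (intro subfield_closed(8)[OF E(1)]) auto
  then show ?thesis using e(2) by simp
qed

text \<open>
  The Galois correspondence for an arbitrary intermediate field \<open>E\<close>. The Galois group over \<open>E\<close> is closed but in
  general not open, so the case of finitely many elements of \<open>E\<close> is combined with compactness.
\<close>

lemma moved_over_intermediate:
  assumes E: "subfield E \<Omega>" "K \<subseteq> E" "E \<subseteq> L" and s: "s \<in> L" "s \<notin> E"
  obtains \<sigma> where "\<sigma> \<in> carrier (galois_group L E)" "\<sigma> s \<noteq> s"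
proof -
  let ?D = "insert (s, - {s}) ((\<lambda>x. (x, {x})) ` E)"
  have "\<exists>\<sigma>\<in>Gal. \<forall>(x, S)\<in>B. \<sigma> x \<in> S" if B: "finite B" "B \<subseteq> ?D" for B
  proof -
    let ?Y = "fst ` B \<inter> E"
    obtain \<sigma> where \<sigma>: "\<sigma> \<in> stabilizer ?Y" "\<sigma> s \<noteq> s"
      using fixed_by_stabilizer[OF E, of ?Y s] s B by auto
    then have "\<forall>(x, S)\<in>B. \<sigma> x \<in> S" using B(2) by (auto simp: stabilizer_def) force+
    then show ?thesis using \<sigma>(1) by (auto simp: stabilizer_def)
  qed
  moreover have "fst ` ?D \<subseteq> L" using E s by auto
  ultimately obtain \<sigma> where "\<sigma> \<in> Gal" "\<And>x S. (x, S) \<in> ?D \<Longrightarrow> \<sigma> x \<in> S"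
    using Gal_compact[of ?D] by blast
  then have "\<sigma> \<in> carrier (galois_group L E)" "\<sigma> s \<noteq> s" by (auto simp: galois_group_def)
  then show ?thesis by (rule that)
qed

end


section \<open>Valuations\<close>

locale valued_field =
  fixes L :: "'a::field set" and w :: "'a \<Rightarrow> 'g::linordered_ab_group_add"
  assumes L: "subfield L \<Omega>" and valuation: "valuation L w"
begin

abbreviation "A \<equiv> valuation_ring L w"
abbreviation "m \<equiv> valuation_ideal L w"

lemma w_mult: "x \<in> L \<Longrightarrow> y \<in> L \<Longrightarrow> x \<noteq> 0 \<Longrightarrow> y \<noteq> 0 \<Longrightarrow> w (x * y) = w x + w y"
  and w_add: "x \<in> L \<Longrightarrow> y \<in> L \<Longrightarrow> x \<noteq> 0 \<Longrightarrow> y \<noteq> 0 \<Longrightarrow> x + y \<noteq> 0 \<Longrightarrow> min (w x) (w y) \<le> w (x + y)"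
  using valuation by (auto simp: valuation_def)

lemma w_one: "w 1 = 0"
  using w_mult[of 1 1] subfield_closed(2)[OF L] by simp

lemma w_uminus:
  assumes "x \<in> L" "x \<noteq> 0"
  shows "w (- x) = w x"
proof -
  have 1: "- 1 \<in> L" using subfield_closed(2,5)[OF L] by simp
  have "w (- 1) + w (- 1) = 0" using w_mult[of "- 1" "- 1"] 1 w_one by simp
  then have "w (- 1) = 0" by simp
  then show ?thesis using w_mult[OF 1 assms(1)] assms(2) by simp
qed

lemma w_inverse: "x \<in> L \<Longrightarrow> x \<noteq> 0 \<Longrightarrow> w (inverse x) = - w x"
  using w_mult[of x "inverse x"] subfield_closed(7)[OF L, of x] w_one
  by (simp add: eq_neg_iff_add_eq_0 add.commute)

lemma w_divide: "x \<in> L \<Longrightarrow> y \<in> L \<Longrightarrow> x \<noteq> 0 \<Longrightarrow> y \<noteq> 0 \<Longrightarrow> w (x / y) = w x - w y"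
  using w_mult[of x "inverse y"] w_inverse[of y] subfield_closed(7)[OF L, of y]
  by (simp add: divide_inverse)

lemma A_iff: "x \<in> A \<longleftrightarrow> x \<in> L \<and> (x = 0 \<or> 0 \<le> w x)"
  and m_iff: "x \<in> m \<longleftrightarrow> x \<in> L \<and> (x = 0 \<or> 0 < w x)"
  by (auto simp: valuation_ring_def valuation_ideal_def)

sublocale prime_in_subring A m
proof
  note cl = subfield_closed[OF L]
  show "1 \<in> A" "1 \<notin> m" "0 \<in> m" using cl by (auto simp: A_iff m_iff w_one)
  show "m \<subseteq> A" by (auto simp: A_iff m_iff)
  show "- x \<in> A" if "x \<in> A" for x using that cl(5) w_uminus[of x] by (cases "x = 0") (auto simp: A_iff)
  show "x + y \<in> A" if "x \<in> A" "y \<in> A" for x y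
  proof (cases "x = 0 \<or> y = 0 \<or> x + y = 0")
    case False
    then show ?thesis using w_add[of x y] that cl(3) by (auto simp: A_iff min_def split: if_splits)
  qed (use that cl in \<open>auto simp: A_iff\<close>)
  show "x + y \<in> m" if "x \<in> m" "y \<in> m" for x y
  proof (cases "x = 0 \<or> y = 0 \<or> x + y = 0")
    case False
    then show ?thesis using w_add[of x y] that cl(3) by (auto simp: m_iff min_def split: if_splits)
  qed (use that cl in \<open>auto simp: m_iff\<close>)
  show "x * y \<in> A" if "x \<in> A" "y \<in> A" for x y
    using that cl(4)[of x y] w_mult[of x y] by (cases "x = 0 \<or> y = 0") (auto simp: A_iff)
  show "x * y \<in> m" if "x \<in> A" "y \<in> m" for x y
    using that cl(4)[of x y] w_mult[of x y] by (cases "x = 0 \<or> y = 0") (auto simp: A_iff m_iff add_nonneg_pos)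
  show "x \<in> m \<or> y \<in> m" if "x \<in> A" "y \<in> A" "x * y \<in> m" for x y
  proof (cases "x = 0 \<or> y = 0")
    case False
    then have "0 < w x + w y" using that w_mult[of x y] by (auto simp: A_iff m_iff)
    then have "0 < w x \<or> 0 < w y" using add_nonpos_nonpos[of "w x" "w y"] by (meson not_le)
    then show ?thesis using that by (auto simp: A_iff m_iff)
  qed (use that cl in \<open>auto simp: m_iff A_iff\<close>)
qed

lemma inverse_in_m: "x \<in> L \<Longrightarrow> x \<notin> A \<Longrightarrow> x \<noteq> 0 \<and> inverse x \<in> m"
  using w_inverse[of x] subfield_closed(7)[OF L, of x] by (auto simp: A_iff m_iff)

lemma inverse_in_A: "x \<in> L \<Longrightarrow> x \<notin> m \<Longrightarrow> inverse x \<in> A"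
  using w_inverse[of x] subfield_closed(7)[OF L, of x] by (auto simp: A_iff m_iff)

lemma w_unit: "x \<in> A \<Longrightarrow> x \<notin> m \<Longrightarrow> x \<noteq> 0 \<and> w x = 0"
  by (auto simp: A_iff m_iff)

lemma power_in_m: "x \<in> m \<Longrightarrow> 0 < k \<Longrightarrow> x ^ k \<in> m"
  using m_mult[of "x ^ (k - 1)" x] A_power[of x "k - 1"] m_sub power_minus_mult[of k x] by auto

lemma one_unit:
  assumes "x - 1 \<in> m"
  shows "x \<in> A" "x \<notin> m"
proof -
  have "x = (x - 1) + 1" by simp
  then show "x \<in> A" using assms m_sub A_add A_one by (metis subsetD)
  show "x \<notin> m" using assms one_notin m_diff[of x "x - 1"] by auto
qed

end

text \<open>
  An element \<open>a\<close> that is integral for \<open>w\<close> is a quotient \<open>(a * d) / d\<close> of elements that are integral for all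
  valuations with the same restriction to \<open>K\<close>, with \<open>d\<close> a unit for \<open>w\<close>. Scale a polynomial over \<open>K\<close> with root \<open>a\<close> so
  that all coefficients are integral and the last one of minimal value, say that of degree \<open>j\<close>, is \<open>1\<close>.
  The terms of degree at least \<open>j\<close>, divided by \<open>a ^ j\<close>, add up to \<open>d\<close>. If \<open>a\<close> is integral for \<open>w'\<close> this sum is
  integral; otherwise \<open>1 / a\<close> is integral for \<open>w'\<close>, and the terms of degree below \<open>j\<close> give the same result.
\<close>

lemma common_denominator:
  fixes K L :: "'a::field set" and w :: "'a \<Rightarrow> 'g::linordered_ab_group_add"
  assumes K: "subfield K \<Omega>" "K \<subseteq> L" and L: "subfield L \<Omega>" and w: "valuation L w"
    and a: "a \<in> valuation_ring L w" "ring.algebraic \<Omega> K a"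
  obtains d where "d \<in> L" "d - 1 \<in> valuation_ideal L w"
    "\<And>w' :: 'a \<Rightarrow> 'g. valuation L w' \<Longrightarrow> (\<forall>x\<in>K - {0}. w' x = w x) \<Longrightarrow>
      d \<in> valuation_ring L w' \<and> a * d \<in> valuation_ring L w'"
proof -
  interpret W: valued_field L w by (rule valued_field.intro[OF L w])
  note Lcl = subfield_closed[OF L]
  obtain g :: "'a poly" where g: "g \<noteq> 0" "\<And>i. coeff g i \<in> K" "poly g a = 0"
    using algebraic_root[OF K(1) a(2)] by blast
  have gL: "coeff g i \<in> L" for i using g(2) K(2) by blast
  define N where "N = {i. coeff g i \<noteq> 0}"
  have "N \<subseteq> {..degree g}" by (auto simp: N_def le_degree)
  then have N: "finite N" using finite_subset by blast
  have "degree g \<in> N" using g(1) by (simp add: N_def)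
  then have N_ne: "N \<noteq> {}" by blast
  define \<mu> where "\<mu> = Min ((\<lambda>i. w (coeff g i)) ` N)"
  define J where "J = {i \<in> N. w (coeff g i) = \<mu>}"
  have "\<mu> \<in> (\<lambda>i. w (coeff g i)) ` N" unfolding \<mu>_def using N N_ne by (intro Min_in) auto
  then have J: "finite J" "J \<noteq> {}" using N by (auto simp: J_def)
  define j where "j = Max J"
  have j: "j \<in> N" "w (coeff g j) = \<mu>" using Max_in[OF J] by (auto simp: j_def J_def)
  have \<mu>_le: "\<mu> \<le> w (coeff g i)" if "i \<in> N" for i using N that by (simp add: \<mu>_def)
  define c where "c i = coeff g i / coeff g j" for i
  have cj: "c j = 1" using j by (simp add: c_def N_def)
  have cK: "c i \<in> K" for i using g(2) subfield_closed(8)[OF K(1)] by (simp add: c_def)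
  then have cL: "c i \<in> L" for i using K(2) by blast
  have wc: "w (c i) = w (coeff g i) - \<mu>" if "i \<in> N" for i
    using W.w_divide[OF gL gL, of i j] that j by (simp add: c_def N_def)
  have c0: "c i = 0" if "i \<notin> N" for i using that by (simp add: c_def N_def)
  have cA: "c i = 0 \<or> 0 \<le> w (c i)" for i using wc[of i] \<mu>_le[of i] c0[of i] by force
  have cm: "c i \<in> W.m" if "j < i" for i
  proof (cases "i \<in> N")
    case True
    have "i \<notin> J" using Max_ge[OF J(1), of i] that by (auto simp: j_def)
    then have "\<mu> < w (coeff g i)" using True \<mu>_le[of i] by (auto simp: J_def)
    then show ?thesis using wc[OF True] cL by (simp add: W.m_iff)
  qed (use c0 W.m_zero in simp)
  let ?n = "degree g"
  have jn: "j \<le> ?n" using j(1) by (auto simp: N_def le_degree)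
  have zero: "(\<Sum>i\<le>?n. c i * a ^ i) = 0"
  proof -
    have "(\<Sum>i\<le>?n. c i * a ^ i) = (\<Sum>i\<le>?n. coeff g i * a ^ i) / coeff g j"
      by (simp add: c_def sum_divide_distrib)
    then show ?thesis using g(3) by (simp add: poly_altdef)
  qed
  define d where "d = (\<Sum>i\<in>{j..?n}. c i * a ^ (i - j))"
  have aL: "a \<in> L" using a(1) by (simp add: W.A_iff)
  have dL: "d \<in> L" unfolding d_def using cL aL Lcl by (intro subfield_sum_closed[OF L]) auto
  have d1: "d - 1 \<in> W.m"
  proof -
    have "d = c j * a ^ (j - j) + (\<Sum>i\<in>{j<..?n}. c i * a ^ (i - j))"
      unfolding d_def using jn by (simp add: sum.head)
    then have "d - 1 = (\<Sum>i\<in>{j<..?n}. a ^ (i - j) * c i)" using cj by (simp add: mult.commute)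
    then show ?thesis using W.m_mult[OF W.A_power[OF a(1)] cm] by (auto intro: W.m_sum)
  qed
  have "d \<in> valuation_ring L w' \<and> a * d \<in> valuation_ring L w'"
    if w': "valuation L w'" "\<forall>x\<in>K - {0}. w' x = w x" for w' :: "'a \<Rightarrow> 'g"
  proof -
    interpret W': valued_field L w' by (rule valued_field.intro[OF L w'(1)])
    have cA': "c i \<in> W'.A" for i
    proof (cases "c i = 0")
      case False
      then have "w' (c i) = w (c i)" using w'(2) cK[of i] by simp
      then show ?thesis using cA[of i] cL[of i] False by (simp add: W'.A_iff)
    qed (simp add: W'.A_zero)
    show ?thesis
    proof (cases "a \<in> W'.A")
      case True
      then have "d \<in> W'.A"
        unfolding d_def by (intro W'.A_sum W'.A_mult W'.A_power cA')
      then show ?thesis using True W'.A_mult by blast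
    next
      case False
      define b where "b = inverse a"
      have b: "a \<noteq> 0" "b \<in> W'.A" using W'.inverse_in_m[OF aL False] W'.m_sub by (auto simp: b_def)
      have "d * a ^ j = (\<Sum>i\<in>{j..?n}. c i * a ^ i)"
        unfolding d_def sum_distrib_right
        by (intro sum.cong) (auto simp: mult.assoc simp flip: power_add)
      moreover have "{..?n} = {..<j} \<union> {j..?n}" using jn by auto
      then have "(\<Sum>i\<le>?n. c i * a ^ i) = (\<Sum>i<j. c i * a ^ i) + (\<Sum>i\<in>{j..?n}. c i * a ^ i)"
        by (simp only:) (rule sum.union_disjoint, auto)
      ultimately have da: "d * a ^ j = - (\<Sum>i<j. c i * a ^ i)"
        using zero by (simp add: eq_neg_iff_add_eq_0 add.commute)
      have ab: "a ^ i * b ^ k = b ^ (k - i)" if "i \<le> k" for i k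
      proof -
        have "b ^ k = b ^ i * b ^ (k - i)" using that by (simp flip: power_add)
        then show ?thesis using b(1) by (simp add: b_def mult.assoc[symmetric] flip: power_mult_distrib)
      qed
      have "d = d * a ^ j * b ^ j" using ab[of j j] by (simp add: mult.assoc)
      also have "\<dots> = - (\<Sum>i<j. c i * (a ^ i * b ^ j))"
        unfolding da by (simp add: sum_distrib_right mult.assoc)
      also have "\<dots> = - (\<Sum>i<j. c i * b ^ (j - i))" by (simp add: ab)
      finally have d: "d = - (\<Sum>i<j. c i * b ^ (j - i))" .
      have "a * b ^ (j - i) = b ^ (j - i - 1)" if "i < j" for i
        using ab[of 1 "j - i"] that by simp
      then have "a * (c i * b ^ (j - i)) = c i * b ^ (j - i - 1)" if "i < j" for i
        using that by (metis mult.left_commute)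
      then have "(\<Sum>i<j. a * (c i * b ^ (j - i))) = (\<Sum>i<j. c i * b ^ (j - i - 1))"
        by (intro sum.cong) auto
      then have "a * d = - (\<Sum>i<j. c i * b ^ (j - i - 1))"
        unfolding d by (simp only: mult_minus_right sum_distrib_left)
      moreover have "(\<Sum>i<j. c i * b ^ (j - i - 1)) \<in> W'.A" "(\<Sum>i<j. c i * b ^ (j - i)) \<in> W'.A"
        by (intro W'.A_sum W'.A_mult W'.A_power cA' b)+
      ultimately show ?thesis using d W'.A_uminus by auto
    qed
  qed
  then show ?thesis using that dL d1 by blast
qed


section \<open>Tame inertia\<close>

context galois begin

lemma stabilizer_normal:
  assumes Y: "Y \<subseteq> L" "\<And>\<sigma> y. \<sigma> \<in> Gal \<Longrightarrow> y \<in> Y \<Longrightarrow> \<sigma> y \<in> Y"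
  shows "stabilizer Y \<lhd> galois_group L K"
proof (subst G.normal_inv_iff, intro conjI ballI)
  let ?G = "galois_group L K"
  have yL: "y \<in> Y \<Longrightarrow> y \<in> L" for y using Y(1) by blast
  show "subgroup (stabilizer Y) ?G"
  proof (rule G.subgroupI)
    show "stabilizer Y \<subseteq> Gal" by (auto simp: stabilizer_def)
    have "\<one>\<^bsub>?G\<^esub> \<in> stabilizer Y" using one_apply yL by (simp add: stabilizer_def)
    then show "stabilizer Y \<noteq> {}" by blast
    show "inv\<^bsub>?G\<^esub> \<sigma> \<in> stabilizer Y" if "\<sigma> \<in> stabilizer Y" for \<sigma>
    proof -
      have s: "\<sigma> \<in> Gal" "\<And>y. y \<in> Y \<Longrightarrow> \<sigma> y = y" using that by (auto simp: stabilizer_def)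
      have "(inv\<^bsub>?G\<^esub> \<sigma>) y = y" if "y \<in> Y" for y
        using app_inv(2)[OF s(1) yL[OF that]] s(2)[OF that] by simp
      then show ?thesis using s(1) by (simp add: stabilizer_def)
    qed
    show "\<sigma> \<star> \<tau> \<in> stabilizer Y" if "\<sigma> \<in> stabilizer Y" "\<tau> \<in> stabilizer Y" for \<sigma> \<tau>
    proof -
      have s: "\<sigma> \<in> Gal" "\<And>y. y \<in> Y \<Longrightarrow> \<sigma> y = y" "\<tau> \<in> Gal" "\<And>y. y \<in> Y \<Longrightarrow> \<tau> y = y"
        using that by (auto simp: stabilizer_def)
      have "(\<sigma> \<star> \<tau>) y = y" if "y \<in> Y" for y
        using comp_apply[OF s(1,3) yL[OF that]] s(2,4)[OF that] by simp
      then show ?thesis using s(1,3) by (simp add: stabilizer_def)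
    qed
  qed
  fix \<sigma> \<theta> assume st: "\<sigma> \<in> Gal" "\<theta> \<in> stabilizer Y"
  then have \<theta>: "\<theta> \<in> Gal" "\<And>y. y \<in> Y \<Longrightarrow> \<theta> y = y" by (auto simp: stabilizer_def)
  have inv: "inv\<^bsub>?G\<^esub> \<sigma> \<in> Gal" using st(1) by simp
  have "(\<sigma> \<star> \<theta> \<star> inv\<^bsub>?G\<^esub> \<sigma>) y = y" if y: "y \<in> Y" for y
  proof -
    have i: "(inv\<^bsub>?G\<^esub> \<sigma>) y \<in> Y" using Y(2)[OF inv y] .
    have "(\<sigma> \<star> \<theta> \<star> inv\<^bsub>?G\<^esub> \<sigma>) y = (\<sigma> \<star> \<theta>) ((inv\<^bsub>?G\<^esub> \<sigma>) y)"
      using comp_apply[OF G.m_closed[OF st(1) \<theta>(1)] inv yL[OF y]] .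
    also have "\<dots> = \<sigma> (\<theta> ((inv\<^bsub>?G\<^esub> \<sigma>) y))" using comp_apply[OF st(1) \<theta>(1) yL[OF i]] .
    also have "\<dots> = y" using \<theta>(2)[OF i] app_inv(1)[OF st(1) yL[OF y]] by simp
    finally show ?thesis .
  qed
  then show "\<sigma> \<star> \<theta> \<star> inv\<^bsub>?G\<^esub> \<sigma> \<in> stabilizer Y" using st(1) \<theta>(1) by (simp add: stabilizer_def)
qed

lemma card_transversal:
  assumes Y: "Y \<subseteq> L" "\<And>\<sigma> y. \<sigma> \<in> Gal \<Longrightarrow> y \<in> Y \<Longrightarrow> \<sigma> y \<in> Y"
    and \<Gamma>: "transversal Gal Y \<Gamma>"
  shows "card \<Gamma> = card (rcosets\<^bsub>galois_group L K\<^esub> (stabilizer Y))"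
proof -
  let ?G = "galois_group L K"
  let ?N = "stabilizer Y"
  interpret N: normal ?N ?G by (rule stabilizer_normal[OF Y(1)]) (rule Y(2))
  have sub: "subgroup ?N ?G" by (rule N.subgroup_axioms)
  have g: "\<And>\<gamma>. \<gamma> \<in> \<Gamma> \<Longrightarrow> \<gamma> \<in> Gal" using \<Gamma> by (auto simp: transversal_def)
  have "bij_betw (\<lambda>\<gamma>. ?N #>\<^bsub>?G\<^esub> \<gamma>) \<Gamma> (rcosets\<^bsub>?G\<^esub> ?N)"
    unfolding bij_betw_def
  proof
    show "inj_on (\<lambda>\<gamma>. ?N #>\<^bsub>?G\<^esub> \<gamma>) \<Gamma>"
    proof (rule inj_onI)
      fix \<gamma> \<delta> assume gd: "\<gamma> \<in> \<Gamma>" "\<delta> \<in> \<Gamma>" "?N #>\<^bsub>?G\<^esub> \<gamma> = ?N #>\<^bsub>?G\<^esub> \<delta>"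
      have "\<gamma> \<in> ?N #>\<^bsub>?G\<^esub> \<delta>" using G.rcos_self[OF g[OF gd(1)] sub] gd(3) by simp
      then obtain \<nu> where \<nu>: "\<nu> \<in> ?N" "\<gamma> = \<nu> \<star> \<delta>" by (auto simp: r_coset_def)
      have "\<gamma> y = \<delta> y" if y: "y \<in> Y" for y
      proof -
        have "\<nu> \<in> Gal" "\<forall>y\<in>Y. \<nu> y = y" using \<nu>(1) unfolding stabilizer_def by blast+
        moreover have "y \<in> L" "\<delta> y \<in> Y" by (rule subsetD[OF Y(1) y], rule Y(2)[OF g[OF gd(2)] y])
        ultimately show ?thesis using comp_apply[OF _ g[OF gd(2)]] \<nu>(2) by simp
      qed
      then have "agree Y \<gamma> \<delta>" by (simp add: agree_def)
      then show "\<gamma> = \<delta>" using \<Gamma> gd(1,2) unfolding transversal_def by blast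
    qed
    show "(\<lambda>\<gamma>. ?N #>\<^bsub>?G\<^esub> \<gamma>) ` \<Gamma> = rcosets\<^bsub>?G\<^esub> ?N"
    proof
      show "rcosets\<^bsub>?G\<^esub> ?N \<subseteq> (\<lambda>\<gamma>. ?N #>\<^bsub>?G\<^esub> \<gamma>) ` \<Gamma>"
      proof
        fix C assume "C \<in> rcosets\<^bsub>?G\<^esub> ?N"
        then obtain \<sigma> where \<sigma>: "\<sigma> \<in> Gal" "C = ?N #>\<^bsub>?G\<^esub> \<sigma>" by (auto simp: RCOSETS_def)
        obtain \<gamma> where \<gamma>: "\<gamma> \<in> \<Gamma>" "agree Y \<sigma> \<gamma>" using \<Gamma> \<sigma>(1) unfolding transversal_def by blast
        have gG: "\<gamma> \<in> Gal" "inv\<^bsub>?G\<^esub> \<gamma> \<in> Gal" using g[OF \<gamma>(1)] by auto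
        have "(\<sigma> \<star> inv\<^bsub>?G\<^esub> \<gamma>) y = y" if y: "y \<in> Y" for y
        proof -
          have i: "(inv\<^bsub>?G\<^esub> \<gamma>) y \<in> Y" by (rule Y(2)[OF gG(2) y])
          have "(\<sigma> \<star> inv\<^bsub>?G\<^esub> \<gamma>) y = \<gamma> ((inv\<^bsub>?G\<^esub> \<gamma>) y)"
            using comp_apply[OF \<sigma>(1) gG(2) subsetD[OF Y(1) y]] \<gamma>(2) i by (simp add: agree_def)
          then show ?thesis using app_inv(1)[OF gG(1) subsetD[OF Y(1) y]] by simp
        qed
        then have "\<sigma> \<star> inv\<^bsub>?G\<^esub> \<gamma> \<in> ?N"
          unfolding stabilizer_def using G.m_closed[OF \<sigma>(1) gG(2)] by blast
        moreover have "\<sigma> = \<sigma> \<star> inv\<^bsub>?G\<^esub> \<gamma> \<star> \<gamma>" using \<sigma>(1) gG(1) by (simp add: G.m_assoc)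
        ultimately have "\<sigma> \<in> ?N #>\<^bsub>?G\<^esub> \<gamma>" unfolding r_coset_def by blast
        then have "C = ?N #>\<^bsub>?G\<^esub> \<gamma>" using G.repr_independence[OF _ gG(1) sub] \<sigma>(2) by simp
        then show "C \<in> (\<lambda>\<gamma>. ?N #>\<^bsub>?G\<^esub> \<gamma>) ` \<Gamma>" using \<gamma>(1) by blast
      qed
    qed (use g in \<open>auto simp: RCOSETS_def\<close>)
  qed
  then show ?thesis by (rule bij_betw_same_card)
qed

lemma valuation_comp:
  assumes "valuation L (w :: 'a \<Rightarrow> 'g::linordered_ab_group_add)" "\<sigma> \<in> Gal"
  shows "valuation L (\<lambda>x. w (\<sigma> x))"
proof -
  have nz: "\<sigma> x \<noteq> 0" if "x \<in> L" "x \<noteq> 0" for x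
    using app_inj[OF assms(2) that(1) L_closed(1)] app_0[OF assms(2)] that(2) by simp
  show ?thesis
    unfolding valuation_def
  proof (intro ballI)
    fix x y assume xy: "x \<in> L - {0}" "y \<in> L - {0}"
    then have L: "x \<in> L" "y \<in> L" "\<sigma> x \<in> L - {0}" "\<sigma> y \<in> L - {0}"
      using nz app_closed[OF assms(2)] by auto
    have "\<sigma> x + \<sigma> y \<noteq> 0" if "x + y \<noteq> 0"
      using nz[OF L_closed(3)[OF L(1,2)] that] app_add[OF assms(2) L(1,2)] by simp
    then show "w (\<sigma> (x * y)) = w (\<sigma> x) + w (\<sigma> y) \<and> (x + y \<noteq> 0 \<longrightarrow> min (w (\<sigma> x)) (w (\<sigma> y)) \<le> w (\<sigma> (x + y)))"
      using assms(1) L(3,4) unfolding valuation_def app_add[OF assms(2) L(1,2)] app_mult[OF assms(2) L(1,2)]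
      by blast
  qed
qed

text \<open>
  A transversal adapted to a subgroup \<open>H\<close>: representatives of the restrictions of \<open>H\<close> times representatives
  of the right cosets of \<open>H\<close>. Stability of \<open>Y\<close> is used to cancel a coset representative on the right.
\<close>

lemma product_transversal:
  assumes Y: "Y \<subseteq> L" "\<And>\<sigma> y. \<sigma> \<in> Gal \<Longrightarrow> y \<in> Y \<Longrightarrow> \<sigma> y \<in> Y"
    and H: "subgroup H (galois_group L K)"
    and \<Gamma>H: "transversal H Y \<Gamma>H"
    and R: "finite R" "R \<subseteq> Gal" "\<And>\<sigma>. \<sigma> \<in> Gal \<Longrightarrow> \<exists>\<rho>\<in>R. \<sigma> \<star> inv\<^bsub>galois_group L K\<^esub> \<rho> \<in> H"
      "\<And>\<rho> \<rho>' \<theta> \<theta>'. \<rho> \<in> R \<Longrightarrow> \<rho>' \<in> R \<Longrightarrow> \<theta> \<in> H \<Longrightarrow> \<theta>' \<in> H \<Longrightarrow> agree Y (\<theta> \<star> \<rho>) (\<theta>' \<star> \<rho>') \<Longrightarrow> \<rho> = \<rho>'"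
  shows "inj_on (\<lambda>(\<theta>, \<rho>). \<theta> \<star> \<rho>) (\<Gamma>H \<times> R)" "transversal Gal Y ((\<lambda>(\<theta>, \<rho>). \<theta> \<star> \<rho>) ` (\<Gamma>H \<times> R))"
proof -
  interpret H: subgroup H "galois_group L K" by (rule H)
  have HG: "\<theta> \<in> Gal" if "\<theta> \<in> H" for \<theta> using that H.subset by blast
  have RG: "\<rho> \<in> Gal" if "\<rho> \<in> R" for \<rho> using that R(2) by blast
  have \<Gamma>: "\<And>\<theta>. \<theta> \<in> \<Gamma>H \<Longrightarrow> \<theta> \<in> H" "finite \<Gamma>H" using \<Gamma>H by (auto simp: transversal_def)
  have yL: "y \<in> Y \<Longrightarrow> y \<in> L" for y using Y(1) by blast
  have unique: "\<theta> = \<theta>' \<and> \<rho> = \<rho>'"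
    if *: "\<theta> \<in> \<Gamma>H" "\<theta>' \<in> \<Gamma>H" "\<rho> \<in> R" "\<rho>' \<in> R" and ag: "agree Y (\<theta> \<star> \<rho>) (\<theta>' \<star> \<rho>')" for \<theta> \<theta>' \<rho> \<rho>'
  proof -
    have r: "\<rho> = \<rho>'" by (rule R(4)[OF *(3,4) \<Gamma>(1)[OF *(1)] \<Gamma>(1)[OF *(2)] ag])
    have G: "\<theta> \<in> Gal" "\<theta>' \<in> Gal" "\<rho> \<in> Gal" "inv\<^bsub>galois_group L K\<^esub> \<rho> \<in> Gal"
      using HG[OF \<Gamma>(1)[OF *(1)]] HG[OF \<Gamma>(1)[OF *(2)]] RG[OF *(3)] by auto
    have "\<theta> y = \<theta>' y" if y: "y \<in> Y" for y
    proof -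
      let ?z = "(inv\<^bsub>galois_group L K\<^esub> \<rho>) y"
      have z: "?z \<in> Y" by (rule Y(2)[OF G(4) y])
      have "(\<theta> \<star> \<rho>) ?z = (\<theta>' \<star> \<rho>) ?z" using ag z r by (simp add: agree_def)
      then have "\<theta> (\<rho> ?z) = \<theta>' (\<rho> ?z)"
        using comp_apply[OF G(1,3) yL[OF z]] comp_apply[OF G(2,3) yL[OF z]] by simp
      then show ?thesis using app_inv(1)[OF G(3) yL[OF y]] by simp
    qed
    then have "agree Y \<theta> \<theta>'" by (simp add: agree_def)
    then show ?thesis using r *(1,2) \<Gamma>H unfolding transversal_def by blast
  qed
  show "inj_on (\<lambda>(\<theta>, \<rho>). \<theta> \<star> \<rho>) (\<Gamma>H \<times> R)"
  proof (rule inj_onI, clarify)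
    fix \<theta> \<rho> \<theta>' \<rho>' assume "\<theta> \<in> \<Gamma>H" "\<rho> \<in> R" "\<theta>' \<in> \<Gamma>H" "\<rho>' \<in> R" "\<theta> \<star> \<rho> = \<theta>' \<star> \<rho>'"
    then show "\<theta> = \<theta>' \<and> \<rho> = \<rho>'" using unique[of \<theta> \<theta>' \<rho> \<rho>'] by (simp add: agree_def)
  qed
  show "transversal Gal Y ((\<lambda>(\<theta>, \<rho>). \<theta> \<star> \<rho>) ` (\<Gamma>H \<times> R))"
    unfolding transversal_def
  proof (intro conjI ballI impI)
    show "finite ((\<lambda>(\<theta>, \<rho>). \<theta> \<star> \<rho>) ` (\<Gamma>H \<times> R))" using \<Gamma>(2) R(1) by simp
    show "(\<lambda>(\<theta>, \<rho>). \<theta> \<star> \<rho>) ` (\<Gamma>H \<times> R) \<subseteq> Gal" 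
    proof
      fix \<gamma> assume "\<gamma> \<in> (\<lambda>(\<theta>, \<rho>). \<theta> \<star> \<rho>) ` (\<Gamma>H \<times> R)"
      then obtain \<theta> \<rho> where *: "\<theta> \<in> \<Gamma>H" "\<rho> \<in> R" "\<gamma> = \<theta> \<star> \<rho>" by auto
      then show "\<gamma> \<in> Gal" using G.m_closed[OF HG[OF \<Gamma>(1)[OF *(1)]] RG[OF *(2)]] by simp
    qed
    fix \<gamma> \<delta>
    assume "\<gamma> \<in> (\<lambda>(\<theta>, \<rho>). \<theta> \<star> \<rho>) ` (\<Gamma>H \<times> R)" "\<delta> \<in> (\<lambda>(\<theta>, \<rho>). \<theta> \<star> \<rho>) ` (\<Gamma>H \<times> R)" "agree Y \<gamma> \<delta>"
    moreover from this obtain \<theta> \<rho> \<theta>' \<rho>' where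
      *: "\<theta> \<in> \<Gamma>H" "\<theta>' \<in> \<Gamma>H" "\<rho> \<in> R" "\<rho>' \<in> R" "\<gamma> = \<theta> \<star> \<rho>" "\<delta> = \<theta>' \<star> \<rho>'" by auto
    ultimately show "\<gamma> = \<delta>" using unique[OF *(1-4)] by simp
  next
    fix \<sigma> assume \<sigma>: "\<sigma> \<in> Gal"
    obtain \<rho> where \<rho>: "\<rho> \<in> R" "\<sigma> \<star> inv\<^bsub>galois_group L K\<^esub> \<rho> \<in> H" using R(3)[OF \<sigma>] by blast
    obtain \<theta> where \<theta>: "\<theta> \<in> \<Gamma>H" "agree Y (\<sigma> \<star> inv\<^bsub>galois_group L K\<^esub> \<rho>) \<theta>"
      using \<Gamma>H \<rho>(2) unfolding transversal_def by blast
    have \<rho>G: "\<rho> \<in> Gal" "inv\<^bsub>galois_group L K\<^esub> \<rho> \<in> Gal" using RG[OF \<rho>(1)] by auto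
    have "\<sigma> y = (\<theta> \<star> \<rho>) y" if y: "y \<in> Y" for y
    proof -
      have "(\<theta> \<star> \<rho>) y = \<theta> (\<rho> y)" using comp_apply[OF HG[OF \<Gamma>(1)[OF \<theta>(1)]] \<rho>G(1) yL[OF y]] .
      also have "\<dots> = (\<sigma> \<star> inv\<^bsub>galois_group L K\<^esub> \<rho>) (\<rho> y)" using \<theta>(2) Y(2)[OF \<rho>G(1) y] by (simp add: agree_def)
      also have "\<dots> = \<sigma> ((inv\<^bsub>galois_group L K\<^esub> \<rho>) (\<rho> y))"
        using comp_apply[OF \<sigma> \<rho>G(2) yL[OF Y(2)[OF \<rho>G(1) y]]] .
      also have "\<dots> = \<sigma> y" using app_inv(2)[OF \<rho>G(1) yL[OF y]] by simp
      finally show ?thesis by simp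
    qed
    then have "agree Y \<sigma> (\<theta> \<star> \<rho>)" by (simp add: agree_def)
    then show "\<exists>\<gamma>\<in>(\<lambda>(\<theta>, \<rho>). \<theta> \<star> \<rho>) ` (\<Gamma>H \<times> R). agree Y \<sigma> \<gamma>" 
      by (rule bexI[of _ "\<theta> \<star> \<rho>"]) (use \<theta>(1) \<rho>(1) in auto)
  qed
qed

lemma pro_p_transversal:
  assumes pro: "pro_p_galois_extension p L K"
    and Y: "finite Y" "Y \<subseteq> L" "\<And>\<sigma> y. \<sigma> \<in> Gal \<Longrightarrow> y \<in> Y \<Longrightarrow> \<sigma> y \<in> Y"
    and \<Gamma>: "transversal Gal Y \<Gamma>"
  obtains k where "card \<Gamma> = p ^ k"
proof -
  have "stabilizer Y \<lhd> galois_group L K" by (rule stabilizer_normal[OF Y(2)]) (rule Y(3))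
  moreover have "openin (krull_topology L K) (stabilizer Y)" by (rule openin_stabilizer[OF Y(1,2)])
  ultimately obtain k where "card (rcosets\<^bsub>galois_group L K\<^esub> (stabilizer Y)) = p ^ k"
    using pro unfolding pro_p_galois_extension_def by blast
  moreover have "card \<Gamma> = card (rcosets\<^bsub>galois_group L K\<^esub> (stabilizer Y))"
    by (rule card_transversal[OF Y(2) _ \<Gamma>]) (rule Y(3))
  ultimately show ?thesis using that by simp
qed

text \<open>
  The heart of the proof: inertia modulo finitely many conditions moves a \<open>p\<close>-th root of a uniformizer. The
  inertia group is replaced by the subgroup \<open>H\<close> of all \<open>\<theta>\<close> with \<open>\<theta> c \<equiv> c\<close> modulo the maximal ideal, for \<open>c\<close> in a
  monoid \<open>M\<close> of elements that are integral at all conjugates of the valuation. On \<open>M\<close> every automorphism, not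
  only those of the decomposition group, is a character with integral values; this takes the place of
  separating the conjugate valuations by approximation. The common denominators of the elements of \<open>B\<close>, which are in \<open>M\<close>,
  show that \<open>H\<close> satisfies the conditions given by \<open>B\<close>.
\<close>

lemma tame_inertia_finite:
  fixes w :: "'a \<Rightarrow> 'g::linordered_ab_group_add"
  assumes pro: "pro_p_galois_extension p L K" and p: "2 \<le> p"
    and w: "valuation L w" and char: "of_nat p \<notin> valuation_ideal L w"
    and roots: "\<And>x. x \<in> L \<Longrightarrow> x ^ p = 1 \<Longrightarrow> x \<in> K"
    and s: "s \<in> L" "s ^ p = t" and t: "uniformizer K w t"
    and B: "finite B" "B \<subseteq> valuation_ring L w"
  shows "\<exists>\<sigma>\<in>Gal. \<sigma> s \<noteq> s \<and> (\<forall>a\<in>B. \<sigma> a - a \<in> valuation_ideal L w)"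
proof (rule ccontr)
  assume "\<not> ?thesis"
  then have contra: "\<sigma> s = s" if "\<sigma> \<in> Gal" "\<forall>a\<in>B. \<sigma> a - a \<in> valuation_ideal L w" for \<sigma> using that by blast
  interpret W: valued_field L w by (rule valued_field.intro[OF L w])
  let ?G = "galois_group L K"
  have tK: "t \<in> K" "t \<noteq> 0" "0 < w t" and t_min: "\<And>x. x \<in> K \<Longrightarrow> x \<noteq> 0 \<Longrightarrow> 0 < w x \<Longrightarrow> w t \<le> w x"
    using t by (auto simp: uniformizer_def)
  have s0: "s \<noteq> 0" using s tK p by auto
  have AL: "x \<in> L" if "x \<in> W.A" for x using that by (simp add: W.A_iff)

  \<comment> \<open>Elements that are integral at all conjugates of the valuation.\<close>
  define D where "D = {c \<in> L. \<forall>\<sigma>\<in>Gal. \<sigma> c \<in> W.A}"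
  have DA: "c \<in> W.A" if "c \<in> D" for c
  proof -
    have "\<one>\<^bsub>?G\<^esub> c \<in> W.A" "c \<in> L" using that G.one_closed unfolding D_def by blast+
    then show ?thesis using one_apply by simp
  qed
  have "\<exists>d. d \<in> D \<and> a * d \<in> D \<and> d - 1 \<in> W.m" if a: "a \<in> B" for a
  proof -
    have aA: "a \<in> W.A" using a B(2) by blast
    obtain d where d: "d \<in> L" "d - 1 \<in> W.m"
      "\<And>w' :: 'a \<Rightarrow> 'g. valuation L w' \<Longrightarrow> (\<forall>x\<in>K - {0}. w' x = w x) \<Longrightarrow>
        d \<in> valuation_ring L w' \<and> a * d \<in> valuation_ring L w'"
      using common_denominator[OF K K_sub L w aA algebraic[OF AL[OF aA]]] by blast
    have "\<sigma> d \<in> W.A \<and> \<sigma> (a * d) \<in> W.A" if \<sigma>: "\<sigma> \<in> Gal" for \<sigma>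
    proof -
      have "d \<in> valuation_ring L (\<lambda>x. w (\<sigma> x)) \<and> a * d \<in> valuation_ring L (\<lambda>x. w (\<sigma> x))"
        by (rule d(3)[OF valuation_comp[OF w \<sigma>]]) (use app_fix[OF \<sigma>] in auto)
      moreover have "\<sigma> x \<in> W.A" if "x \<in> valuation_ring L (\<lambda>x. w (\<sigma> x))" for x
        using that app_0[OF \<sigma>] app_closed[OF \<sigma>] by (auto simp: valuation_ring_def)
      ultimately show ?thesis by blast
    qed
    then show ?thesis using d(1,2) L_closed(4)[OF AL[OF aA] d(1)] unfolding D_def by blast
  qed
  then obtain d where d: "\<And>a. a \<in> B \<Longrightarrow> d a \<in> D" "\<And>a. a \<in> B \<Longrightarrow> a * d a \<in> D" "\<And>a. a \<in> B \<Longrightarrow> d a - 1 \<in> W.m"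
    by metis
  have DL: "D \<subseteq> L" by (auto simp: D_def)

  define Y0 where "Y0 = insert s (d ` B \<union> (\<lambda>a. a * d a) ` B)"
  have Y0: "finite Y0" "Y0 \<subseteq> L" using B(1) s(1) d(1,2) DL by (auto simp: Y0_def)
  define Y where "Y = (\<Union>y\<in>Y0. (\<lambda>\<sigma>. \<sigma> y) ` Gal)"
  have "finite Y" unfolding Y_def using Y0 finite_orbit by (intro finite_UN_I) auto
  have YL: "Y \<subseteq> L" unfolding Y_def using Y0(2) app_closed by blast
  have Yst: "\<sigma> y \<in> Y" if "\<sigma> \<in> Gal" "y \<in> Y" for \<sigma> y
  proof -
    obtain \<tau> y0 where y: "y0 \<in> Y0" "\<tau> \<in> Gal" "y = \<tau> y0" using \<open>y \<in> Y\<close> unfolding Y_def by blast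
    have "\<sigma> y = (\<sigma> \<star> \<tau>) y0" using comp_apply[OF that(1) y(2)] y Y0(2) by auto
    moreover have "\<sigma> \<star> \<tau> \<in> Gal" using that y by simp
    ultimately show ?thesis using y(1) unfolding Y_def by blast
  qed
  have Y0Y: "Y0 \<subseteq> Y"
  proof
    fix y assume y: "y \<in> Y0"
    then have "y = \<one>\<^bsub>?G\<^esub> y" using one_apply Y0(2) by auto
    then show "y \<in> Y" using y G.one_closed unfolding Y_def by blast
  qed

  define M where "M = determined Y \<inter> D"
  have M_sub: "x \<in> L" if "x \<in> M" for x using that DL by (auto simp: M_def)
  have M1: "1 \<in> M"
  proof -
    have "\<sigma> 1 \<in> W.A" if "\<sigma> \<in> Gal" for \<sigma> using app_1[OF that] W.A_one by simp
    then show ?thesis using determined_closed(3) L_closed(2) by (simp add: M_def D_def)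
  qed
  have Mmult: "x * y \<in> M" if "x \<in> M" "y \<in> M" for x y
  proof -
    have "\<sigma> (x * y) \<in> W.A" if \<sigma>: "\<sigma> \<in> Gal" for \<sigma>
      using app_mult[OF \<sigma> M_sub M_sub] \<open>x \<in> M\<close> \<open>y \<in> M\<close> W.A_mult \<sigma> by (simp add: M_def D_def)
    then show ?thesis using that determined_closed(5) L_closed(4) by (simp add: M_def D_def)
  qed
  have Mst: "\<tau> c \<in> M" if \<tau>: "\<tau> \<in> Gal" and c: "c \<in> M" for \<tau> c
  proof -
    have cL: "c \<in> L" by (rule M_sub[OF c])
    have "\<sigma> (\<tau> c) \<in> W.A" if \<sigma>: "\<sigma> \<in> Gal" for \<sigma>
    proof -
      have "(\<sigma> \<star> \<tau>) c \<in> W.A" using c G.m_closed[OF \<sigma> \<tau>] unfolding M_def D_def by blast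
      then show ?thesis using comp_apply[OF \<sigma> \<tau> cL] by simp
    qed
    moreover have "\<sigma> (\<tau> c) = \<sigma>' (\<tau> c)" if \<sigma>: "\<sigma> \<in> Gal" "\<sigma>' \<in> Gal" "agree Y \<sigma> \<sigma>'" for \<sigma> \<sigma>'
    proof -
      have "(\<sigma> \<star> \<tau>) y = (\<sigma>' \<star> \<tau>) y" if y: "y \<in> Y" for y
        using comp_apply[OF \<sigma>(1) \<tau>] comp_apply[OF \<sigma>(2) \<tau>] y YL \<sigma>(3) Yst[OF \<tau> y] by (auto simp: agree_def)
      then have "agree Y (\<sigma> \<star> \<tau>) (\<sigma>' \<star> \<tau>)" by (simp add: agree_def)
      then have "(\<sigma> \<star> \<tau>) c = (\<sigma>' \<star> \<tau>) c"
        using determinedD[OF _ G.m_closed[OF \<sigma>(1) \<tau>] G.m_closed[OF \<sigma>(2) \<tau>], of c Y] c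
        by (simp add: M_def)
      then show ?thesis using comp_apply[OF \<sigma>(1) \<tau> cL] comp_apply[OF \<sigma>(2) \<tau> cL] by simp
    qed
    ultimately show ?thesis using app_closed[OF \<tau> cL] unfolding M_def D_def determined_def by blast
  qed
  have MA: "\<sigma> c \<in> W.A" if "\<sigma> \<in> Gal" "c \<in> M" for \<sigma> c using that by (simp add: M_def D_def)

  define H where "H = {\<theta> \<in> Gal. \<forall>c\<in>M. \<theta> c - c \<in> W.m}"
  have HG: "\<theta> \<in> Gal" if "\<theta> \<in> H" for \<theta> using that by (simp add: H_def)
  have Hm: "\<theta> c - c \<in> W.m" if "\<theta> \<in> H" "c \<in> M" for \<theta> c using that by (simp add: H_def)
  have H: "subgroup H ?G"
  proof (rule G.subgroupI)
    show "H \<subseteq> Gal" by (auto simp: H_def)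
    have "\<one>\<^bsub>?G\<^esub> \<in> H" using one_apply M_sub W.m_zero by (simp add: H_def)
    then show "H \<noteq> {}" by blast
    show "inv\<^bsub>?G\<^esub> \<theta> \<in> H" if \<theta>: "\<theta> \<in> H" for \<theta>
    proof -
      have i: "inv\<^bsub>?G\<^esub> \<theta> \<in> Gal" using HG[OF \<theta>] by simp
      have "(inv\<^bsub>?G\<^esub> \<theta>) c - c \<in> W.m" if c: "c \<in> M" for c
        using W.m_uminus[OF Hm[OF \<theta> Mst[OF i c]]] app_inv(1)[OF HG[OF \<theta>] M_sub[OF c]] by simp
      then show ?thesis using i by (simp add: H_def)
    qed
    show "\<theta> \<star> \<eta> \<in> H" if \<theta>: "\<theta> \<in> H" and \<eta>: "\<eta> \<in> H" for \<theta> \<eta>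
    proof -
      have "(\<theta> \<star> \<eta>) c - c \<in> W.m" if c: "c \<in> M" for c
      proof -
        have "(\<theta> \<star> \<eta>) c - c = (\<theta> (\<eta> c) - \<eta> c) + (\<eta> c - c)"
          using comp_apply[OF HG[OF \<theta>] HG[OF \<eta>] M_sub[OF c]] by simp
        then show ?thesis using W.m_add[OF Hm[OF \<theta> Mst[OF HG[OF \<eta>] c]] Hm[OF \<eta> c]] by simp
      qed
      then show ?thesis using HG[OF \<theta>] HG[OF \<eta>] by (simp add: H_def)
    qed
  qed
  have Hs: "\<theta> s = s" if \<theta>: "\<theta> \<in> H" for \<theta>
  proof (rule contra[OF HG[OF \<theta>]], rule ballI)
    fix a assume a: "a \<in> B"
    have aA: "a \<in> W.A" using a B(2) by blast
    have dM: "d a \<in> M" "a * d a \<in> M"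
      using d(1,2)[OF a] Y0Y determined_closed(1)[OF YL] a by (auto simp: M_def Y0_def)
    let ?e = "\<theta> (d a)"
    have "(\<theta> a - a) * ?e = (\<theta> (a * d a) - a * d a) - a * (?e - d a)"
      using app_mult[OF HG[OF \<theta>] AL[OF aA] M_sub[OF dM(1)]] by (simp add: algebra_simps)
    then have 1: "(\<theta> a - a) * ?e \<in> W.m"
      using W.m_diff[OF Hm[OF \<theta> dM(2)] W.m_mult[OF aA Hm[OF \<theta> dM(1)]]] by simp
    have "?e - 1 = (?e - d a) + (d a - 1)" by simp
    then have e1: "?e - 1 \<in> W.m" using W.m_add[OF Hm[OF \<theta> dM(1)] d(3)[OF a]] by simp
    have eu: "?e \<notin> W.m" "?e \<in> W.A" using W.one_unit[OF e1] by auto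
    have "inverse ?e * ((\<theta> a - a) * ?e) \<in> W.m"
      by (rule W.m_mult[OF W.inverse_in_A[OF AL[OF eu(2)] eu(1)] 1])
    moreover have "?e \<noteq> 0" using eu(1) W.m_zero by auto
    then have "inverse ?e * ((\<theta> a - a) * ?e) = \<theta> a - a" by simp
    ultimately show "\<theta> a - a \<in> W.m" by (simp only:)
  qed

  obtain \<Gamma>H where \<Gamma>H: "transversal H Y \<Gamma>H"
    using transversal_exists[OF \<open>finite Y\<close> YL subgroup.subset[OF H]] .
  obtain \<Gamma>0 where \<Gamma>0: "transversal Gal Y \<Gamma>0" using transversal_exists[OF \<open>finite Y\<close> YL subset_refl] .
  have \<Gamma>HH: "\<theta> \<in> H" if "\<theta> \<in> \<Gamma>H" for \<theta> using that \<Gamma>H by (auto simp: transversal_def)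
  have \<Gamma>H_fin: "finite \<Gamma>H" using \<Gamma>H by (simp add: transversal_def)

  define cong where "cong \<sigma> \<tau> \<longleftrightarrow> (\<forall>c\<in>M. \<sigma> c - \<tau> c \<in> W.m)" for \<sigma> \<tau> :: "'a \<Rightarrow> 'a"
  have cong_sym: "cong \<tau> \<sigma>" if "cong \<sigma> \<tau>" for \<sigma> \<tau>
    using that W.m_uminus unfolding cong_def by (metis minus_diff_eq)
  have cong_trans: "cong \<sigma> \<upsilon>" if "cong \<sigma> \<tau>" "cong \<tau> \<upsilon>" for \<sigma> \<tau> \<upsilon>
    unfolding cong_def
  proof
    fix c assume "c \<in> M"
    then have "(\<sigma> c - \<tau> c) + (\<tau> c - \<upsilon> c) \<in> W.m" using that by (intro W.m_add) (auto simp: cong_def)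
    then show "\<sigma> c - \<upsilon> c \<in> W.m" by simp
  qed
  have cong_refl: "cong \<sigma> \<sigma>" for \<sigma> using W.m_zero by (simp add: cong_def)
  have cong_agree: "cong \<sigma> \<tau>" if "\<sigma> \<in> Gal" "\<tau> \<in> Gal" "agree Y \<sigma> \<tau>" for \<sigma> \<tau>
    unfolding cong_def
  proof
    fix c assume "c \<in> M"
    then have "\<sigma> c = \<tau> c" using determinedD[OF _ that] by (simp add: M_def)
    then show "\<sigma> c - \<tau> c \<in> W.m" using W.m_zero by simp
  qed
  have cong_H: "cong (\<theta> \<star> \<rho>) \<rho>" if "\<theta> \<in> H" "\<rho> \<in> Gal" for \<theta> \<rho>
    unfolding cong_def
    using Hm[OF that(1) Mst[OF that(2)]] comp_apply[OF HG[OF that(1)] that(2) M_sub] by simp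
  \<comment> \<open>Representatives of the right cosets of \<open>H\<close>, that is, of the characters of \<open>M\<close> modulo the maximal ideal.\<close>
  define cls where "cls \<gamma> = {\<delta> \<in> \<Gamma>0. cong \<gamma> \<delta>}" for \<gamma>
  define R where "R = inv_into \<Gamma>0 cls ` cls ` \<Gamma>0"
  have \<Gamma>0G: "\<gamma> \<in> Gal" if "\<gamma> \<in> \<Gamma>0" for \<gamma> using that \<Gamma>0 by (auto simp: transversal_def)
  have RG0: "R \<subseteq> \<Gamma>0" unfolding R_def by (auto intro: inv_into_into)
  have R_fin: "finite R" unfolding R_def using \<Gamma>0 by (simp add: transversal_def)
  have RG: "\<rho> \<in> Gal" if "\<rho> \<in> R" for \<rho> using that RG0 \<Gamma>0G by blast
  have cls_eq: "cls \<gamma> = cls \<delta>" if "cong \<gamma> \<delta>" for \<gamma> \<delta>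
    using that cong_sym cong_trans unfolding cls_def by blast
  have R_ex: "\<exists>\<rho>\<in>R. cong \<sigma> \<rho>" if \<sigma>: "\<sigma> \<in> Gal" for \<sigma>
  proof -
    obtain \<gamma> where \<gamma>: "\<gamma> \<in> \<Gamma>0" "agree Y \<sigma> \<gamma>" using \<Gamma>0 \<sigma> unfolding transversal_def by blast
    let ?\<rho> = "inv_into \<Gamma>0 cls (cls \<gamma>)"
    have "cls ?\<rho> = cls \<gamma>" using \<gamma>(1) by (simp add: f_inv_into_f)
    moreover have "\<gamma> \<in> cls \<gamma>" using \<gamma>(1) cong_refl by (simp add: cls_def)
    ultimately have "cong ?\<rho> \<gamma>" by (auto simp: cls_def)
    then have "cong \<sigma> ?\<rho>" using cong_agree[OF \<sigma> \<Gamma>0G[OF \<gamma>(1)] \<gamma>(2)] cong_sym cong_trans by blast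
    then show ?thesis using \<gamma>(1) unfolding R_def by blast
  qed
  have R_unique: "\<rho> = \<rho>'" if RR: "\<rho> \<in> R" "\<rho>' \<in> R" "cong \<rho> \<rho>'" for \<rho> \<rho>'
  proof -
    obtain u u' where u: "u \<in> cls ` \<Gamma>0" "\<rho> = inv_into \<Gamma>0 cls u" "u' \<in> cls ` \<Gamma>0" "\<rho>' = inv_into \<Gamma>0 cls u'"
      using RR(1,2) unfolding R_def by blast
    have "cls \<rho> = u" "cls \<rho>' = u'" using u f_inv_into_f[of _ cls \<Gamma>0] by simp_all
    then show ?thesis using cls_eq[OF RR(3)] u by simp
  qed
  have R_cover: "\<exists>\<rho>\<in>R. \<sigma> \<star> inv\<^bsub>?G\<^esub> \<rho> \<in> H" if \<sigma>: "\<sigma> \<in> Gal" for \<sigma>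
  proof -
    obtain \<rho> where \<rho>: "\<rho> \<in> R" "cong \<sigma> \<rho>" using R_ex[OF \<sigma>] by blast
    have i: "inv\<^bsub>?G\<^esub> \<rho> \<in> Gal" using RG[OF \<rho>(1)] by simp
    have "(\<sigma> \<star> inv\<^bsub>?G\<^esub> \<rho>) c - c \<in> W.m" if c: "c \<in> M" for c
      using comp_apply[OF \<sigma> i M_sub[OF c]] app_inv(1)[OF RG[OF \<rho>(1)] M_sub[OF c]] \<rho>(2) Mst[OF i c]
      unfolding cong_def by (metis)
    then have "\<sigma> \<star> inv\<^bsub>?G\<^esub> \<rho> \<in> H" using \<sigma> i by (simp add: H_def)
    then show ?thesis using \<rho>(1) by blast
  qed
  have R_sep: "\<rho> = \<rho>'"
    if *: "\<rho> \<in> R" "\<rho>' \<in> R" "\<theta> \<in> H" "\<theta>' \<in> H" "agree Y (\<theta> \<star> \<rho>) (\<theta>' \<star> \<rho>')" for \<rho> \<rho>' \<theta> \<theta>'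
  proof (rule R_unique[OF *(1,2)])
    have "cong (\<theta> \<star> \<rho>) (\<theta>' \<star> \<rho>')" using cong_agree *(5) HG[OF *(3)] HG[OF *(4)] RG[OF *(1)] RG[OF *(2)] by simp
    then show "cong \<rho> \<rho>'"
      using cong_H[OF *(3) RG[OF *(1)]] cong_H[OF *(4) RG[OF *(2)]] cong_sym cong_trans by blast
  qed
  let ?\<Gamma> = "(\<lambda>(\<theta>, \<rho>). \<theta> \<star> \<rho>) ` (\<Gamma>H \<times> R)"
  have RGal: "R \<subseteq> Gal" using RG by blast
  note pt = product_transversal[OF YL _ H \<Gamma>H R_fin RGal]
  have inj: "inj_on (\<lambda>(\<theta>, \<rho>). \<theta> \<star> \<rho>) (\<Gamma>H \<times> R)"
    by (rule pt(1)) (rule Yst R_cover R_sep; assumption)+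
  have \<Gamma>: "transversal Gal Y ?\<Gamma>"
    by (rule pt(2)) (rule Yst R_cover R_sep; assumption)+

  obtain k where k: "card ?\<Gamma> = p ^ k" by (rule pro_p_transversal[OF pro \<open>finite Y\<close> YL _ \<Gamma>]) (rule Yst)
  define h where "h = card \<Gamma>H"
  have "card ?\<Gamma> = h * card R" using card_image[OF inj] by (simp add: h_def card_cartesian_product)
  then have hk: "of_nat (p ^ k) = of_nat (card R) * (of_nat h :: 'a)" using k by (simp add: mult.commute flip: of_nat_mult)
  have h: "of_nat h \<notin> W.m"
    using W.of_nat_power_notin[OF char, of k] W.m_mult[OF W.A_of_nat, of "of_nat h" "card R"] hk by auto

  define \<chi> where "\<chi> \<sigma> = \<sigma> s / s" for \<sigma> :: "'a \<Rightarrow> 'a"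
  have \<chi>1: "\<chi> \<sigma> ^ p = 1" and \<chi>L: "\<chi> \<sigma> \<in> L" and \<chi>s: "\<sigma> s = \<chi> \<sigma> * s" if \<sigma>: "\<sigma> \<in> Gal" for \<sigma>
  proof -
    have "(\<sigma> s) ^ p = t" using app_power[OF \<sigma> s(1), of p] s(2) app_fix[OF \<sigma> tK(1)] by simp
    then show "\<chi> \<sigma> ^ p = 1" using s(2) tK(2) by (simp add: \<chi>_def power_divide)
    show "\<chi> \<sigma> \<in> L" using L_closed(8)[OF app_closed[OF \<sigma> s(1)] s(1)] by (simp add: \<chi>_def)
    show "\<sigma> s = \<chi> \<sigma> * s" using s0 by (simp add: \<chi>_def)
  qed
  have \<chi>K: "\<chi> \<sigma> \<in> K" if "\<sigma> \<in> Gal" for \<sigma> using roots \<chi>L \<chi>1 that by blast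
  have \<chi>u: "\<chi> \<sigma> \<in> W.A \<and> \<chi> \<sigma> \<notin> W.m" if \<sigma>: "\<sigma> \<in> Gal" for \<sigma>
  proof
    have p0: "0 < p" using p by simp
    show "\<chi> \<sigma> \<notin> W.m" using W.power_in_m[OF _ p0, of "\<chi> \<sigma>"] \<chi>1[OF \<sigma>] W.one_notin by auto
    show "\<chi> \<sigma> \<in> W.A"
    proof (rule ccontr)
      assume "\<chi> \<sigma> \<notin> W.A"
      then have "inverse (\<chi> \<sigma>) ^ p \<in> W.m" using W.power_in_m[OF _ p0] W.inverse_in_m[OF \<chi>L[OF \<sigma>]] by blast
      then show False using \<chi>1[OF \<sigma>] W.one_notin by (simp add: power_inverse)
    qed
  qed

  have "\<exists>c\<in>M. (\<Sum>\<rho>\<in>R. (of_nat h * \<chi> \<rho>) * \<rho> c) \<notin> W.m"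
  proof (rule ccontr)
    assume "\<not> ?thesis"
    then have rel: "\<And>c. c \<in> M \<Longrightarrow> (\<Sum>\<rho>\<in>R. (of_nat h * \<chi> \<rho>) * \<rho> c) \<in> W.m" by blast
    obtain \<rho>0 where \<rho>0: "\<rho>0 \<in> R" using R_ex[OF G.one_closed] by blast
    have "of_nat h * \<chi> \<rho>0 \<in> W.m"
    proof (rule W.dedekind_independence[where I = R and f = "\<lambda>\<rho>. \<rho>" and M = M and c = "\<lambda>\<rho>. of_nat h * \<chi> \<rho>"])
      show "\<exists>c\<in>M. \<rho> c - \<rho>' c \<notin> W.m" if "\<rho> \<in> R" "\<rho>' \<in> R" "\<rho> \<noteq> \<rho>'" for \<rho> \<rho>'
        using R_unique[OF that(1,2)] that(3) unfolding cong_def by blast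
      show "\<rho> (x * y) = \<rho> x * \<rho> y" if "\<rho> \<in> R" "x \<in> M" "y \<in> M" for \<rho> x y
        using app_mult[OF RG[OF that(1)] M_sub[OF that(2)] M_sub[OF that(3)]] .
      show "\<rho> 1 = 1" if "\<rho> \<in> R" for \<rho> by (rule app_1[OF RG[OF that]])
      show "\<rho> x \<in> W.A" if "\<rho> \<in> R" "x \<in> M" for \<rho> x by (rule MA[OF RG[OF that(1)] that(2)])
      show "of_nat h * \<chi> \<rho> \<in> W.A" if "\<rho> \<in> R" for \<rho> using W.A_mult[OF W.A_of_nat] \<chi>u[OF RG[OF that]] by blast
      show "x * y \<in> M" if "x \<in> M" "y \<in> M" for x y by (rule Mmult[OF that])
      show "(\<Sum>\<rho>\<in>R. (of_nat h * \<chi> \<rho>) * \<rho> x) \<in> W.m" if "x \<in> M" for x by (rule rel[OF that])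
      show "1 \<in> M" by (rule M1)
      show "finite R" by (rule R_fin)
      show "\<rho>0 \<in> R" by (rule \<rho>0)
    qed
    then show False using W.prime[OF W.A_of_nat, of "\<chi> \<rho>0" h] \<chi>u[OF RG[OF \<rho>0]] h by blast
  qed
  then obtain c where c: "c \<in> M" "(\<Sum>\<rho>\<in>R. (of_nat h * \<chi> \<rho>) * \<rho> c) \<notin> W.m" by blast

  \<comment> \<open>The trace of \<open>c * s\<close> is \<open>s\<close> times a unit.\<close>
  define S where "S = (\<Sum>\<theta>\<in>\<Gamma>H. \<Sum>\<rho>\<in>R. \<chi> \<rho> * \<theta> (\<rho> c))"
  have cs: "c * s \<in> determined Y"
    using c(1) Y0Y determined_closed(1)[OF YL] determined_closed(5) by (auto simp: M_def Y0_def)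
  have xK: "(\<Sum>\<gamma>\<in>?\<Gamma>. \<gamma> (c * s)) \<in> K"
    using trace_fixed(2)[OF \<Gamma> subset_refl G.m_closed YL cs G.one_closed]
      trace_fixed(1)[OF \<Gamma> subset_refl G.m_closed YL cs] by (intro fixed) auto
  have summand: "(\<theta> \<star> \<rho>) (c * s) = \<chi> \<rho> * \<theta> (\<rho> c) * s" if \<theta>: "\<theta> \<in> H" and \<rho>: "\<rho> \<in> Gal" for \<theta> \<rho>
  proof -
    have G: "\<theta> \<in> Gal" by (rule HG[OF \<theta>])
    have L: "c \<in> L" "\<rho> c \<in> L" "\<chi> \<rho> \<in> L" "\<chi> \<rho> * s \<in> L"
      using M_sub[OF c(1)] app_closed[OF \<rho>] \<chi>L[OF \<rho>] L_closed(4) s(1) by auto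
    have "(\<theta> \<star> \<rho>) (c * s) = \<theta> (\<rho> c * (\<chi> \<rho> * s))"
      using comp_apply[OF G \<rho> L_closed(4)[OF L(1) s(1)]] app_mult[OF \<rho> L(1) s(1)] \<chi>s[OF \<rho>] by simp
    also have "\<dots> = \<theta> (\<rho> c) * (\<chi> \<rho> * s)"
      using app_mult[OF G L(2,4)] app_mult[OF G L(3) s(1)] app_fix[OF G \<chi>K[OF \<rho>]] Hs[OF \<theta>] by simp
    finally show ?thesis by (simp add: mult_ac)
  qed
  have "(\<Sum>\<gamma>\<in>?\<Gamma>. \<gamma> (c * s)) = (\<Sum>z\<in>\<Gamma>H \<times> R. (fst z \<star> snd z) (c * s))"
    by (subst sum.reindex[OF inj]) (simp add: case_prod_beta)
  also have "\<dots> = (\<Sum>\<theta>\<in>\<Gamma>H. \<Sum>\<rho>\<in>R. (\<theta> \<star> \<rho>) (c * s))" by (simp add: sum.cartesian_product')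
  also have "\<dots> = (\<Sum>\<theta>\<in>\<Gamma>H. \<Sum>\<rho>\<in>R. \<chi> \<rho> * \<theta> (\<rho> c) * s)"
    by (intro sum.cong refl summand \<Gamma>HH RG)
  also have "\<dots> = S * s" by (simp add: S_def sum_distrib_right)
  finally have x: "S * s \<in> K" using xK by simp
  have S_A: "S \<in> W.A"
    unfolding S_def using \<chi>u RG MA HG[OF \<Gamma>HH] Mst c(1) by (intro W.A_sum W.A_mult) blast+
  have "S - (\<Sum>\<rho>\<in>R. (of_nat h * \<chi> \<rho>) * \<rho> c) = (\<Sum>\<theta>\<in>\<Gamma>H. \<Sum>\<rho>\<in>R. \<chi> \<rho> * (\<theta> (\<rho> c) - \<rho> c))"
  proof -
    have "(\<Sum>\<rho>\<in>R. (of_nat h * \<chi> \<rho>) * \<rho> c) = (\<Sum>\<theta>\<in>\<Gamma>H. \<Sum>\<rho>\<in>R. \<chi> \<rho> * \<rho> c)"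
      by (simp add: h_def sum_distrib_left mult.assoc)
    then show ?thesis by (simp add: S_def sum_subtractf right_diff_distrib)
  qed
  moreover have "(\<Sum>\<theta>\<in>\<Gamma>H. \<Sum>\<rho>\<in>R. \<chi> \<rho> * (\<theta> (\<rho> c) - \<rho> c)) \<in> W.m"
    using \<chi>u RG Hm[OF \<Gamma>HH] Mst c(1) by (intro W.m_sum W.m_mult) blast+
  ultimately have dm: "S - (\<Sum>\<rho>\<in>R. (of_nat h * \<chi> \<rho>) * \<rho> c) \<in> W.m" by (simp only:)
  have Sm: "S \<notin> W.m"
  proof
    assume "S \<in> W.m"
    from W.m_diff[OF this dm] show False using c(2) by simp
  qed
  have Su: "S \<noteq> 0" "w S = 0" using W.w_unit[OF S_A Sm] by auto
  define x where "x = S * s"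
  have xx: "x \<in> K" "x \<noteq> 0" "x \<in> L" using x Su s0 K_sub by (auto simp: x_def)
  have "x ^ p = S ^ p * t" using s(2) by (simp add: x_def power_mult_distrib)
  moreover have Sp: "S ^ p \<in> W.A" "S ^ p \<notin> W.m"
  proof -
    show "S ^ p \<in> W.A" by (rule W.A_power[OF S_A])
    have "S ^ j \<notin> W.m" for j by (induct j) (use W.one_notin W.prime[OF S_A W.A_power[OF S_A]] Sm in auto)
    then show "S ^ p \<notin> W.m" .
  qed
  ultimately have wxp: "w (x ^ p) = w t"
    using W.w_mult[of "S ^ p" t] W.w_unit[OF Sp] AL[OF Sp(1)] tK K_sub by auto
  have xm: "x \<in> W.m"
  proof (rule ccontr)
    assume "x \<notin> W.m"
    then have "inverse x ^ p \<in> W.A" using W.A_power[OF W.inverse_in_A[OF xx(3)]] by blast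
    then have "0 \<le> w (inverse (x ^ p))" using xx(2) by (auto simp: W.A_iff power_inverse)
    then show False using W.w_inverse[of "x ^ p"] wxp tK(3) xx L_closed(9) by simp
  qed
  have "x ^ (p - 1) \<in> W.m" using W.power_in_m[OF xm] p by simp
  then have "0 < w (x ^ (p - 1))" "x ^ (p - 1) \<in> L" using xx(2) by (auto simp: W.m_iff)
  moreover have "x ^ p = x ^ (p - 1) * x" using p power_minus_mult[of p x] by simp
  ultimately have "w t = w (x ^ (p - 1)) + w x" using W.w_mult[of "x ^ (p - 1)" x] xx wxp by simp
  then have "w x < w t" using \<open>0 < w (x ^ (p - 1))\<close> by (simp only: less_add_same_cancel2)
  moreover have "w t \<le> w x" using t_min[OF xx(1,2)] xm xx(2) by (simp add: W.m_iff)
  ultimately show False by simp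
qed

lemma tame_inertia:
  fixes w :: "'a \<Rightarrow> 'g::linordered_ab_group_add"
  assumes pro: "pro_p_galois_extension p L K" and p: "2 \<le> p"
    and w: "valuation L w" and char: "of_nat p \<notin> valuation_ideal L w"
    and roots: "\<And>x. x \<in> L \<Longrightarrow> x ^ p = 1 \<Longrightarrow> x \<in> K"
    and s: "s \<in> L" "s ^ p = t" and t: "uniformizer K w t"
  obtains \<sigma> where "\<sigma> \<in> inertia_group L K w" "\<sigma> s \<noteq> s"
proof -
  let ?D = "insert (s, - {s}) ((\<lambda>a. (a, {y. y - a \<in> valuation_ideal L w})) ` valuation_ring L w)"
  have "\<exists>\<sigma>\<in>Gal. \<forall>(x, S)\<in>B. \<sigma> x \<in> S" if B: "finite B" "B \<subseteq> ?D" for B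
  proof -
    have "finite (fst ` B \<inter> valuation_ring L w)" "fst ` B \<inter> valuation_ring L w \<subseteq> valuation_ring L w"
      using B(1) by auto
    from tame_inertia_finite[OF pro p w char roots s t this]
    obtain \<sigma> where \<sigma>: "\<sigma> \<in> Gal" "\<sigma> s \<noteq> s"
      "\<forall>a\<in>fst ` B \<inter> valuation_ring L w. \<sigma> a - a \<in> valuation_ideal L w" by blast
    have "\<sigma> x \<in> S" if xS: "(x, S) \<in> B" for x S
    proof -
      have "x \<in> fst ` B" using xS by force
      moreover have "(x, S) \<in> ?D" using B(2) xS by blast
      ultimately show ?thesis using \<sigma>(2,3) by auto
    qed
    then show ?thesis using \<sigma>(1) by blast
  qed
  moreover have "fst ` ?D \<subseteq> L" using s(1) by (auto simp: valuation_ring_def)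
  ultimately obtain \<sigma> where \<sigma>: "\<sigma> \<in> Gal" "\<And>x S. (x, S) \<in> ?D \<Longrightarrow> \<sigma> x \<in> S"
    using Gal_compact[of ?D] by blast
  have "\<sigma> s \<in> - {s}" by (rule \<sigma>(2)) simp
  moreover have "\<sigma> a - a \<in> valuation_ideal L w" if "a \<in> valuation_ring L w" for a
    using \<sigma>(2)[of a "{y. y - a \<in> valuation_ideal L w}"] that by blast
  ultimately show ?thesis using that \<sigma>(1) by (auto simp: inertia_group_def valuation_ideal_def)
qed

end


section \<open>Roots of unity and radical extensions\<close>

lemma roots_of_unity:
  fixes z :: "'a::field"
  assumes "primitive_root_of_unity q z" "0 < q"
  shows "{x. x ^ q = 1} = (\<lambda>i. z ^ i) ` {..<q}" "card {x :: 'a. x ^ q = 1} = q" "finite {x :: 'a. x ^ q = 1}"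
proof -
  let ?P = "monom 1 q - 1 :: 'a poly"
  have "coeff ?P q = 1" using assms(2) by simp
  then have P: "?P \<noteq> 0" by (metis coeff_0 zero_neq_one)
  have deg: "degree ?P \<le> q" by (intro degree_diff_le) (auto simp: degree_monom_le)
  have eq: "{x :: 'a. x ^ q = 1} = {x. poly ?P x = 0}" by (simp add: poly_monom)
  show fin: "finite {x :: 'a. x ^ q = 1}" unfolding eq by (rule poly_roots_finite[OF P])
  have le: "card {x :: 'a. x ^ q = 1} \<le> q"
    unfolding eq using card_poly_roots_bound[OF P] deg by linarith
  have z: "z ^ q = 1" "\<And>k. 0 < k \<Longrightarrow> k < q \<Longrightarrow> z ^ k \<noteq> 1"
    using assms(1) by (auto simp: primitive_root_of_unity_def)
  have z0: "z \<noteq> 0" using z(1) assms(2) by (auto simp: power_0_left)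
  have ne: "z ^ i \<noteq> z ^ j" if "i < j" "j < q" for i j
  proof
    assume "z ^ i = z ^ j"
    moreover have "z ^ j = z ^ i * z ^ (j - i)" using that by (simp flip: power_add)
    ultimately have "z ^ (j - i) = 1" using z0 by simp
    then show False using z(2)[of "j - i"] that by simp
  qed
  have inj: "inj_on (\<lambda>i. z ^ i) {..<q}"
    by (rule inj_onI) (metis ne lessThan_iff linorder_neqE_nat)
  have sub: "(\<lambda>i. z ^ i) ` {..<q} \<subseteq> {x. x ^ q = 1}"
  proof
    fix x assume "x \<in> (\<lambda>i. z ^ i) ` {..<q}"
    then obtain i where "x = z ^ i" by blast
    then have "x ^ q = (z ^ q) ^ i" by (simp add: mult.commute flip: power_mult)
    then show "x \<in> {x. x ^ q = 1}" using z(1) by simp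
  qed
  show s: "{x. x ^ q = 1} = (\<lambda>i. z ^ i) ` {..<q}"
    using card_seteq[OF fin sub] le card_image[OF inj] by simp
  show "card {x :: 'a. x ^ q = 1} = q" using card_image[OF inj] s by simp
qed

lemma root_of_unity_of_exact_order:
  fixes \<zeta> :: "'a::field"
  assumes "Factorial_Ring.prime p" "q = p ^ k" "1 < q" "\<zeta> ^ q = 1" "\<zeta> ^ (q div p) \<noteq> 1"
  shows "primitive_root_of_unity q \<zeta>"
proof -
  have k: "0 < k" using assms(2,3) by (cases k) auto
  have "\<zeta> ^ j \<noteq> 1" if j: "0 < j" "j < q" for j
  proof
    assume 1: "\<zeta> ^ j = 1"
    define e where "e = (LEAST e. 0 < e \<and> \<zeta> ^ e = 1)"
    have e: "0 < e" "\<zeta> ^ e = 1" using LeastI[of "\<lambda>e. 0 < e \<and> \<zeta> ^ e = 1" j] 1 j(1) by (auto simp: e_def)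
    have ej: "e \<le> j" unfolding e_def using 1 j(1) by (intro Least_le) auto
    have "\<zeta> ^ q = (\<zeta> ^ e) ^ (q div e) * \<zeta> ^ (q mod e)"
      by (simp flip: power_mult power_add)
    then have "\<zeta> ^ (q mod e) = 1" using assms(4) e(2) by simp
    have "q mod e = 0"
    proof (rule ccontr)
      assume "q mod e \<noteq> 0"
      then have "e \<le> q mod e"
        unfolding e_def by (intro Least_le) (use \<open>\<zeta> ^ (q mod e) = 1\<close> in \<open>simp add: e_def\<close>)
      then show False using mod_less_divisor[OF e(1), of q] by simp
    qed
    then have "e dvd p ^ k" using assms(2) by auto
    then obtain i where i: "i \<le> k" "e = p ^ i" using divides_primepow_nat[OF assms(1)] by blast
    have "i \<noteq> k" using i ej j(2) assms(2) by auto
    then have "i \<le> k - 1" using i k by simp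
    moreover have "q div p = p ^ (k - 1)" using assms(1,2) k by (cases k) auto
    ultimately have "e dvd q div p" using i(2) le_imp_power_dvd by simp
    then obtain l where "q div p = e * l" by blast
    then have "\<zeta> ^ (q div p) = 1" using e(2) by (simp add: power_mult)
    then show False using assms(5) by simp
  qed
  then show ?thesis using assms(4) by (simp add: primitive_root_of_unity_def)
qed


text \<open>
  Polynomials over a subfield are polynomials over the ambient field with restricted coefficients, so
  that they can be evaluated anywhere and split into linear factors there.
\<close>

definition poly_over :: "'a::field set \<Rightarrow> 'a poly set"
  where "poly_over F = {g. \<forall>i. coeff g i \<in> F}"

lemma poly_over_closed:
  fixes F :: "'a::field set"
  assumes F: "subfield F \<Omega>"
  shows "0 \<in> poly_over F" "g \<in> poly_over F \<Longrightarrow> h \<in> poly_over F \<Longrightarrow> g + h \<in> poly_over F"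
    "g \<in> poly_over F \<Longrightarrow> h \<in> poly_over F \<Longrightarrow> g - h \<in> poly_over F"
    "g \<in> poly_over F \<Longrightarrow> h \<in> poly_over F \<Longrightarrow> g * h \<in> poly_over F"
    "c \<in> F \<Longrightarrow> monom c n \<in> poly_over F" "c \<in> F \<Longrightarrow> [:c:] \<in> poly_over F"
    "c \<in> F \<Longrightarrow> g \<in> poly_over F \<Longrightarrow> pcompose g [:0, c:] \<in> poly_over F"
    "(\<And>i. i \<in> I \<Longrightarrow> f i \<in> poly_over F) \<Longrightarrow> (\<Sum>i\<in>I. f i) \<in> poly_over F"
proof -
  note Fc = subfield_closed[OF F]
  show 0: "0 \<in> poly_over F" using Fc by (simp add: poly_over_def)
  show add: "g + h \<in> poly_over F" if "g \<in> poly_over F" "h \<in> poly_over F" for g h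
    using Fc that by (simp add: poly_over_def)
  show "g - h \<in> poly_over F" if "g \<in> poly_over F" "h \<in> poly_over F"
    using Fc that by (simp add: poly_over_def)
  show "g * h \<in> poly_over F" if "g \<in> poly_over F" "h \<in> poly_over F"
    using Fc that by (auto simp: poly_over_def coeff_mult intro: subfield_sum_closed[OF F])
  show "monom c n \<in> poly_over F" "[:c:] \<in> poly_over F" if "c \<in> F"
    using Fc that by (auto simp: poly_over_def coeff_pCons split: nat.split)
  show "pcompose g [:0, c:] \<in> poly_over F" if "c \<in> F" "g \<in> poly_over F"
    using Fc that by (simp add: poly_over_def coeff_pcompose_linear)
  show "(\<Sum>i\<in>I. f i) \<in> poly_over F" if "\<And>i. i \<in> I \<Longrightarrow> f i \<in> poly_over F"
    using that by (induct I rule: infinite_finite_induct) (auto intro: 0 add)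
qed

lemma dvd_of_minimal_degree:
  fixes F :: "'a::field set"
  assumes F: "subfield F \<Omega>" and g: "g \<in> poly_over F" "g \<noteq> 0" "poly g x = 0"
    and minimal: "\<And>h. h \<in> poly_over F \<Longrightarrow> poly h x = 0 \<Longrightarrow> degree h < degree g \<Longrightarrow> h = 0"
    and f: "f \<in> poly_over F" "poly f x = 0"
  shows "g dvd f"
  using f
proof (induct "degree f" arbitrary: f rule: less_induct)
  case less
  show ?case
  proof (cases "f = 0")
    case False
    have dg: "degree g \<le> degree f" using minimal[OF less(2,3)] False by (meson not_le)
    define c where "c = lead_coeff f / lead_coeff g"
    have cF: "c \<in> F" using less(2) g(1) subfield_closed(8)[OF F] by (simp add: c_def poly_over_def)
    define h where "h = f - monom c (degree f - degree g) * g"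
    have h: "h \<in> poly_over F" "poly h x = 0"
      using less(2,3) g(1,3) cF by (auto simp: h_def intro!: poly_over_closed[OF F])
    have "degree h \<le> degree f"
      unfolding h_def
      by (rule degree_diff_le[OF order_refl order_trans[OF degree_mult_le]])
        (use dg degree_monom_le[of c "degree f - degree g"] in simp)
    moreover have "coeff h (degree f) = 0" using dg g(2) by (simp add: h_def coeff_monom_mult c_def)
    ultimately consider "h = 0" | "degree h < degree f" using eq_zero_or_degree_less by blast
    then have "g dvd h" using less(1)[OF _ h] by cases auto
    then have "g dvd h + monom c (degree f - degree g) * g" by simp
    then show ?thesis by (simp add: h_def)
  qed simp
qed


text \<open>
  Here \<open>d\<close> is the least positive exponent for which \<open>r ^ d\<close> is in \<open>F\<close>, and \<open>F\<close> contains the \<open>d\<close>-th roots of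
  unity. Then \<open>x ^ d - r ^ d\<close> turns out to be the minimal polynomial of \<open>r\<close>.
\<close>

locale radical_extension =
  fixes F :: "'a::alg_closed_field set" and d :: nat and \<omega> r :: 'a
  assumes F: "subfield F \<Omega>" and d: "0 < d" and \<omega>: "\<omega> \<in> F" "primitive_root_of_unity d \<omega>"
    and r: "r \<noteq> 0" "r ^ d \<in> F" "\<And>j. 0 < j \<Longrightarrow> j < d \<Longrightarrow> r ^ j \<notin> F"
begin

lemmas F_closed = subfield_closed[OF F]

definition P :: "'a poly"
  where "P = monom 1 d - [:r ^ d:]"

lemma P: "P \<in> poly_over F" "degree P = d" "P \<noteq> 0" "poly P x = x ^ d - r ^ d"
proof -
  show "P \<in> poly_over F" unfolding P_def using r F_closed by (intro poly_over_closed[OF F])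
  have "coeff P d = 1" using d by (simp add: P_def coeff_pCons split: nat.split)
  moreover have "degree P \<le> d" unfolding P_def by (intro degree_diff_le) (auto simp: degree_monom_le)
  ultimately show "degree P = d" using le_degree[of P d] by simp
  then show "P \<noteq> 0" using d by auto
  show "poly P x = x ^ d - r ^ d" by (simp add: P_def poly_monom)
qed

lemma roots_of_unity_in_F: "x ^ d = 1 \<Longrightarrow> x \<in> F"
proof -
  assume "x ^ d = 1"
  then have "x \<in> {x. x ^ d = 1}" by simp
  then show "x \<in> F" unfolding roots_of_unity(1)[OF \<omega>(2) d] using F_closed(9)[OF \<omega>(1)] by auto
qed

text \<open>
  The minimal polynomial of \<open>r\<close>, of degree \<open>e\<close>, divides \<open>x ^ d - r ^ d\<close>, so its roots are multiples of \<open>r\<close> by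
  roots of unity in \<open>F\<close>. Its constant coefficient is therefore a multiple of \<open>r ^ e\<close> by an element of \<open>F\<close>, whence
  \<open>r ^ e\<close> is in \<open>F\<close> and \<open>e\<close> is at least \<open>d\<close>.
\<close>

lemma degree_of_vanishing:
  assumes "f \<in> poly_over F" "poly f r = 0" "f \<noteq> 0"
  shows "d \<le> degree f"
proof -
  let ?Q = "\<lambda>g. g \<in> poly_over F \<and> poly g r = 0 \<and> g \<noteq> 0"
  obtain g where g: "?Q g" "\<And>h. ?Q h \<Longrightarrow> degree g \<le> degree h"
    using ex_has_least_nat[of ?Q f degree] assms by blast
  have "g dvd P"
    by (rule dvd_of_minimal_degree[OF F _ _ _ _ P(1)]) (use g P(4)[of r] in \<open>auto dest: leD\<close>)
  obtain A where A: "size A = degree g" "g = smult (lead_coeff g) (\<Prod>x\<in>#A. [:- x, 1:])"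
    using alg_closed_imp_factorization[of g] g(1) by blast
  have root: "\<exists>u\<in>F. u \<noteq> 0 \<and> - x = u * r" if x: "x \<in># A" for x
  proof -
    have "[:- x, 1:] dvd (\<Prod>x\<in>#A. [:- x, 1:])" using x by (simp add: dvd_prod_mset)
    then have "[:- x, 1:] dvd g" by (subst A(2)) (rule dvd_smult)
    then have "poly P x = 0" using \<open>g dvd P\<close> by (metis dvd_trans poly_eq_0_iff_dvd)
    then have "(x / r) ^ d = 1" using P(4)[of x] r(1) by (simp add: power_divide)
    then have "x / r \<in> F" "x / r \<noteq> 0" using roots_of_unity_in_F d by (auto simp: power_0_left)
    then show ?thesis using r(1) F_closed(5)[of "x / r"] by (intro bexI[of _ "- (x / r)"]) auto
  qed
  have "\<exists>u\<in>F. u \<noteq> 0 \<and> (\<Prod>x\<in>#B. - x) = u * r ^ size B" if "B \<subseteq># A" for B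
    using that
  proof (induct B)
    case empty
    then show ?case using F_closed(2) by auto
  next
    case (add x B)
    then obtain u where u: "u \<in> F" "u \<noteq> 0" "(\<Prod>x\<in>#B. - x) = u * r ^ size B"
      using mset_subset_eq_insertD subset_mset.less_imp_le by metis
    have "x \<in># A" using add(2) by (meson mset_subset_eq_insertD)
    then obtain w where "w \<in> F" "w \<noteq> 0" "- x = w * r" using root by blast
    then show ?case using u F_closed(4)[of w u] by (intro bexI[of _ "w * u"]) (auto simp: mult_ac)
  qed
  from this[OF subset_mset.order_refl] obtain u
    where u: "u \<in> F" "u \<noteq> 0" "(\<Prod>x\<in>#A. - x) = u * r ^ degree g" using A(1) by metis
  have "poly g 0 = lead_coeff g * (\<Prod>x\<in>#A. - x)"
    by (subst A(2)) (simp add: poly_prod_mset image_mset.compositionality o_def)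
  then have "r ^ degree g = poly g 0 / lead_coeff g / u" using u g(1) by simp
  also have "\<dots> \<in> F"
    using g(1) u(1) by (intro F_closed(8)) (auto simp: poly_0_coeff_0 poly_over_def)
  finally have "r ^ degree g \<in> F" .
  moreover have "0 < degree g" using g(1) by (metis degree_eq_zeroE gr0I poly_const_conv pCons_eq_0_iff)
  ultimately have "d \<le> degree g" using r(3) by (meson not_le)
  then show ?thesis using g(2)[of f] assms by simp
qed

lemma vanish_conjugate:
  assumes "f \<in> poly_over F" "poly f r = 0" "\<zeta> ^ d = 1"
  shows "poly f (\<zeta> * r) = 0"
proof -
  have "P dvd f"
    by (rule dvd_of_minimal_degree[OF F P(1) P(3) _ _ assms(1,2)]) (use P(2,4) degree_of_vanishing in \<open>force+\<close>)
  moreover have "poly P (\<zeta> * r) = 0" using assms(3) P(4) by (simp add: power_mult_distrib)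
  ultimately show ?thesis by auto
qed

definition M :: "'a set"
  where "M = (\<lambda>g. poly g r) ` poly_over F"

lemma M_simple: "M = ring.simple_extension \<Omega> F r"
proof -
  interpret R: field "\<Omega> :: 'a ring" by (rule field_from_type_algebra)
  have "x \<in> M" if "x \<in> R.simple_extension F r" for x
    using that
  proof (induct rule: R.simple_extension.induct)
    case zero
    then show ?case using poly_over_closed(1)[OF F] by (auto simp: M_def image_iff intro!: bexI[of _ 0])
  next
    case (lin k1 k2)
    then obtain g where g: "g \<in> poly_over F" "k1 = poly g r" by (auto simp: M_def)
    have "pCons k2 g \<in> poly_over F" using g(1) lin by (auto simp: poly_over_def coeff_pCons split: nat.split)
    moreover have "poly (pCons k2 g) r = k1 * r + k2" using g(2) by (simp add: mult.commute)
    ultimately show ?case unfolding M_def by (auto intro: rev_image_eqI)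
  qed
  moreover have "poly g r \<in> R.simple_extension F r" if "g \<in> poly_over F" for g
    using that
  proof (induct g)
    case 0
    then show ?case using R.simple_extension.zero[of F r] by simp
  next
    case (pCons c g)
    have "c \<in> F" "g \<in> poly_over F"
      using pCons(3) by (auto simp: poly_over_def dest: spec[of _ 0]) (metis coeff_pCons_Suc)
    then show ?case using R.simple_extension.lin[OF pCons(2), of c] by (simp add: mult.commute add.commute)
  qed
  ultimately show ?thesis by (auto simp: M_def)
qed

lemma M: "subfield M \<Omega>" "F \<subseteq> M" "r \<in> M" "x \<in> M \<Longrightarrow> ring.algebraic \<Omega> F x"
proof -
  interpret R: field "\<Omega> :: 'a ring" by (rule field_from_type_algebra)
  let ?p = "rev (coeffs P)"
  have "?p \<noteq> []" using P(3) by simp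
  moreover have "set ?p \<subseteq> F" using P(1) by (auto simp: poly_over_def coeffs_def)
  moreover have "hd ?p \<noteq> 0" using P(3) by (simp add: hd_rev last_coeffs_eq_coeff_degree)
  ultimately have "?p \<in> carrier (F[X]\<^bsub>\<Omega>\<^esub>)" by (simp add: univ_poly_def polynomial_def)
  moreover have "R.eval ?p r = \<zero>\<^bsub>\<Omega>\<^esub>" using P(4)[of r] by (simp add: eval_ambient)
  ultimately have alg: "(R.algebraic over F) r" using R.algebraicI \<open>?p \<noteq> []\<close> by blast
  show "subfield M \<Omega>" unfolding M_simple using R.simple_extension_is_subfield[OF F, of r] alg by simp
  show "F \<subseteq> M" unfolding M_simple using R.simple_extension_incl[of F r] by simp
  show "r \<in> M" unfolding M_simple using R.simple_extension_mem[OF subfieldE(1)[OF F], of r] by simp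
  show "ring.algebraic \<Omega> F x" if "x \<in> M"
    using R.simple_extesion_mem_imp_algebraic[OF F, of r x] alg that by (simp add: M_simple over_def)
qed

text \<open>
  The automorphism \<open>r \<mapsto> \<zeta> * r\<close>. Its value does not depend on the choice of the polynomial because a
  polynomial over \<open>F\<close> that vanishes at \<open>r\<close> also vanishes at \<open>\<zeta> * r\<close>.
\<close>

definition twist :: "'a \<Rightarrow> 'a \<Rightarrow> 'a"
  where "twist \<zeta> = (\<lambda>x\<in>M. poly (SOME g. g \<in> poly_over F \<and> poly g r = x) (\<zeta> * r))"

lemma twist_poly:
  assumes "g \<in> poly_over F" "\<zeta> ^ d = 1"
  shows "twist \<zeta> (poly g r) = poly g (\<zeta> * r)"
proof -
  define h where "h = (SOME h. h \<in> poly_over F \<and> poly h r = poly g r)"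
  have h: "h \<in> poly_over F \<and> poly h r = poly g r" unfolding h_def by (rule someI[of _ g]) (use assms in simp)
  have "poly (h - g) (\<zeta> * r) = 0"
    using h assms by (intro vanish_conjugate poly_over_closed[OF F]) auto
  moreover have "poly g r \<in> M" using assms(1) by (simp add: M_def)
  ultimately show ?thesis by (simp add: twist_def h_def)
qed

lemma twist_mem: "x \<in> M \<Longrightarrow> \<zeta> ^ d = 1 \<Longrightarrow> twist \<zeta> x \<in> M"
proof -
  assume *: "x \<in> M" "\<zeta> ^ d = 1"
  then obtain g where g: "g \<in> poly_over F" "x = poly g r" by (auto simp: M_def)
  have "pcompose g [:0, \<zeta>:] \<in> poly_over F" using poly_over_closed(7)[OF F roots_of_unity_in_F[OF *(2)] g(1)] .
  moreover have "twist \<zeta> x = poly (pcompose g [:0, \<zeta>:]) r"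
    using twist_poly[OF g(1) *(2)] g(2) by (simp add: poly_pcompose mult.commute)
  ultimately show ?thesis by (simp add: M_def)
qed

lemma twist_inverse: "x \<in> M \<Longrightarrow> \<zeta> ^ d = 1 \<Longrightarrow> \<zeta> * \<eta> = 1 \<Longrightarrow> twist \<eta> (twist \<zeta> x) = x"
proof -
  assume *: "x \<in> M" "\<zeta> ^ d = 1" "\<zeta> * \<eta> = 1"
  then obtain g where g: "g \<in> poly_over F" "x = poly g r" by (auto simp: M_def)
  have "\<zeta> ^ d * \<eta> ^ d = 1" using *(3) by (simp flip: power_mult_distrib)
  then have \<eta>: "\<eta> ^ d = 1" using *(2) by simp
  have "pcompose g [:0, \<zeta>:] \<in> poly_over F" using poly_over_closed(7)[OF F roots_of_unity_in_F[OF *(2)] g(1)] .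
  moreover have "twist \<zeta> x = poly (pcompose g [:0, \<zeta>:]) r"
    using twist_poly[OF g(1) *(2)] g(2) by (simp add: poly_pcompose mult.commute)
  ultimately have "twist \<eta> (twist \<zeta> x) = poly (pcompose g [:0, \<zeta>:]) (\<eta> * r)" using twist_poly[OF _ \<eta>] by simp
  also have "\<dots> = poly g (\<zeta> * \<eta> * r)" by (simp add: poly_pcompose mult_ac)
  finally show ?thesis using *(3) g(2) by simp
qed

lemma twist_galois:
  assumes "\<zeta> ^ d = 1"
  shows "twist \<zeta> \<in> carrier (galois_group M F)"
proof -
  obtain \<eta> where \<eta>: "\<zeta> * \<eta> = 1" using assms d by (metis power_0_left right_inverse zero_neq_one less_numeral_extra(3))
  then have "\<zeta> ^ d * \<eta> ^ d = 1" by (simp flip: power_mult_distrib)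
  then have \<eta>d: "\<eta> ^ d = 1" using assms by simp
  have "bij_betw (twist \<zeta>) M M"
    using twist_mem assms \<eta>d twist_inverse[OF _ assms \<eta>] twist_inverse[OF _ \<eta>d, of _ \<zeta>] \<eta>
    by (intro bij_betw_byWitness[where f' = "twist \<eta>"]) (auto simp: mult.commute)
  then have "twist \<zeta> \<in> Bij M" by (simp add: Bij_def twist_def)
  moreover have "twist \<zeta> (x + y) = twist \<zeta> x + twist \<zeta> y \<and> twist \<zeta> (x * y) = twist \<zeta> x * twist \<zeta> y"
    if "x \<in> M" "y \<in> M" for x y
  proof -
    obtain g where g: "g \<in> poly_over F" "x = poly g r" using \<open>x \<in> M\<close> unfolding M_def by blast
    obtain h where h: "h \<in> poly_over F" "y = poly h r" using \<open>y \<in> M\<close> unfolding M_def by blast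
    note gh = g h
    show ?thesis
      using twist_poly[OF poly_over_closed(2)[OF F gh(1,3)] assms] twist_poly[OF poly_over_closed(4)[OF F gh(1,3)] assms]
        twist_poly[OF gh(1) assms] twist_poly[OF gh(3) assms] gh(2,4) by simp
  qed
  moreover have "twist \<zeta> x = x" if "x \<in> F" for x
    using twist_poly[OF poly_over_closed(6)[OF F that] assms] by simp
  ultimately show ?thesis by (simp add: galois_group_def)
qed

lemma reduced_representative:
  assumes "x \<in> M"
  obtains g where "g \<in> poly_over F" "poly g r = x" "degree g < d"
proof -
  obtain h where h: "h \<in> poly_over F" "poly h r = x" using assms by (auto simp: M_def)
  define g where "g = (\<Sum>i\<le>degree h. monom (coeff h i * (r ^ d) ^ (i div d)) (i mod d))"
  have "g \<in> poly_over F"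
    unfolding g_def using h(1) r(2) F_closed(4,9)
    by (intro poly_over_closed[OF F]) (auto simp: poly_over_def)
  moreover have "poly g r = (\<Sum>i\<le>degree h. coeff h i * r ^ i)"
    unfolding g_def poly_sum poly_monom
  proof (rule sum.cong[OF refl])
    fix i
    have "(r ^ d) ^ (i div d) * r ^ (i mod d) = r ^ i" by (simp flip: power_mult power_add)
    then show "coeff h i * (r ^ d) ^ (i div d) * r ^ (i mod d) = coeff h i * r ^ i" by (simp add: mult.assoc)
  qed
  moreover have "degree g < d"
  proof -
    have "degree g \<le> d - 1"
      unfolding g_def
    proof (rule degree_sum_le)
      fix i
      have "i mod d < d" using d by simp
      then show "degree (monom (coeff h i * (r ^ d) ^ (i div d)) (i mod d)) \<le> d - 1"
        by (intro order_trans[OF degree_monom_le]) simp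
    qed simp
    then show ?thesis using d by simp
  qed
  ultimately show ?thesis using that h(2) by (simp add: poly_altdef)
qed

text \<open>
  If the twist by a primitive root of unity fixes a polynomial expression in \<open>r\<close> of degree below \<open>d\<close>, then
  comparison of coefficients leaves only the constant one.
\<close>

lemma galois: "galois_extension M F"
  unfolding galois_extension_def
proof (intro conjI ballI)
  show "fixed_field M (carrier (galois_group M F)) = F"
  proof
    show "F \<subseteq> fixed_field M (carrier (galois_group M F))"
      using M(2) by (auto simp: fixed_field_def galois_group_def)
    show "fixed_field M (carrier (galois_group M F)) \<subseteq> F"
    proof
      fix x assume "x \<in> fixed_field M (carrier (galois_group M F))"
      then have x: "x \<in> M" "\<And>\<sigma>. \<sigma> \<in> carrier (galois_group M F) \<Longrightarrow> \<sigma> x = x" by (auto simp: fixed_field_def)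
      obtain g where g: "g \<in> poly_over F" "poly g r = x" "degree g < d" using reduced_representative[OF x(1)] .
      have \<omega>d: "\<omega> ^ d = 1" using \<omega>(2) by (simp add: primitive_root_of_unity_def)
      define f where "f = pcompose g [:0, \<omega>:] - g"
      have cf: "coeff f i = (\<omega> ^ i - 1) * coeff g i" for i
        by (simp add: f_def coeff_pcompose_linear algebra_simps)
      have "f \<in> poly_over F" unfolding f_def by (intro poly_over_closed[OF F] \<omega>(1) g(1))
      moreover have "poly f r = 0"
        using x(2)[OF twist_galois[OF \<omega>d]] twist_poly[OF g(1) \<omega>d] g(2)
        by (simp add: f_def poly_pcompose mult.commute)
      moreover have "degree f < d"
      proof -
        have "degree f \<le> degree g" by (rule degree_le) (simp add: cf coeff_eq_0)
        then show ?thesis using g(3) by simp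
      qed
      ultimately have "f = 0" using degree_of_vanishing[of f] by force
      then have "coeff g i = 0" if "0 < i" for i
        using cf[of i] that \<omega>(2) coeff_eq_0[of g i] g(3)
        by (cases "i < d") (auto simp: primitive_root_of_unity_def)
      then have "g = [:coeff g 0:]" by (intro poly_eqI) (auto simp: coeff_pCons split: nat.split)
      then have "x = coeff g 0" using g(2) by (metis poly_const_conv)
      then show "x \<in> F" using g(1) by (simp add: poly_over_def)
    qed
  qed
qed (use F M in auto)

lemma card_galois: "card (carrier (galois_group M F)) = d"
proof -
  interpret S: galois M F by unfold_locales (rule galois)
  have "bij_betw (\<lambda>\<sigma>. \<sigma> r / r) S.Gal {x. x ^ d = 1}"
    unfolding bij_betw_def
  proof
    show "inj_on (\<lambda>\<sigma>. \<sigma> r / r) S.Gal"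
    proof (rule inj_onI)
      fix \<sigma> \<tau> assume *: "\<sigma> \<in> S.Gal" "\<tau> \<in> S.Gal" "\<sigma> r / r = \<tau> r / r"
      have ev: "\<upsilon> (poly g r) = poly g (\<upsilon> r)" if \<upsilon>: "\<upsilon> \<in> S.Gal" and g: "g \<in> poly_over F" for \<upsilon> g
        using g
      proof (induct g)
        case 0
        show ?case using S.app_0[OF \<upsilon>] by simp
      next
        case (pCons c g)
        have cg: "c \<in> F" "g \<in> poly_over F"
          using pCons(3) by (auto simp: poly_over_def dest: spec[of _ 0]) (metis coeff_pCons_Suc)
        have L: "c \<in> M" "poly g r \<in> M" "r * poly g r \<in> M"
          using M(2,3) cg S.L_closed(4) by (auto simp: M_def)
        show ?case
          using S.app_add[OF \<upsilon> L(1,3)] S.app_mult[OF \<upsilon> M(3) L(2)] S.app_fix[OF \<upsilon> cg(1)] pCons(2)[OF cg(2)] by simp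
      qed
      have "\<sigma> x = \<tau> x" if "x \<in> M" for x
      proof -
        obtain g where "g \<in> poly_over F" "x = poly g r" using \<open>x \<in> M\<close> unfolding M_def by blast
        moreover have "\<sigma> r = \<tau> r" using *(3) r(1) by simp
        ultimately show ?thesis using ev[OF *(1)] ev[OF *(2)] by simp
      qed
      then show "\<sigma> = \<tau>" by (rule S.Gal_ext[OF *(1,2)])
    qed
    show "(\<lambda>\<sigma>. \<sigma> r / r) ` S.Gal = {x. x ^ d = 1}"
    proof
      show "(\<lambda>\<sigma>. \<sigma> r / r) ` S.Gal \<subseteq> {x. x ^ d = 1}"
      proof
        fix x assume "x \<in> (\<lambda>\<sigma>. \<sigma> r / r) ` S.Gal"
        then obtain \<sigma> where \<sigma>: "\<sigma> \<in> S.Gal" "x = \<sigma> r / r" by blast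
        have "(\<sigma> r) ^ d = r ^ d" using S.app_power[OF \<sigma>(1) M(3), of d] S.app_fix[OF \<sigma>(1) r(2)] by simp
        then show "x \<in> {x. x ^ d = 1}" using \<sigma>(2) r(1) by (simp add: power_divide)
      qed
      show "{x. x ^ d = 1} \<subseteq> (\<lambda>\<sigma>. \<sigma> r / r) ` S.Gal"
      proof
        fix x assume "x \<in> {x :: 'a. x ^ d = 1}"
        then have x: "x ^ d = 1" by simp
        have "[:0, 1:] \<in> poly_over F" using F_closed by (auto simp: poly_over_def coeff_pCons split: nat.split)
        from twist_poly[OF this x] have "twist x r / r = x" using r(1) by simp
        then show "x \<in> (\<lambda>\<sigma>. \<sigma> r / r) ` S.Gal"
          by (intro image_eqI[where x = "twist x"] twist_galois x) (rule sym)
      qed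
    qed
  qed
  then show ?thesis using roots_of_unity(2)[OF \<omega>(2) d] bij_betw_same_card by metis
qed

end

text \<open>
  The Galois group of \<open>F(r)\<close> has order \<open>d\<close>, where \<open>d\<close> divides \<open>q\<close>, a power of \<open>p\<close>.
\<close>

lemma kummer_radical_in_pro_p:
  fixes F :: "'a::alg_closed_field set"
  assumes p: "Factorial_Ring.prime p" and q: "q = p ^ k" and F: "subfield F \<Omega>"
    and z: "z \<in> F" "primitive_root_of_unity q z" and r: "r ^ q \<in> F" "r \<noteq> 0"
  obtains M where "pro_p_galois_extension p M F" "r \<in> M"
proof -
  note Fc = subfield_closed[OF F]
  have q0: "0 < q" using p q by (simp add: prime_gt_0_nat)
  define d where "d = (LEAST d. 0 < d \<and> r ^ d \<in> F)"
  have d: "0 < d" "r ^ d \<in> F" using LeastI[of "\<lambda>d. 0 < d \<and> r ^ d \<in> F" q] q0 r(1) by (auto simp: d_def)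
  have dmin: "r ^ j \<notin> F" if "0 < j" "j < d" for j
    using not_less_Least[of j "\<lambda>d. 0 < d \<and> r ^ d \<in> F"] that by (auto simp: d_def)
  have "r ^ q = (r ^ d) ^ (q div d) * r ^ (q mod d)" by (simp flip: power_mult power_add)
  then have "r ^ (q mod d) = r ^ q / (r ^ d) ^ (q div d)" using r(2) by simp
  also have "\<dots> \<in> F" using r(1) d(2) Fc by auto
  finally have "q mod d = 0" using dmin[of "q mod d"] d(1) by (meson gr0I mod_less_divisor)
  then obtain e where e: "q = d * e" by auto
  have e0: "0 < e" using e q0 by (cases e) auto
  have \<omega>: "z ^ e \<in> F" "primitive_root_of_unity d (z ^ e)"
  proof -
    show "z ^ e \<in> F" using z(1) Fc by simp
    have "e * j < q" if "j < d" for j using e e0 that by (simp add: mult.commute)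
    then show "primitive_root_of_unity d (z ^ e)"
      using z(2) e e0 unfolding primitive_root_of_unity_def
      by (auto simp: mult.commute simp flip: power_mult)
  qed
  interpret radical_extension F d "z ^ e" r
    by (rule radical_extension.intro[OF F d(1) \<omega> r(2) d(2)]) (rule dmin)
  interpret S: galois M F by unfold_locales (rule galois)
  obtain i where i: "d = p ^ i" using e q divides_primepow_nat[OF p, of d k] by (metis dvd_triv_left)
  have "pro_p_galois_extension p M F"
    unfolding pro_p_galois_extension_def
  proof (intro conjI allI impI galois)
    fix N assume "N \<lhd> galois_group M F \<and> openin (krull_topology M F) N"
    then have "subgroup N (galois_group M F)" using normal_imp_subgroup by blast
    from S.G.lagrange[OF this]
    have "card (rcosets\<^bsub>galois_group M F\<^esub> N) dvd p ^ i"
      using card_galois i unfolding Coset.order_def by (metis dvd_triv_left)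
    then show "\<exists>k. card (rcosets\<^bsub>galois_group M F\<^esub> N) = p ^ k" using divides_primepow_nat[OF p] by blast
  qed
  then show ?thesis using M(3) that by blast
qed


section \<open>The Kummer character and restrictions\<close>

text \<open>
  Each of the two images is a copy of \<open>T\<close> modulo the common fibres.
\<close>

lemma is_iso_of_same_fibres:
  fixes H1 :: "('h, 'm) monoid_scheme" and H2 :: "('k, 'n) monoid_scheme"
  assumes closed: "\<And>x y. x \<in> T \<Longrightarrow> y \<in> T \<Longrightarrow> op x y \<in> T"
    and f: "\<And>x y. x \<in> T \<Longrightarrow> y \<in> T \<Longrightarrow> f (op x y) = f x \<otimes>\<^bsub>H1\<^esub> f y"
    and g: "\<And>x y. x \<in> T \<Longrightarrow> y \<in> T \<Longrightarrow> g (op x y) = g x \<otimes>\<^bsub>H2\<^esub> g y"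
    and fibres: "\<And>x y. x \<in> T \<Longrightarrow> y \<in> T \<Longrightarrow> f x = f y \<longleftrightarrow> g x = g y"
    and onto: "g ` T = carrier H2"
  shows "(H1\<lparr>carrier := f ` T\<rparr>) \<cong> H2"
proof -
  define h where "h u = g (inv_into T f u)" for u
  have h: "h (f x) = g x" if "x \<in> T" for x
  proof -
    have "inv_into T f (f x) \<in> T" "f (inv_into T f (f x)) = f x"
      using that by (auto intro: inv_into_into f_inv_into_f)
    then show ?thesis using fibres that by (simp add: h_def)
  qed
  have "h ` f ` T = carrier H2" using h onto by (force simp: image_image)
  moreover have "inj_on h (f ` T)"
    by (rule inj_onI) (use h fibres in auto)
  moreover have "h (f x \<otimes>\<^bsub>H1\<^esub> f y) = h (f x) \<otimes>\<^bsub>H2\<^esub> h (f y)" if "x \<in> T" "y \<in> T" for x y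
    using f[OF that] g[OF that] h closed[OF that] that by metis
  ultimately have "h \<in> iso (H1\<lparr>carrier := f ` T\<rparr>) H2"
    by (auto simp: iso_def hom_def bij_betw_def)
  then show ?thesis by (rule is_isoI)
qed

lemma (in group) normal_Inter:
  assumes "\<And>H. H \<in> A \<Longrightarrow> H \<lhd> G" "A \<noteq> {}"
  shows "\<Inter>A \<lhd> G"
proof (subst normal_inv_iff, intro conjI ballI)
  show "subgroup (\<Inter>A) G" using assms normal_imp_subgroup by (intro subgroups_Inter) auto
  show "x \<otimes> h \<otimes> inv x \<in> \<Inter>A" if "x \<in> carrier G" "h \<in> \<Inter>A" for x h
  proof
    fix H assume H: "H \<in> A"
    show "x \<otimes> h \<otimes> inv x \<in> H"
      by (rule normal.inv_op_closed2[OF assms(1)[OF H] that(1)]) (use that(2) H in blast)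
  qed
qed

context galois begin

lemma normal_closure:
  assumes "S \<subseteq> Gal"
  shows "closed_normal_closure (galois_group L K) (krull_topology L K) S \<lhd> galois_group L K"
    "S \<subseteq> closed_normal_closure (galois_group L K) (krull_topology L K) S"
proof -
  have "closedin (krull_topology L K) Gal" using closedin_topspace openin_krull_Gal(2) by metis
  moreover have "Gal \<lhd> galois_group L K"
    using G.subgroup_self G.normal_inv_iff by simp
  ultimately show "closed_normal_closure (galois_group L K) (krull_topology L K) S \<lhd> galois_group L K"
    unfolding closed_normal_closure_def using assms by (intro G.normal_Inter) auto
  show "S \<subseteq> closed_normal_closure (galois_group L K) (krull_topology L K) S"
    by (auto simp: closed_normal_closure_def)
qed

lemma inertia_closed:
  fixes w :: "'a \<Rightarrow> 'g::linordered_ab_group_add"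
  assumes w: "valuation L w"
  shows "inertia_group L K w \<subseteq> Gal" "\<one>\<^bsub>galois_group L K\<^esub> \<in> inertia_group L K w"
    "\<sigma> \<in> inertia_group L K w \<Longrightarrow> \<tau> \<in> inertia_group L K w \<Longrightarrow> \<sigma> \<star> \<tau> \<in> inertia_group L K w"
proof -
  interpret W: valued_field L w by (rule valued_field.intro[OF L w])
  have aL: "a \<in> L" if "a \<in> W.A" for a using that by (simp add: W.A_iff)
  have iff: "\<sigma> \<in> inertia_group L K w \<longleftrightarrow> \<sigma> \<in> Gal \<and> (\<forall>a\<in>W.A. \<sigma> a - a \<in> W.m)" for \<sigma>
  proof -
    have "\<sigma> a - a \<in> L" if "\<sigma> \<in> Gal" "a \<in> W.A" for a
      using L_closed(6)[OF app_closed[OF that(1) aL[OF that(2)]] aL[OF that(2)]] .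
    then show ?thesis unfolding inertia_group_def W.m_iff by blast
  qed
  show "inertia_group L K w \<subseteq> Gal" by (auto simp: inertia_group_def)
  show "\<one>\<^bsub>galois_group L K\<^esub> \<in> inertia_group L K w"
    using one_apply aL W.m_zero by (simp add: iff)
  assume *: "\<sigma> \<in> inertia_group L K w" "\<tau> \<in> inertia_group L K w"
  then have st: "\<sigma> \<in> Gal" "\<tau> \<in> Gal" "\<And>a. a \<in> W.A \<Longrightarrow> \<sigma> a - a \<in> W.m" "\<And>a. a \<in> W.A \<Longrightarrow> \<tau> a - a \<in> W.m"
    by (simp_all add: iff)
  have "(\<sigma> \<star> \<tau>) a - a \<in> W.m" if a: "a \<in> W.A" for a
  proof -
    have "(\<tau> a - a) + a \<in> W.A" using W.A_add[OF subsetD[OF W.m_sub st(4)[OF a]] a] .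
    then have ta: "\<tau> a \<in> W.A" by simp
    have "(\<sigma> \<star> \<tau>) a - a = (\<sigma> (\<tau> a) - \<tau> a) + (\<tau> a - a)"
      using comp_apply[OF st(1,2) aL[OF a]] by simp
    then show ?thesis using W.m_add[OF st(3)[OF ta] st(4)[OF a]] by simp
  qed
  then show "\<sigma> \<star> \<tau> \<in> inertia_group L K w" using st(1,2) by (simp add: iff)
qed

lemma kummer_map_eq:
  assumes "r \<in> L" "r ^ q = t"
  obtains r' where "r' \<in> L" "r' ^ q = t" "\<And>\<sigma>. kummer_map L q t \<sigma> = \<sigma> r' / r'"
proof -
  define r' where "r' = (SOME r. r \<in> L \<and> r ^ q = t)"
  have "r' \<in> L \<and> r' ^ q = t" unfolding r'_def by (rule someI[of _ r]) (use assms in simp)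
  moreover have "kummer_map L q t \<sigma> = \<sigma> r' / r'" for \<sigma> by (simp add: kummer_map_def r'_def Let_def)
  ultimately show ?thesis using that by blast
qed

lemma kummer_character:
  assumes roots: "{x. x ^ q = 1} \<subseteq> K" and r: "r \<in> L" "r ^ q = t" "t \<in> K" "r \<noteq> 0" and \<sigma>: "\<sigma> \<in> Gal"
  shows "(\<sigma> r / r) ^ q = 1" "\<sigma> r / r \<in> K" "\<tau> \<in> Gal \<Longrightarrow> (\<sigma> \<star> \<tau>) r / r = (\<sigma> r / r) * (\<tau> r / r)"
proof -
  have pow: "(\<sigma> r / r) ^ q = 1" if \<sigma>: "\<sigma> \<in> Gal" for \<sigma>
  proof -
    have "(\<sigma> r) ^ q = t" using app_power[OF \<sigma> r(1), of q] app_fix[OF \<sigma> r(3)] unfolding r(2) by simp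
    moreover have "t \<noteq> 0" using r(2,4) by auto
    ultimately show ?thesis using r(2) by (simp add: power_divide)
  qed
  show "(\<sigma> r / r) ^ q = 1" by (rule pow[OF \<sigma>])
  show "\<sigma> r / r \<in> K" using pow[OF \<sigma>] roots by blast
  assume \<tau>: "\<tau> \<in> Gal"
  have c: "\<tau> r / r \<in> K" using pow[OF \<tau>] roots by blast
  have "(\<sigma> \<star> \<tau>) r = \<sigma> (\<tau> r / r * r)" using comp_apply[OF \<sigma> \<tau> r(1)] r(4) by simp
  also have "\<dots> = \<tau> r / r * \<sigma> r" using app_mult[OF \<sigma> _ r(1), of "\<tau> r / r"] app_fix[OF \<sigma> c] c K_sub by auto
  finally show "(\<sigma> \<star> \<tau>) r / r = (\<sigma> r / r) * (\<tau> r / r)" by simp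
qed

text \<open>
  The Kummer value of an element that moves \<open>r ^ (q / p)\<close> is a root of unity of exact order \<open>q\<close>, whose
  powers exhaust all \<open>q\<close>-th roots of unity.
\<close>

lemma kummer_surjective:
  assumes p: "Factorial_Ring.prime p" and q: "q = p ^ k" "1 < q" and z: "z \<in> K" "primitive_root_of_unity q z"
    and r: "r \<in> L" "r ^ q = t" "t \<in> K" "r \<noteq> 0"
    and T: "T \<subseteq> Gal" "\<one>\<^bsub>galois_group L K\<^esub> \<in> T" "\<And>\<sigma> \<tau>. \<sigma> \<in> T \<Longrightarrow> \<tau> \<in> T \<Longrightarrow> \<sigma> \<star> \<tau> \<in> T"
    and moved: "\<tau> \<in> T" "\<tau> (r ^ (q div p)) \<noteq> r ^ (q div p)"
  shows "(\<lambda>\<sigma>. \<sigma> r / r) ` T = {x. x ^ q = 1}"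
proof
  have q0: "0 < q" using q(2) by simp
  have roots: "{x. x ^ q = 1} \<subseteq> K"
    unfolding roots_of_unity(1)[OF z(2) q0] using z(1) K_closed(9) by blast
  note kc = kummer_character[OF roots r]
  show "(\<lambda>\<sigma>. \<sigma> r / r) ` T \<subseteq> {x. x ^ q = 1}" using kc(1) T(1) by blast
  have \<tau>: "\<tau> \<in> Gal" using moved(1) T(1) by blast
  have "(\<tau> r / r) ^ (q div p) \<noteq> 1"
    using moved(2) app_power[OF \<tau> r(1)] r(4) by (simp add: power_divide)
  then have prim: "primitive_root_of_unity q (\<tau> r / r)"
    by (rule root_of_unity_of_exact_order[OF p q kc(1)[OF \<tau>]])
  have "(\<tau> r / r) ^ i \<in> (\<lambda>\<sigma>. \<sigma> r / r) ` T" for i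
  proof (induct i)
    case 0
    have "\<one>\<^bsub>galois_group L K\<^esub> r / r = 1" using one_apply[OF r(1)] r(4) by simp
    then show ?case using T(2) by (auto simp: image_iff intro!: bexI[OF _ T(2)])
  next
    case (Suc i)
    then obtain \<sigma> where \<sigma>: "\<sigma> \<in> T" "(\<tau> r / r) ^ i = \<sigma> r / r" by blast
    have "(\<tau> \<star> \<sigma>) r / r = (\<tau> r / r) ^ Suc i" using kc(3)[OF \<tau>, of \<sigma>] \<sigma> T(1) by auto
    moreover have "\<tau> \<star> \<sigma> \<in> T" by (rule T(3)[OF moved(1) \<sigma>(1)])
    ultimately show ?case by (metis (no_types, lifting) image_eqI)
  qed
  then show "{x. x ^ q = 1} \<subseteq> (\<lambda>\<sigma>. \<sigma> r / r) ` T"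
    unfolding roots_of_unity(1)[OF prim q0] by blast
qed

lemma restrict_to_fixed_field:
  assumes N: "N \<lhd> galois_group L K"
  defines "E \<equiv> fixed_field L N"
  shows "\<sigma> \<in> Gal \<Longrightarrow> restrict \<sigma> E \<in> carrier (galois_group E K)"
    "\<sigma> \<in> Gal \<Longrightarrow> \<tau> \<in> Gal \<Longrightarrow> restrict (\<sigma> \<star> \<tau>) E = restrict \<sigma> E \<otimes>\<^bsub>galois_group E K\<^esub> restrict \<tau> E"
proof -
  let ?G = "galois_group L K"
  interpret N: normal N ?G by (rule N)
  have EL: "x \<in> L" and fix_E: "\<And>\<nu>. \<nu> \<in> N \<Longrightarrow> \<nu> x = x" if "x \<in> E" for x
    using that by (auto simp: E_def fixed_field_def)
  have KE: "K \<subseteq> E"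
  proof
    fix x assume x: "x \<in> K"
    have "\<nu> x = x" if "\<nu> \<in> N" for \<nu> by (rule app_fix[OF subsetD[OF N.subset that] x])
    then show "x \<in> E" using subsetD[OF K_sub x] by (simp add: E_def fixed_field_def)
  qed
  have stable: "\<sigma> x \<in> E" if \<sigma>: "\<sigma> \<in> Gal" and x: "x \<in> E" for \<sigma> x
  proof -
    have "\<nu> (\<sigma> x) = \<sigma> x" if \<nu>: "\<nu> \<in> N" for \<nu>
    proof -
      have \<nu>G: "\<nu> \<in> Gal" by (rule subsetD[OF N.subset \<nu>])
      let ?i = "inv\<^bsub>?G\<^esub> \<sigma>"
      have i: "?i \<in> Gal" using \<sigma> by simp
      have "?i \<star> \<nu> \<star> \<sigma> \<in> N" by (rule N.inv_op_closed1[OF \<sigma> \<nu>])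
      then have "(?i \<star> \<nu> \<star> \<sigma>) x = x" using fix_E[OF x] by blast
      then have "?i (\<nu> (\<sigma> x)) = x"
        using comp_apply[OF G.m_closed[OF i \<nu>G] \<sigma> EL[OF x]] comp_apply[OF i \<nu>G app_closed[OF \<sigma> EL[OF x]]] by simp
      then show ?thesis using app_inv(1)[OF \<sigma> app_closed[OF \<nu>G app_closed[OF \<sigma> EL[OF x]]]] by simp
    qed
    then show ?thesis using app_closed[OF \<sigma> EL[OF x]] by (simp add: E_def fixed_field_def)
  qed
  show mem: "restrict \<sigma> E \<in> carrier (galois_group E K)" if \<sigma>: "\<sigma> \<in> Gal" for \<sigma>
  proof -
    have i: "inv\<^bsub>?G\<^esub> \<sigma> \<in> Gal" using \<sigma> by simp
    have "bij_betw \<sigma> E E"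
      by (rule bij_betw_byWitness[where f' = "inv\<^bsub>?G\<^esub> \<sigma>"])
        (use app_inv[OF \<sigma> EL] stable[OF \<sigma>] stable[OF i] in auto)
    then have "restrict \<sigma> E \<in> Bij E" by (simp add: Bij_def)
    moreover have "x + y \<in> E" "x * y \<in> E" if "x \<in> E" "y \<in> E" for x y
    proof -
      have "\<nu> (x + y) = x + y \<and> \<nu> (x * y) = x * y" if "\<nu> \<in> N" for \<nu>
        using app_add[OF subsetD[OF N.subset that] EL EL, of x y] app_mult[OF subsetD[OF N.subset that] EL EL, of x y]
          fix_E[OF \<open>x \<in> E\<close> that] fix_E[OF \<open>y \<in> E\<close> that] \<open>x \<in> E\<close> \<open>y \<in> E\<close> by simp
      then show "x + y \<in> E" "x * y \<in> E"
        using L_closed(3,4)[OF EL EL] \<open>x \<in> E\<close> \<open>y \<in> E\<close> by (auto simp: E_def fixed_field_def)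
    qed
    ultimately show ?thesis
      using app_add[OF \<sigma> EL EL] app_mult[OF \<sigma> EL EL] app_fix[OF \<sigma>] KE
      by (auto simp: galois_group_def)
  qed
  assume \<sigma>: "\<sigma> \<in> Gal" and \<tau>: "\<tau> \<in> Gal"
  have "restrict \<sigma> E \<in> Bij E" "restrict \<tau> E \<in> Bij E" using mem[OF \<sigma>] mem[OF \<tau>] by (simp_all add: galois_group_def)
  then have "restrict \<sigma> E \<otimes>\<^bsub>galois_group E K\<^esub> restrict \<tau> E = compose E (restrict \<sigma> E) (restrict \<tau> E)"
    by (simp add: galois_group_def BijGroup_def)
  also have "\<dots> = restrict (\<sigma> \<star> \<tau>) E"
    using comp_apply[OF \<sigma> \<tau> EL] stable[OF \<tau>] by (auto simp: compose_def restrict_def fun_eq_iff)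
  finally show "restrict (\<sigma> \<star> \<tau>) E = restrict \<sigma> E \<otimes>\<^bsub>galois_group E K\<^esub> restrict \<tau> E" by simp
qed

end


section \<open>Residue characteristic and orderings\<close>

text \<open>
  If \<open>p\<close> were in the maximal ideal, then an integer that is not a multiple of \<open>p\<close> could not be in it, by
  Bezout's identity, and the greatest common divisor that defines the residue characteristic would be \<open>p\<close>.
\<close>

lemma residue_char_unit:
  fixes v :: "'a::field \<Rightarrow> 'g::linordered_ab_group_add"
  assumes K: "subfield K \<Omega>" and v: "valuation K v" and p: "Factorial_Ring.prime p" "residue_char K v \<noteq> p"
  shows "of_nat p \<notin> valuation_ideal K v"
proof
  assume pm: "of_nat p \<in> valuation_ideal K v"
  interpret W: valued_field K v by (rule valued_field.intro[OF K v])
  let ?R = "\<Omega>\<lparr>carrier := W.A\<rparr> :: 'a ring"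
  let ?Q = "residue_field K v"
  interpret R: field "\<Omega> :: 'a ring" by (rule field_from_type_algebra)
  have coset: "W.m +>\<^bsub>?R\<^esub> x = {h + x | h. h \<in> W.m}" for x
    by (auto simp: a_r_coset_def r_coset_def)
  have one: "\<one>\<^bsub>?Q\<^esub> = {h + 1 | h. h \<in> W.m}"
    using coset[of 1] by (simp add: residue_field_def FactRing_def)
  have add: "{h + x | h. h \<in> W.m} \<oplus>\<^bsub>?Q\<^esub> {h + y | h. h \<in> W.m} = {h + (x + y) | h. h \<in> W.m}" for x y
  proof -
    have "{h + x | h. h \<in> W.m} \<oplus>\<^bsub>?Q\<^esub> {h + y | h. h \<in> W.m} = {a + b | a b. a \<in> {h + x | h. h \<in> W.m} \<and> b \<in> {h + y | h. h \<in> W.m}}"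
      by (auto simp: residue_field_def FactRing_def set_add_def set_mult_def)
    also have "\<dots> = {h + (x + y) | h. h \<in> W.m}"
    proof
      show "{a + b | a b. a \<in> {h + x | h. h \<in> W.m} \<and> b \<in> {h + y | h. h \<in> W.m}} \<subseteq> {h + (x + y) | h. h \<in> W.m}"
      proof
        fix c assume "c \<in> {a + b | a b. a \<in> {h + x | h. h \<in> W.m} \<and> b \<in> {h + y | h. h \<in> W.m}}"
        then obtain h h' where "h \<in> W.m" "h' \<in> W.m" "c = (h + x) + (h' + y)" by blast
        then have "c = (h + h') + (x + y)" "h + h' \<in> W.m" using W.m_add by (simp_all add: algebra_simps)
        then show "c \<in> {h + (x + y) | h. h \<in> W.m}" by blast
      qed
      show "{h + (x + y) | h. h \<in> W.m} \<subseteq> {a + b | a b. a \<in> {h + x | h. h \<in> W.m} \<and> b \<in> {h + y | h. h \<in> W.m}}"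
      proof
        fix c assume "c \<in> {h + (x + y) | h. h \<in> W.m}"
        then obtain h where "h \<in> W.m" "c = (h + x) + (0 + y)" by (auto simp: algebra_simps)
        then show "c \<in> {a + b | a b. a \<in> {h + x | h. h \<in> W.m} \<and> b \<in> {h + y | h. h \<in> W.m}}"
          using W.m_zero by blast
      qed
    qed
    finally show ?thesis .
  qed
  have zero: "\<zero>\<^bsub>?Q\<^esub> = {h + 0 | h. h \<in> W.m}" by (simp add: residue_field_def FactRing_def)
  have mult: "[n] \<cdot>\<^bsub>?Q\<^esub> \<one>\<^bsub>?Q\<^esub> = {h + of_nat n | h. h \<in> W.m}" for n :: nat
  proof (induct n)
    case 0
    then show ?case using zero by (simp add: add_pow_def)
  next
    case (Suc n)
    have "[Suc n] \<cdot>\<^bsub>?Q\<^esub> \<one>\<^bsub>?Q\<^esub> = [n] \<cdot>\<^bsub>?Q\<^esub> \<one>\<^bsub>?Q\<^esub> \<oplus>\<^bsub>?Q\<^esub> \<one>\<^bsub>?Q\<^esub>" by (simp add: add_pow_def)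
    also have "\<dots> = {h + of_nat n | h. h \<in> W.m} \<oplus>\<^bsub>?Q\<^esub> \<one>\<^bsub>?Q\<^esub>" by (simp only: Suc)
    also have "\<dots> = {h + of_nat (Suc n) | h. h \<in> W.m}" unfolding one add by (simp add: add.commute)
    finally show ?case .
  qed
  have "[n] \<cdot>\<^bsub>?Q\<^esub> \<one>\<^bsub>?Q\<^esub> = \<zero>\<^bsub>?Q\<^esub> \<longleftrightarrow> of_nat n \<in> W.m" for n :: nat
  proof
    assume "[n] \<cdot>\<^bsub>?Q\<^esub> \<one>\<^bsub>?Q\<^esub> = \<zero>\<^bsub>?Q\<^esub>"
    then have "0 + of_nat n \<in> {h + 0 | h. h \<in> W.m}" unfolding mult zero using W.m_zero by blast
    then show "of_nat n \<in> W.m" by simp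
  next
    assume n: "of_nat n \<in> W.m"
    have "{h + of_nat n | h. h \<in> W.m} = {h + 0 | h. h \<in> W.m}"
    proof
      show "{h + of_nat n | h. h \<in> W.m} \<subseteq> {h + 0 | h. h \<in> W.m}" using W.m_add n by auto
      show "{h + 0 | h. h \<in> W.m} \<subseteq> {h + of_nat n | h. h \<in> W.m}"
      proof
        fix c assume "c \<in> {h + 0 | h. h \<in> W.m}"
        then have "c - of_nat n \<in> W.m" "c = (c - of_nat n) + of_nat n" using W.m_diff n by auto
        then show "c \<in> {h + of_nat n | h. h \<in> W.m}" by blast
      qed
    qed
    then show "[n] \<cdot>\<^bsub>?Q\<^esub> \<one>\<^bsub>?Q\<^esub> = \<zero>\<^bsub>?Q\<^esub>" unfolding mult zero .
  qed
  then have rc: "residue_char K v = Gcd {n. of_nat n \<in> W.m}" by (simp add: residue_char_def)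
  have "p dvd n" if n: "of_nat n \<in> W.m" for n
  proof (rule ccontr)
    assume "\<not> p dvd n"
    then have "coprime n p" using p(1) by (metis coprime_commute prime_imp_coprime)
    then obtain a b where "a * n = b * p + 1"
      using coprime_bezout_strong[of n p] prime_gt_1_nat[OF p(1)] by (auto simp: mult.commute)
    then have "(of_nat a * of_nat n - of_nat b * of_nat p :: 'a) = 1"
      by (metis add_diff_cancel_left' of_nat_1 of_nat_add of_nat_mult)
    moreover have "(of_nat a * of_nat n - of_nat b * of_nat p :: 'a) \<in> W.m"
      by (intro W.m_diff W.m_mult W.A_of_nat n pm)
    ultimately show False using W.one_notin by simp
  qed
  then have "Gcd {n. of_nat n \<in> W.m} = p" using pm
    by (intro Gcd_eqI) auto
  then show False using p(2) rc by simp
qed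

text \<open>
  The positive elements form a subgroup of index \<open>2\<close>, so an element that is not positive lies in the same
  coset as its inverse, and its square is their quotient.
\<close>

lemma field_ordering_squares:
  fixes K :: "'a::field set"
  assumes "field_ordering K P" "subfield K \<Omega>"
  shows "0 \<notin> P" "x \<in> P \<Longrightarrow> y \<in> P \<Longrightarrow> x + y \<in> P" "x \<in> K \<Longrightarrow> x \<noteq> 0 \<Longrightarrow> x ^ 2 \<in> P"
proof -
  let ?R = "\<Omega>\<lparr>carrier := K\<rparr> :: 'a ring"
  let ?U = "mult_of ?R"
  interpret R: field "\<Omega> :: 'a ring" by (rule field_from_type_algebra)
  interpret F: field ?R by (rule R.subfield_iff(2)[OF assms(2)])
  have "?U = units_of ?R" using F.field_Units by (simp add: units_of_def mult_of_def)
  then interpret U: group ?U using F.units_group by simp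
  have P: "subgroup P ?U" "card (rcosets\<^bsub>?U\<^esub> P) = 2" "\<forall>x\<in>P. \<forall>y\<in>P. x + y \<in> P"
    using assms(1) by (auto simp: field_ordering_def)
  interpret P: subgroup P ?U by (rule P(1))
  have cU: "carrier ?U = K - {0}" by simp
  show "0 \<notin> P" using P.subset cU by auto
  show "x \<in> P \<Longrightarrow> y \<in> P \<Longrightarrow> x + y \<in> P" using P(3) by blast
  assume x: "x \<in> K" "x \<noteq> 0"
  show "x ^ 2 \<in> P"
  proof (cases "x \<in> P")
    case True
    then show ?thesis using P.m_closed[OF True True] by (simp add: power2_eq_square)
  next
    case False
    have xU: "x \<in> carrier ?U" using x cU by simp
    have inv: "inv\<^bsub>?U\<^esub> x \<in> carrier ?U" by (rule U.inv_closed[OF xU])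
    let ?C = "P #>\<^bsub>?U\<^esub> x" and ?D = "P #>\<^bsub>?U\<^esub> inv\<^bsub>?U\<^esub> x"
    have neP: "P #>\<^bsub>?U\<^esub> y \<noteq> P" if "y \<in> carrier ?U" "y \<notin> P" for y
      using U.rcos_self[OF that(1) P(1)] that(2) by blast
    have "inv\<^bsub>?U\<^esub> x \<notin> P" using P.m_inv_closed[of "inv\<^bsub>?U\<^esub> x"] U.inv_inv[OF xU] False by auto
    then have ne: "?C \<noteq> P" "?D \<noteq> P" using neP xU inv False by blast+
    have mem: "?C \<in> rcosets\<^bsub>?U\<^esub> P" "?D \<in> rcosets\<^bsub>?U\<^esub> P" "P \<in> rcosets\<^bsub>?U\<^esub> P"
      using xU inv P.subgroup_in_rcosets[OF U.group_axioms] by (auto simp: RCOSETS_def)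
    have fin: "finite (rcosets\<^bsub>?U\<^esub> P)" using P(2) by (metis card.infinite zero_neq_numeral)
    have "?C = ?D"
    proof (rule ccontr)
      assume "?C \<noteq> ?D"
      then have "card {P, ?C, ?D} = 3" using ne by auto
      moreover have "card {P, ?C, ?D} \<le> 2" using card_mono[OF fin, of "{P, ?C, ?D}"] mem P(2) by auto
      ultimately show False by simp
    qed
    then have "x \<in> ?D" using U.rcos_self[OF xU P(1)] by simp
    then obtain h where h: "h \<in> P" "x = h \<otimes>\<^bsub>?U\<^esub> inv\<^bsub>?U\<^esub> x" by (auto simp: r_coset_def)
    then have "x = h * inv\<^bsub>?U\<^esub> x" by simp
    moreover have "inv\<^bsub>?U\<^esub> x * x = 1" using U.l_inv[OF xU] by simp
    ultimately have "x * x = h" by (metis mult.assoc mult.right_neutral)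
    then show ?thesis using h(1) by (simp add: power2_eq_square)
  qed
qed


section \<open>Ramification in the field cut out by a globalization\<close>

theorem theorem8p5:
  fixes p q n :: nat
    and F Fp :: "'a::alg_closed_field set"
    and \<phi> :: "'a \<Rightarrow> 'q::nontriv mod_ring"
    and Jval Jord I Ihat :: "'j set"
    and v u :: "'j \<Rightarrow> 'a \<Rightarrow> 'g::linordered_ab_group_add"
    and P R :: "'j \<Rightarrow> 'a set"
    and Z T :: "'j \<Rightarrow> ('a \<Rightarrow> 'a) set"
    and ix :: "nat \<Rightarrow> 'j"
    and t :: "'j \<Rightarrow> 'a"
    and \<pi> :: "'j \<Rightarrow> ('a \<Rightarrow> 'a) \<Rightarrow> 'q mod_ring mat"
    and \<rho> :: "('a \<Rightarrow> 'a) set \<Rightarrow> 'q mod_ring mat"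
    and G :: "('a \<Rightarrow> 'a) monoid"
    and N :: "('a \<Rightarrow> 'a) set"
    and E :: "'a set"
  assumes p: "Factorial_Ring.prime p"
    and q: "q > 1" "\<exists>k. q = p ^ k" "CARD('q) = q"
    and F: "subfield F \<Omega>"
    and root_of_unity: "\<exists>z\<in>F. primitive_root_of_unity q z"
    and \<phi>: "\<phi> \<in> iso (roots_of_unity_group q F) (add_monoid (ring_of_type_algebra :: 'q mod_ring ring))"
    and Fp: "maximal_pro_p_galois_extension p Fp F"
    and G: "G = galois_group Fp F"
    and J: "Jval \<inter> Jord = {}"
    and v: "\<And>j. j \<in> Jval \<Longrightarrow> valuation F (v j) \<and> nontrivial_valuation F (v j)"
    and v_noneq: "\<And>j j'. j \<in> Jval \<Longrightarrow> j' \<in> Jval \<Longrightarrow> j \<noteq> j' \<Longrightarrow> \<not> equivalent_valuations F (v j) (v j')"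
    and u: "\<And>j. j \<in> Jval \<Longrightarrow> valuation Fp (u j) \<and> (\<forall>x\<in>F - {0}. u j x = v j x)"
    and ZT_val: "\<And>j. j \<in> Jval \<Longrightarrow> Z j = decomposition_group Fp F (u j)"
                "\<And>j. j \<in> Jval \<Longrightarrow> T j = inertia_group Fp F (u j)"
    and Jord: "p \<noteq> 2 \<Longrightarrow> Jord = {}"
    and P: "\<And>j. j \<in> Jord \<Longrightarrow> field_ordering F (P j)" "inj_on P Jord"
    and R: "\<And>j. j \<in> Jord \<Longrightarrow> relative_real_closure Fp F (P j) (R j)"
    and ZT_ord: "\<And>j. j \<in> Jord \<Longrightarrow> Z j = carrier (galois_group Fp (R j))"
                "\<And>j. j \<in> Jord \<Longrightarrow> T j = carrier (galois_group Fp (R j))"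
    and I: "n \<ge> 1" "bij_betw ix {..<n} I" "I \<subseteq> Ihat" "Ihat \<subseteq> Jval \<union> Jord"
    and I_val: "\<And>i. i \<in> I \<inter> Jval \<Longrightarrow> discrete_valuation F (v i) \<and> residue_char F (v i) \<noteq> p"
    and I_indep: "inj_on (\<lambda>i. if i \<in> Jval then valuation_topology F (v i) else ordering_topology F (P i)) I"
    and t: "\<And>i. i \<in> I \<Longrightarrow> t i \<in> F - {0}"
           "\<And>i. i \<in> I \<inter> Jval \<Longrightarrow> uniformizer F (v i) (t i)"
           "\<And>i. i \<in> I \<inter> Jord \<Longrightarrow> - t i \<in> P i"
           "\<And>i i'. i \<in> I \<Longrightarrow> i' \<in> I \<inter> Jval \<Longrightarrow> i \<noteq> i' \<Longrightarrow> v i' (t i) = 0"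
           "\<And>i i'. i \<in> I \<Longrightarrow> i' \<in> I \<inter> Jord \<Longrightarrow> i \<noteq> i' \<Longrightarrow> t i \<in> P i'"
    and \<pi>: "\<And>l \<tau>. l < n \<Longrightarrow> \<tau> \<in> T (ix l) \<Longrightarrow>
           \<pi> (ix l) \<tau> = 1\<^sub>m (n + 1) + \<phi> (kummer_map Fp q (t (ix l)) \<tau>) \<cdot>\<^sub>m elementary_matrix (n + 1) l (l + 1)"
    and N: "N = closed_normal_closure G (krull_topology Fp F) (\<Union>j\<in>(Jval \<union> Jord) - Ihat. T j)"
    and generate: "(quotient_topology G (krull_topology Fp F) N) closure_of
           (generate (G Mod N) (\<Union>i\<in>I. (\<lambda>\<tau>. N #>\<^bsub>G\<^esub> \<tau>) ` T i)) = carrier (G Mod N)"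
    and \<rho>: "globalization
           \<lparr>index_set = I,
            global_group = G Mod N,
            global_topology = quotient_topology G (krull_topology Fp F) N,
            target_group = unipotent_group n,
            local_group = (\<lambda>i. G\<lparr>carrier := Z i\<rparr>),
            local_inertia = T,
            local_res = (\<lambda>i \<sigma>. N #>\<^bsub>G\<^esub> \<sigma>),
            local_map = \<pi>\<rparr> \<rho>"
    and E: "E = fixed_field Fp {\<sigma> \<in> carrier G. \<rho> (N #>\<^bsub>G\<^esub> \<sigma>) = \<one>\<^bsub>unipotent_group n\<^esub>}"
  shows "(\<forall>i\<in>I. \<not> unramified_in (T i) E \<and>
            ((galois_group E F)\<lparr>carrier := (\<lambda>\<sigma>. restrict \<sigma> E) ` T i\<rparr>) \<cong> integer_mod_group q)
       \<and> (\<forall>j\<in>(Jval \<union> Jord) - Ihat. unramified_in (T j) E)"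
proof -
  let ?G = "galois_group Fp F"
  have pro: "pro_p_galois_extension p Fp F" and max: "\<And>M. pro_p_galois_extension p M F \<Longrightarrow> M \<subseteq> Fp"
    using Fp by (auto simp: maximal_pro_p_galois_extension_def)
  interpret S: galois Fp F
    by unfold_locales (use pro in \<open>simp add: pro_p_galois_extension_def\<close>)
  obtain k where k: "q = p ^ k" using q(2) by blast
  obtain z where z: "z \<in> F" "primitive_root_of_unity q z" using root_of_unity by blast
  have q0: "0 < q" using q(1) by simp
  have p2: "2 \<le> p" using prime_ge_2_nat[OF p] .
  have roots: "{x. x ^ q = 1} \<subseteq> F"
    unfolding roots_of_unity(1)[OF z(2) q0] using z(1) S.K_closed(9) by blast
  have pq: "(q div p) * p = q" using k q(1) by (cases k) auto

  have T: "T j \<subseteq> S.Gal \<and> \<one>\<^bsub>?G\<^esub> \<in> T j \<and> (\<forall>\<sigma>\<in>T j. \<forall>\<tau>\<in>T j. \<sigma> \<otimes>\<^bsub>?G\<^esub> \<tau> \<in> T j)"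
    if j: "j \<in> Jval \<union> Jord" for j
  proof (cases "j \<in> Jval")
    case True
    then have "valuation Fp (u j)" using u by blast
    then show ?thesis unfolding ZT_val(2)[OF True] using S.inertia_closed[of "u j"] by blast
  next
    case False
    then have jo: "j \<in> Jord" using j by blast
    have FR: "F \<subseteq> R j" "R j \<subseteq> Fp" using R[OF jo] by (auto simp: relative_real_closure_def)
    have Tj: "\<sigma> \<in> T j \<longleftrightarrow> \<sigma> \<in> S.Gal \<and> (\<forall>x\<in>R j. \<sigma> x = x)" for \<sigma>
      unfolding ZT_ord(2)[OF jo] galois_group_def using FR(1) by auto
    have "\<sigma> \<otimes>\<^bsub>?G\<^esub> \<tau> \<in> T j" if "\<sigma> \<in> T j" "\<tau> \<in> T j" for \<sigma> \<tau>
    proof -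
      have st: "\<sigma> \<in> S.Gal" "\<tau> \<in> S.Gal" using that Tj by blast+
      have "(\<sigma> \<otimes>\<^bsub>?G\<^esub> \<tau>) x = x" if x: "x \<in> R j" for x
        using S.comp_apply[OF st subsetD[OF FR(2) x]] \<open>\<sigma> \<in> T j\<close> \<open>\<tau> \<in> T j\<close> x Tj by simp
      then show ?thesis using st Tj by simp
    qed
    moreover have "\<one>\<^bsub>?G\<^esub> \<in> T j" using Tj S.one_apply FR(2) by auto
    ultimately show ?thesis using Tj by blast
  qed
  have IJ: "i \<in> Jval \<union> Jord" if "i \<in> I" for i using that I(3,4) by blast

  have TG: "(\<Union>j\<in>(Jval \<union> Jord) - Ihat. T j) \<subseteq> S.Gal" using T by blast
  have N': "N = closed_normal_closure ?G (krull_topology Fp F) (\<Union>j\<in>(Jval \<union> Jord) - Ihat. T j)"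
    using N unfolding G .
  interpret N: normal N ?G unfolding N' by (rule S.normal_closure(1)[OF TG])
  have TN: "T j \<subseteq> N" if "j \<in> (Jval \<union> Jord) - Ihat" for j
    using S.normal_closure(2)[OF TG] that unfolding N' by blast
  define c where "c \<sigma> = N #>\<^bsub>?G\<^esub> \<sigma>" for \<sigma>
  have \<rho>_hom: "\<rho> \<in> hom (?G Mod N) (unipotent_group n)"
    and \<rho>_cont: "continuous_map (quotient_topology ?G (krull_topology Fp F) N)
      (discrete_topology (carrier (unipotent_group n))) \<rho>"
    and \<rho>_loc: "\<And>i \<tau>. i \<in> I \<Longrightarrow> \<tau> \<in> T i \<Longrightarrow> \<rho> (c \<tau>) = \<pi> i \<tau>"
    using \<rho> unfolding globalization_def G by (auto simp: c_def)
  have c_carrier: "c \<sigma> \<in> carrier (?G Mod N)" if "\<sigma> \<in> S.Gal" for \<sigma>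
    using that by (auto simp: c_def FactGroup_def RCOSETS_def)
  have \<rho>_carrier: "\<rho> (c \<sigma>) \<in> carrier_mat (n + 1) (n + 1)" if "\<sigma> \<in> S.Gal" for \<sigma>
    using hom_in_carrier[OF \<rho>_hom c_carrier[OF that]] by (simp add: unipotent_group_def)
  have \<rho>_mult: "\<rho> (c (\<sigma> \<otimes>\<^bsub>?G\<^esub> \<tau>)) = \<rho> (c \<sigma>) * \<rho> (c \<tau>)" if "\<sigma> \<in> S.Gal" "\<tau> \<in> S.Gal" for \<sigma> \<tau>
    using hom_mult[OF \<rho>_hom c_carrier[OF that(1)] c_carrier[OF that(2)]] N.rcos_sum[OF that]
    by (simp add: c_def FactGroup_def unipotent_group_def)

  have \<phi>_hom: "\<phi> (x * y) = \<phi> x + \<phi> y" if "x ^ q = 1" "y ^ q = 1" for x y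
  proof -
    have "x \<in> F" "y \<in> F" using that roots by blast+
    then show ?thesis
      using \<phi> that by (auto simp: iso_def hom_def roots_of_unity_group_def)
  qed
  have \<phi>_bij: "bij_betw \<phi> {x. x ^ q = 1} UNIV"
  proof -
    have "{x \<in> F. x ^ q = 1} = {x. x ^ q = 1}" using roots by blast
    then show ?thesis using \<phi> by (simp add: iso_def roots_of_unity_group_def)
  qed
  have \<phi>_one: "\<phi> 1 = 0" using \<phi>_hom[of 1 1] by simp

  \<comment> \<open>Here \<open>r\<close> is the root that the Kummer map chooses; it exists since \<open>F(p)\<close> contains all \<open>q\<close>-th roots of elements of \<open>F\<close>.\<close>
  have radical: "\<exists>r. r \<in> Fp \<and> r ^ q = t i \<and> r \<noteq> 0 \<and> (\<forall>\<sigma>. kummer_map Fp q (t i) \<sigma> = \<sigma> r / r)" if i: "i \<in> I" for i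
  proof -
    obtain r0 where r0: "r0 ^ q = t i" using nth_root_exists[OF q0] by blast
    have ti: "t i \<in> F" "t i \<noteq> 0" using t(1)[OF i] by auto
    have "r0 \<noteq> 0" using r0 ti(2) q0 by (auto simp: power_0_left)
    moreover have "r0 ^ q \<in> F" using r0 ti by simp
    ultimately obtain M where "pro_p_galois_extension p M F" "r0 \<in> M"
      using kummer_radical_in_pro_p[OF p k F z] by blast
    then have "r0 \<in> Fp" using max by blast
    then obtain r where "r \<in> Fp" "r ^ q = t i" "\<And>\<sigma>. kummer_map Fp q (t i) \<sigma> = \<sigma> r / r"
      using S.kummer_map_eq[OF _ r0] by blast
    moreover from this have "r \<noteq> 0" using ti(2) q0 by (auto simp: power_0_left)
    ultimately show ?thesis by blast
  qed
  have moved: "\<exists>\<tau>\<in>T i. \<tau> (r ^ (q div p)) \<noteq> r ^ (q div p)" if i: "i \<in> I" and r: "r \<in> Fp" "r ^ q = t i" for i r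
  proof -
    let ?s = "r ^ (q div p)"
    have s: "?s \<in> Fp" "?s ^ p = t i"
      using S.L_closed(9)[OF r(1)] r(2) pq by (simp_all flip: power_mult)
    have ti: "t i \<in> F" "t i \<noteq> 0" using t(1)[OF i] by auto
    show ?thesis
    proof (cases "i \<in> Jval")
      case True
      have vu: "valuation F (v i)" "valuation Fp (u i)" "\<And>x. x \<in> F \<Longrightarrow> x \<noteq> 0 \<Longrightarrow> u i x = v i x"
        using v[OF True] u[OF True] by auto
      have pF: "of_nat p \<in> F"
        by (induct p) (use S.K_closed in auto)
      have "of_nat p \<notin> valuation_ideal F (v i)"
        using residue_char_unit[OF F vu(1) p] I_val[of i] i True by blast
      then have char: "of_nat p \<notin> valuation_ideal Fp (u i)"
        using pF vu(3)[OF pF] S.K_closed(1) by (auto simp: valuation_ideal_def)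
      have unif: "uniformizer F (u i) (t i)"
        using t(2)[of i] i True vu(3) by (auto simp: uniformizer_def)
      have rp: "x \<in> F" if "x ^ p = 1" for x
      proof -
        have "x ^ q = (x ^ p) ^ (q div p)" using pq by (simp add: mult.commute flip: power_mult)
        then show ?thesis using roots that by auto
      qed
      obtain \<sigma> where "\<sigma> \<in> inertia_group Fp F (u i)" "\<sigma> ?s \<noteq> ?s"
        using S.tame_inertia[OF pro p2 vu(2) char rp s unif] by blast
      then show ?thesis unfolding ZT_val(2)[OF True] by blast
    next
      case False
      then have io: "i \<in> Jord" using IJ[OF i] by blast
      then have p_eq: "p = 2" using Jord by blast
      have RR: "subfield (R i) \<Omega>" "F \<subseteq> R i" "R i \<subseteq> Fp" "ordering_extends_to F (P i) (R i)"
        using R[OF io] by (auto simp: relative_real_closure_def)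
      obtain Q where Q: "field_ordering (R i) Q" "Q \<inter> F = P i"
        using RR(4) by (auto simp: ordering_extends_to_def)
      note ordR = field_ordering_squares[OF Q(1) RR(1)]
      have "?s \<notin> R i"
      proof
        assume sR: "?s \<in> R i"
        have "?s \<noteq> 0"
        proof
          assume "?s = 0"
          then have "0 ^ p = t i" using s(2) by (simp only:)
          then show False using ti(2) p2 by (simp add: power_0_left)
        qed
        then have "t i \<in> Q" using ordR(3)[OF sR] s(2) p_eq by simp
        moreover have "- t i \<in> Q" using t(3)[of i] i io Q(2) by blast
        ultimately show False using ordR(1,2) by fastforce
      qed
      then obtain \<sigma> where "\<sigma> \<in> carrier (galois_group Fp (R i))" "\<sigma> ?s \<noteq> ?s"
        using S.moved_over_intermediate[OF RR(1-3) s(1)] by blast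
      then show ?thesis unfolding ZT_ord(2)[OF io] by blast
    qed
  qed

  \<comment> \<open>The value at the identity can be read off from the local condition at any index of \<open>I\<close>.\<close>
  have \<rho>_one: "\<rho> (c \<one>\<^bsub>?G\<^esub>) = 1\<^sub>m (n + 1)"
  proof -
    have i: "ix 0 \<in> I" using I(1,2) by (auto simp: bij_betw_def)
    obtain r where r: "r \<in> Fp" "r \<noteq> 0" "\<And>\<sigma>. kummer_map Fp q (t (ix 0)) \<sigma> = \<sigma> r / r"
      using radical[OF i] by blast
    have one: "\<one>\<^bsub>?G\<^esub> \<in> T (ix 0)" using T[OF IJ[OF i]] by blast
    have "kummer_map Fp q (t (ix 0)) \<one>\<^bsub>?G\<^esub> = 1" using r S.one_apply by simp
    then have "\<pi> (ix 0) \<one>\<^bsub>?G\<^esub> = 1\<^sub>m (n + 1)"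
      using \<pi>[OF _ one] I(1) \<phi>_one by (auto simp: elementary_matrix_def)
    then show ?thesis using \<rho>_loc[OF i one] by simp
  qed
  \<comment> \<open>The kernel of the composite of the quotient map and \<open>\<rho>\<close>, whose fixed field is \<open>E\<close>.\<close>
  define KK where "KK = {\<sigma> \<in> S.Gal. \<rho> (c \<sigma>) = 1\<^sub>m (n + 1)}"
  have E': "E = fixed_field Fp KK"
    using E unfolding G by (simp add: KK_def c_def unipotent_group_def)
  have \<rho>_inv: "\<rho> (c (inv\<^bsub>?G\<^esub> \<sigma>)) * \<rho> (c \<sigma>) = 1\<^sub>m (n + 1)" "\<rho> (c \<sigma>) * \<rho> (c (inv\<^bsub>?G\<^esub> \<sigma>)) = 1\<^sub>m (n + 1)"
    if "\<sigma> \<in> S.Gal" for \<sigma>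
    using \<rho>_mult[of "inv\<^bsub>?G\<^esub> \<sigma>" \<sigma>] \<rho>_mult[of \<sigma> "inv\<^bsub>?G\<^esub> \<sigma>"] that \<rho>_one by simp_all
  have KK_normal: "KK \<lhd> ?G"
  proof (subst S.G.normal_inv_iff, intro conjI ballI)
    show "subgroup KK ?G"
    proof (rule S.G.subgroupI)
      show "KK \<subseteq> S.Gal" by (auto simp: KK_def)
      show "KK \<noteq> {}" using \<rho>_one S.G.one_closed unfolding KK_def by blast
      show "inv\<^bsub>?G\<^esub> \<sigma> \<in> KK" if "\<sigma> \<in> KK" for \<sigma>
      proof -
        have s: "\<sigma> \<in> S.Gal" "\<rho> (c \<sigma>) = 1\<^sub>m (n + 1)" using that by (auto simp: KK_def)
        then have "\<rho> (c (inv\<^bsub>?G\<^esub> \<sigma>)) = 1\<^sub>m (n + 1)"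
          using \<rho>_inv(1)[OF s(1)] \<rho>_carrier[of "inv\<^bsub>?G\<^esub> \<sigma>"] by simp
        then show ?thesis using s(1) by (simp add: KK_def)
      qed
      show "\<sigma> \<otimes>\<^bsub>?G\<^esub> \<tau> \<in> KK" if "\<sigma> \<in> KK" "\<tau> \<in> KK" for \<sigma> \<tau>
        using that \<rho>_mult[of \<sigma> \<tau>] by (simp add: KK_def)
    qed
    fix \<sigma> \<kappa> assume *: "\<sigma> \<in> S.Gal" "\<kappa> \<in> KK"
    then have \<kappa>: "\<kappa> \<in> S.Gal" "\<rho> (c \<kappa>) = 1\<^sub>m (n + 1)" by (auto simp: KK_def)
    have i: "inv\<^bsub>?G\<^esub> \<sigma> \<in> S.Gal" using *(1) by simp
    have "\<rho> (c (\<sigma> \<otimes>\<^bsub>?G\<^esub> \<kappa> \<otimes>\<^bsub>?G\<^esub> inv\<^bsub>?G\<^esub> \<sigma>)) = 1\<^sub>m (n + 1)"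
      using \<rho>_mult[OF S.G.m_closed[OF *(1) \<kappa>(1)] i] \<rho>_mult[OF *(1) \<kappa>(1)] \<kappa>(2) \<rho>_carrier[OF *(1)] \<rho>_inv(2)[OF *(1)]
      by simp
    then show "\<sigma> \<otimes>\<^bsub>?G\<^esub> \<kappa> \<otimes>\<^bsub>?G\<^esub> inv\<^bsub>?G\<^esub> \<sigma> \<in> KK" using *(1) \<kappa>(1) by (simp add: KK_def)
  qed
  have KK_open: "openin (krull_topology Fp F) KK"
  proof -
    let ?Q = "quotient_topology ?G (krull_topology Fp F) N"
    note oq = openin_quotient_topology[OF N.normal_axioms, of "krull_topology Fp F"]
    have un: "\<Union>(carrier (?G Mod N)) = S.Gal"
      using S.G.rcosets_part_G[OF N.subgroup_axioms] by (simp add: FactGroup_def)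
    have "openin ?Q (carrier (?G Mod N))"
      unfolding oq un using S.openin_krull_Gal(1) by simp
    moreover have "topspace ?Q \<subseteq> carrier (?G Mod N)" using openin_topspace[of ?Q] oq by blast
    ultimately have top: "topspace ?Q = carrier (?G Mod N)" using openin_subset by blast
    have "(1\<^sub>m (n + 1) :: 'q mod_ring mat) \<in> carrier (unipotent_group n)"
      using hom_in_carrier[OF \<rho>_hom c_carrier[OF S.G.one_closed]] \<rho>_one by simp
    then have "openin ?Q {C \<in> topspace ?Q. \<rho> C \<in> {1\<^sub>m (n + 1)}}"
      by (intro openin_continuous_map_preimage[OF \<rho>_cont]) simp
    then have "openin (krull_topology Fp F) (\<Union>{C \<in> carrier (?G Mod N). \<rho> C = 1\<^sub>m (n + 1)})"
      unfolding oq top by simp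
    also have "\<Union>{C \<in> carrier (?G Mod N). \<rho> C = 1\<^sub>m (n + 1)} = KK"
    proof
      show "KK \<subseteq> \<Union>{C \<in> carrier (?G Mod N). \<rho> C = 1\<^sub>m (n + 1)}"
      proof
        fix \<sigma> assume "\<sigma> \<in> KK"
        then have "\<sigma> \<in> S.Gal" "\<rho> (c \<sigma>) = 1\<^sub>m (n + 1)" by (auto simp: KK_def)
        moreover from this have "\<sigma> \<in> c \<sigma>" unfolding c_def by (intro S.G.rcos_self N.subgroup_axioms)
        ultimately show "\<sigma> \<in> \<Union>{C \<in> carrier (?G Mod N). \<rho> C = 1\<^sub>m (n + 1)}" using c_carrier by blast
      qed
      show "\<Union>{C \<in> carrier (?G Mod N). \<rho> C = 1\<^sub>m (n + 1)} \<subseteq> KK"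
      proof
        fix \<sigma> assume "\<sigma> \<in> \<Union>{C \<in> carrier (?G Mod N). \<rho> C = 1\<^sub>m (n + 1)}"
        then obtain C where C: "C \<in> carrier (?G Mod N)" "\<rho> C = 1\<^sub>m (n + 1)" "\<sigma> \<in> C" by blast
        then obtain \<tau> where \<tau>: "\<tau> \<in> S.Gal" "C = c \<tau>" by (auto simp: FactGroup_def RCOSETS_def c_def)
        have "C = c \<sigma>"
          using S.G.repr_independence[OF _ \<tau>(1) N.subgroup_axioms, of \<sigma>] C(3) \<tau>(2) by (simp add: c_def)
        moreover have "\<sigma> \<in> S.Gal" using C un by blast
        ultimately show "\<sigma> \<in> KK" using C(2) by (simp add: KK_def)
      qed
    qed
    finally show ?thesis .
  qed
  have KK_iff: "\<sigma> \<in> KK \<longleftrightarrow> (\<forall>x\<in>E. \<sigma> x = x)" if "\<sigma> \<in> S.Gal" for \<sigma>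
  proof
    show "\<sigma> \<in> KK \<Longrightarrow> \<forall>x\<in>E. \<sigma> x = x" unfolding E' fixed_field_def by blast
    assume fix_E: "\<forall>x\<in>E. \<sigma> x = x"
    show "\<sigma> \<in> KK"
      by (rule S.fixed_field_open_subgroup[OF normal_imp_subgroup[OF KK_normal] KK_open that])
        (use fix_E in \<open>simp add: E'\<close>)
  qed
  have EL: "E \<subseteq> Fp" unfolding E' fixed_field_def by blast
  have restrict_iff: "restrict \<sigma> E = restrict \<tau> E \<longleftrightarrow> \<rho> (c \<sigma>) = \<rho> (c \<tau>)"
    if st: "\<sigma> \<in> S.Gal" "\<tau> \<in> S.Gal" for \<sigma> \<tau>
  proof -
    let ?i = "inv\<^bsub>?G\<^esub> \<sigma>"
    have i: "?i \<in> S.Gal" "?i \<otimes>\<^bsub>?G\<^esub> \<tau> \<in> S.Gal" using st by auto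
    have "restrict \<sigma> E = restrict \<tau> E \<longleftrightarrow> (\<forall>x\<in>E. (?i \<otimes>\<^bsub>?G\<^esub> \<tau>) x = x)"
    proof -
      have "\<sigma> x = \<tau> x \<longleftrightarrow> (?i \<otimes>\<^bsub>?G\<^esub> \<tau>) x = x" if x: "x \<in> E" for x
      proof -
        have xL: "x \<in> Fp" using EL x by blast
        have "(?i \<otimes>\<^bsub>?G\<^esub> \<tau>) x = ?i (\<tau> x)" by (rule S.comp_apply[OF i(1) st(2) xL])
        moreover have "?i (\<sigma> x) = x" by (rule S.app_inv(2)[OF st(1) xL])
        ultimately show ?thesis
          using S.app_inj[OF i(1) S.app_closed[OF st(1) xL] S.app_closed[OF st(2) xL]] by auto
      qed
      then show ?thesis by (auto simp: restrict_def fun_eq_iff)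
    qed
    also have "\<dots> \<longleftrightarrow> \<rho> (c (?i \<otimes>\<^bsub>?G\<^esub> \<tau>)) = 1\<^sub>m (n + 1)"
      using KK_iff[OF i(2)] i(2) by (simp add: KK_def)
    also have "\<dots> \<longleftrightarrow> \<rho> (c ?i) * \<rho> (c \<tau>) = 1\<^sub>m (n + 1)" using \<rho>_mult[OF i(1) st(2)] by simp
    also have "\<dots> \<longleftrightarrow> \<rho> (c \<sigma>) = \<rho> (c \<tau>)"
    proof
      assume *: "\<rho> (c ?i) * \<rho> (c \<tau>) = 1\<^sub>m (n + 1)"
      have "\<rho> (c \<tau>) = \<rho> (c \<sigma>) * \<rho> (c ?i) * \<rho> (c \<tau>)"
        using \<rho>_inv(2)[OF st(1)] \<rho>_carrier[OF st(2)] by simp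
      also have "\<dots> = \<rho> (c \<sigma>) * (\<rho> (c ?i) * \<rho> (c \<tau>))"
        by (rule assoc_mult_mat[OF \<rho>_carrier[OF st(1)] \<rho>_carrier[OF i(1)] \<rho>_carrier[OF st(2)]])
      also have "\<dots> = \<rho> (c \<sigma>)" using * \<rho>_carrier[OF st(1)] by simp
      finally show "\<rho> (c \<sigma>) = \<rho> (c \<tau>)" by simp
    next
      assume "\<rho> (c \<sigma>) = \<rho> (c \<tau>)"
      then show "\<rho> (c ?i) * \<rho> (c \<tau>) = 1\<^sub>m (n + 1)" using \<rho>_inv(1)[OF st(1)] by simp
    qed
    finally show ?thesis .
  qed

  have part_a: "\<not> unramified_in (T i) E \<and>
      ((galois_group E F)\<lparr>carrier := (\<lambda>\<sigma>. restrict \<sigma> E) ` T i\<rparr>) \<cong> integer_mod_group q" if i: "i \<in> I" for i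
  proof -
    obtain l where l: "l < n" "ix l = i" using I(2) i by (auto simp: bij_betw_def)
    obtain r where r: "r \<in> Fp" "r ^ q = t i" "r \<noteq> 0" "\<And>\<sigma>. kummer_map Fp q (t i) \<sigma> = \<sigma> r / r"
      using radical[OF i] by blast
    have ti: "t i \<in> F" using t(1)[OF i] by blast
    have Ti: "T i \<subseteq> S.Gal" "\<one>\<^bsub>?G\<^esub> \<in> T i" "\<And>\<sigma> \<tau>. \<sigma> \<in> T i \<Longrightarrow> \<tau> \<in> T i \<Longrightarrow> \<sigma> \<otimes>\<^bsub>?G\<^esub> \<tau> \<in> T i"
      using T[OF IJ[OF i]] by blast+
    have TiG: "\<sigma> \<in> S.Gal" if "\<sigma> \<in> T i" for \<sigma> using that Ti(1) by blast
    obtain \<tau>0 where \<tau>0: "\<tau>0 \<in> T i" "\<tau>0 (r ^ (q div p)) \<noteq> r ^ (q div p)" using moved[OF i r(1,2)] by blast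
    have surj: "(\<lambda>\<sigma>. \<sigma> r / r) ` T i = {x. x ^ q = 1}"
      by (rule S.kummer_surjective[OF p k q(1) z r(1,2) ti r(3) Ti \<tau>0])
    note kc = S.kummer_character[OF roots r(1,2) ti r(3)]
    define g where "g \<sigma> = to_int_mod_ring (\<phi> (\<sigma> r / r))" for \<sigma> :: "'a \<Rightarrow> 'a"
    have g_mult: "g (\<sigma> \<otimes>\<^bsub>?G\<^esub> \<tau>) = g \<sigma> \<otimes>\<^bsub>integer_mod_group q\<^esub> g \<tau>" if "\<sigma> \<in> T i" "\<tau> \<in> T i" for \<sigma> \<tau>
    proof -
      have s: "\<sigma> \<in> S.Gal" "\<tau> \<in> S.Gal" using that TiG by blast+
      show ?thesis
        unfolding g_def kc(3)[OF s] \<phi>_hom[OF kc(1)[OF s(1)] kc(1)[OF s(2)]] to_int_mod_ring_add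
        using q0 q(3) by (simp add: integer_mod_group_def)
    qed
    have onto: "g ` T i = carrier (integer_mod_group q)"
    proof -
      have "g ` T i = to_int_mod_ring ` \<phi> ` (\<lambda>\<sigma>. \<sigma> r / r) ` T i" by (simp add: g_def image_image)
      also have "\<dots> = range (to_int_mod_ring :: 'q mod_ring \<Rightarrow> int)"
        unfolding surj using \<phi>_bij by (simp add: bij_betw_def)
      finally show ?thesis using range_to_int_mod_ring[where 'a = 'q] q0 q(3) by (simp add: carrier_integer_mod_group)
    qed
    have pi_eq: "\<pi> i \<sigma> = 1\<^sub>m (n + 1) + \<phi> (\<sigma> r / r) \<cdot>\<^sub>m elementary_matrix (n + 1) l (l + 1)" if "\<sigma> \<in> T i" for \<sigma>
      using \<pi>[OF l(1), of \<sigma>] that l(2) r(4) by simp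
    have pi_entry: "\<pi> i \<sigma> $$ (l, l + 1) = \<phi> (\<sigma> r / r)" if "\<sigma> \<in> T i" for \<sigma>
      unfolding pi_eq[OF that] using l(1) by (simp add: elementary_matrix_def)
    have fibres: "restrict \<sigma> E = restrict \<tau> E \<longleftrightarrow> g \<sigma> = g \<tau>" if "\<sigma> \<in> T i" "\<tau> \<in> T i" for \<sigma> \<tau>
    proof -
      have "restrict \<sigma> E = restrict \<tau> E \<longleftrightarrow> \<pi> i \<sigma> = \<pi> i \<tau>"
        using restrict_iff[OF TiG[OF that(1)] TiG[OF that(2)]] \<rho>_loc[OF i that(1)] \<rho>_loc[OF i that(2)] by simp
      also have "\<dots> \<longleftrightarrow> \<phi> (\<sigma> r / r) = \<phi> (\<tau> r / r)"
        using pi_entry[OF that(1)] pi_entry[OF that(2)] pi_eq[OF that(1)] pi_eq[OF that(2)] by metis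
      also have "\<dots> \<longleftrightarrow> g \<sigma> = g \<tau>" by (simp add: g_def)
      finally show ?thesis .
    qed
    have "((galois_group E F)\<lparr>carrier := (\<lambda>\<sigma>. restrict \<sigma> E) ` T i\<rparr>) \<cong> integer_mod_group q"
    proof (rule is_iso_of_same_fibres[where op = "\<lambda>\<sigma> \<tau>. \<sigma> \<otimes>\<^bsub>?G\<^esub> \<tau>" and g = g])
      show "restrict (\<sigma> \<otimes>\<^bsub>?G\<^esub> \<tau>) E = restrict \<sigma> E \<otimes>\<^bsub>galois_group E F\<^esub> restrict \<tau> E" if "\<sigma> \<in> T i" "\<tau> \<in> T i" for \<sigma> \<tau>
        unfolding E' by (rule S.restrict_to_fixed_field(2)[OF KK_normal TiG[OF that(1)] TiG[OF that(2)]])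
    qed (use Ti(3) g_mult fibres onto in blast)+
    moreover have "\<not> unramified_in (T i) E"
    proof
      assume "unramified_in (T i) E"
      then have fix_E: "\<sigma> x = x" if "\<sigma> \<in> T i" "x \<in> E" for \<sigma> x
        using that unfolding unramified_in_def by blast
      have const: "g \<sigma> = g \<tau>" if "\<sigma> \<in> T i" "\<tau> \<in> T i" for \<sigma> \<tau>
      proof -
        have "restrict \<sigma> E = restrict \<tau> E"
          by (rule restrict_ext) (simp only: fix_E[OF that(1)] fix_E[OF that(2)])
        then show ?thesis using fibres[OF that] by simp
      qed
      have "0 \<in> g ` T i" "1 \<in> g ` T i"
        unfolding onto using q(1) by (simp_all add: carrier_integer_mod_group)
      then obtain \<sigma> \<tau> where st: "\<sigma> \<in> T i" "\<tau> \<in> T i" "0 = g \<sigma>" "1 = g \<tau>" by blast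
      from const[OF st(1,2)] st(3,4) show False by simp
    qed
    ultimately show ?thesis by blast
  qed

  have part_b: "unramified_in (T j) E" if j: "j \<in> (Jval \<union> Jord) - Ihat" for j
    unfolding unramified_in_def
  proof (intro ballI)
    fix \<sigma> x assume *: "\<sigma> \<in> T j" "x \<in> E"
    have \<sigma>: "\<sigma> \<in> N" "\<sigma> \<in> S.Gal" using *(1) TN[OF j] N.subset by blast+
    have "c \<sigma> = N" "c \<one>\<^bsub>?G\<^esub> = N"
      unfolding c_def using S.G.coset_join2[OF _ N.subgroup_axioms] \<sigma> N.one_closed by auto
    then have "\<rho> (c \<sigma>) = 1\<^sub>m (n + 1)" using \<rho>_one by simp
    then have "\<sigma> \<in> KK" using \<sigma> by (simp add: KK_def)
    then show "\<sigma> x = x" using KK_iff[OF \<sigma>(2)] *(2) by blast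
  qed
  show ?thesis using part_a part_b by blast
qed

end
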